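(* Let $X$ be a compact complex manifold of dimension $n$ whose universal cover is biholomorphic to $(\mathbb{P}^1)^n$ or to $\mathbb{H}^n$. Then $X$ admits a semi special tensor, i.e. there exist an invertible sheaf $\eta$ on $X$ with $\eta^2 \cong \mathcal{O}_X$ and a non-zero section $0 \neq \omega \in H^0(X, S^n\Omega^1_X(-K_X)\otimes \eta)$.
   Context: $\mathbb{H} = \{\tau\in\mathbb{C} : \operatorname{Im}(\tau)>0\}$ is the upper half-plane and $\mathbb{P}^1=\mathbb{P}^1(\mathbb{C})$. Manifolds are connected. For a complex manifold $X$ of dimension $n$, $\Omega^1_X$ is the holomorphic cotangent bundle, $S^n\Omega^1_X$ its $n$-th symmetric power, $K_X$ the canonical divisor ($\mathcal{O}_X(K_X)=\Omega^n_X$), and $S^n\Omega^1_X(-K_X)=S^n\Omega^1_X\otimes\mathcal{O}_X(-K_X)$. A semi special tensor on $X$ is a non-zero section of $S^n\Omega^1_X(-K_X)\otimes\eta$ for some invertible sheaf $\eta$ with $\eta^2\cong\mathcal{O}_X$ ($\eta$ may be trivial). *)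

theory Defs
  imports "HOL-Analysis.Analysis"
begin

section \<open>Holomorphic functions of several variables\<close>

text \<open>These are meant for open sets \<open>S\<close>. Holomorphic means complex differentiable at every
  point: the real derivative exists and is complex linear.\<close>

definition holo_on :: "(complex ^ 'n::finite \<Rightarrow> complex) \<Rightarrow> (complex ^ 'n) set \<Rightarrow> bool" where
  "holo_on f S \<longleftrightarrow>
     (\<forall>z\<in>S. \<exists>a :: complex ^ 'n. (f has_derivative (\<lambda>v. \<Sum>i\<in>UNIV. a $ i * v $ i)) (at z))"

definition holo_vec_on ::
    "(complex ^ 'n::finite \<Rightarrow> complex ^ 'm::finite) \<Rightarrow> (complex ^ 'n) set \<Rightarrow> bool" where
  "holo_vec_on F S \<longleftrightarrow> (\<forall>j. holo_on (\<lambda>z. F z $ j) S)"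

definition jacobian_at ::
    "(complex ^ 'n::finite \<Rightarrow> complex ^ 'm::finite) \<Rightarrow> complex ^ 'n \<Rightarrow> complex ^ 'n ^ 'm" where
  "jacobian_at F z = matrix (frechet_derivative F (at z))"


section \<open>Complex manifolds\<close>

text \<open>A chart is a pair of its domain and its coordinate map, whose values outside the domain
  are irrelevant. The underlying space of a manifold is a subset of a topological type, with
  the subspace topology. The complex dimension is \<open>CARD('n)\<close>.\<close>

type_synonym ('a, 'n) chart = "'a set \<times> ('a \<Rightarrow> complex ^ 'n)"

record ('a, 'n) mfd =
  points :: "'a set"
  atlas :: "('a, 'n::finite) chart set"

abbreviation mtop :: "('a::topological_space, 'n::finite) mfd \<Rightarrow> 'a topology" where
  "mtop X \<equiv> top_of_set (points X)"

definition chart_inv :: "('a, 'n::finite) chart \<Rightarrow> complex ^ 'n \<Rightarrow> 'a" where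
  "chart_inv \<phi> = inv_into (fst \<phi>) (snd \<phi>)"

definition transition ::
    "('a, 'n::finite) chart \<Rightarrow> ('a, 'n) chart \<Rightarrow> complex ^ 'n \<Rightarrow> complex ^ 'n" where
  "transition \<phi> \<psi> = snd \<psi> \<circ> chart_inv \<phi>"

definition complex_manifold :: "('a::topological_space, 'n::finite) mfd \<Rightarrow> bool" where
  "complex_manifold X \<longleftrightarrow>
     points X \<noteq> {} \<and> connected (points X) \<and>
     Hausdorff_space (mtop X) \<and> second_countable (mtop X) \<and>
     \<Union>(fst ` atlas X) = points X \<and>
     (\<forall>\<phi>\<in>atlas X. openin (mtop X) (fst \<phi>) \<and> open (snd \<phi> ` fst \<phi>) \<and>
        homeomorphism (fst \<phi>) (snd \<phi> ` fst \<phi>) (snd \<phi>) (chart_inv \<phi>)) \<and>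
     (\<forall>\<phi>\<in>atlas X. \<forall>\<psi>\<in>atlas X.
        holo_vec_on (transition \<phi> \<psi>) (snd \<phi> ` (fst \<phi> \<inter> fst \<psi>)))"

definition mfd_restrict :: "('a, 'n::finite) mfd \<Rightarrow> 'a set \<Rightarrow> ('a, 'n) mfd" where
  "mfd_restrict X W =
     \<lparr> points = points X \<inter> W, atlas = {(fst \<phi> \<inter> W, snd \<phi>) | \<phi>. \<phi> \<in> atlas X} \<rparr>"

definition holo_map :: "('a::topological_space, 'n::finite) mfd \<Rightarrow>
    ('b::topological_space, 'm::finite) mfd \<Rightarrow> ('a \<Rightarrow> 'b) \<Rightarrow> bool" where
  "holo_map X Y f \<longleftrightarrow>
     f ` points X \<subseteq> points Y \<and> continuous_on (points X) f \<and>
     (\<forall>\<phi>\<in>atlas X. \<forall>\<psi>\<in>atlas Y.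
        holo_vec_on (snd \<psi> \<circ> f \<circ> chart_inv \<phi>) (snd \<phi> ` (fst \<phi> \<inter> f -` fst \<psi>)))"

definition biholo_map :: "('a::topological_space, 'n::finite) mfd \<Rightarrow>
    ('b::topological_space, 'm::finite) mfd \<Rightarrow> ('a \<Rightarrow> 'b) \<Rightarrow> bool" where
  "biholo_map X Y f \<longleftrightarrow>
     holo_map X Y f \<and>
     (\<exists>g. holo_map Y X g \<and> (\<forall>x\<in>points X. g (f x) = x) \<and> (\<forall>y\<in>points Y. f (g y) = y))"

definition biholomorphic :: "('a::topological_space, 'n::finite) mfd \<Rightarrow>
    ('b::topological_space, 'm::finite) mfd \<Rightarrow> bool" where
  "biholomorphic X Y \<longleftrightarrow> (\<exists>f. biholo_map X Y f)"

definition locally_biholo_map :: "('a::topological_space, 'n::finite) mfd \<Rightarrow>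
    ('b::topological_space, 'n) mfd \<Rightarrow> ('a \<Rightarrow> 'b) \<Rightarrow> bool" where
  "locally_biholo_map X Y f \<longleftrightarrow>
     (\<forall>x\<in>points X. \<exists>W. x \<in> W \<and> openin (mtop X) W \<and> openin (mtop Y) (f ` W) \<and>
        biholo_map (mfd_restrict X W) (mfd_restrict Y (f ` W)) f)"

definition universal_cover :: "('b::topological_space, 'n::finite) mfd \<Rightarrow> ('b \<Rightarrow> 'a) \<Rightarrow>
    ('a::topological_space, 'n) mfd \<Rightarrow> bool" where
  "universal_cover Y p X \<longleftrightarrow>
     complex_manifold Y \<and> simply_connected (points Y) \<and>
     covering_space (points Y) p (points X) \<and> locally_biholo_map Y X p"

text \<open>The product of \<open>CARD('n)\<close> copies of a one-dimensional manifold.\<close>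

definition mfd_power :: "('a, 1) mfd \<Rightarrow> ('a ^ 'n::finite, 'n) mfd" where
  "mfd_power M =
     \<lparr> points = {p. \<forall>i. p $ i \<in> points M},
       atlas = {({p. \<forall>i. p $ i \<in> fst (c i)}, \<lambda>p. \<chi> i. snd (c i) (p $ i) $ 1) | c.
                  \<forall>i. c i \<in> atlas M} \<rparr>"


section \<open>The upper half-plane and the projective line\<close>

definition upper_half_plane :: "(complex, 1) mfd" where
  "upper_half_plane =
     \<lparr> points = {\<tau>. 0 < Im \<tau>}, atlas = {({\<tau>. 0 < Im \<tau>}, \<lambda>\<tau>. \<chi> i. \<tau>)} \<rparr>"

text \<open>The projective line is the quotient of the nonzero vectors of \<open>\<complex>\<^sup>2\<close> by scaling, with the
  quotient topology; \<open>proj_pt (z, w)\<close> is the point \<open>[z : w]\<close>.\<close>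

definition proj_rel :: "complex \<times> complex \<Rightarrow> complex \<times> complex \<Rightarrow> bool" where
  "proj_rel u v \<longleftrightarrow> u \<noteq> 0 \<and> (\<exists>c. c \<noteq> 0 \<and> v = (c * fst u, c * snd u))"

lemma proj_rel_part_equivp: "part_equivp proj_rel"
proof (rule part_equivpI)
  show "\<exists>u. proj_rel u u"
    by (rule exI[of _ "(1, 0)"]) (auto simp: proj_rel_def zero_prod_def intro!: exI[of _ 1])
  show "symp proj_rel"
  proof (rule sympI)
    fix u v assume "proj_rel u v"
    then obtain c where c: "u \<noteq> 0" "c \<noteq> 0" "v = (c * fst u, c * snd u)"
      by (auto simp: proj_rel_def)
    then show "proj_rel v u"
      unfolding proj_rel_def
      by (intro conjI exI[of _ "inverse c"]) (auto simp: prod_eq_iff)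
  qed
  show "transp proj_rel"
  proof (rule transpI)
    fix u v w assume "proj_rel u v" "proj_rel v w"
    then obtain c d where "u \<noteq> 0" "c \<noteq> 0" "d \<noteq> 0" "v = (c * fst u, c * snd u)"
      "w = (d * fst v, d * snd v)"
      by (auto simp: proj_rel_def)
    then show "proj_rel u w"
      unfolding proj_rel_def by (intro conjI exI[of _ "d * c"]) (auto simp: mult.assoc)
  qed
qed

quotient_type proj_line = "complex \<times> complex" / partial: proj_rel
  morphisms rep_proj_line proj_pt
  by (rule proj_rel_part_equivp)

instantiation proj_line :: topological_space
begin

definition open_proj_line :: "proj_line set \<Rightarrow> bool" where
  "open_proj_line U \<longleftrightarrow> open {v. v \<noteq> 0 \<and> proj_pt v \<in> U}"

instance
proof
  have eq: "{v :: complex \<times> complex. v \<noteq> 0} = - {0}"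
    by auto
  show "open (UNIV :: proj_line set)"
    by (simp add: open_proj_line_def eq open_Compl)
next
  fix S T :: "proj_line set" assume "open S" "open T"
  moreover have "{v. v \<noteq> 0 \<and> proj_pt v \<in> S \<inter> T} =
      {v. v \<noteq> 0 \<and> proj_pt v \<in> S} \<inter> {v. v \<noteq> 0 \<and> proj_pt v \<in> T}"
    by auto
  ultimately show "open (S \<inter> T)"
    by (simp only: open_proj_line_def open_Int)
next
  fix K :: "proj_line set set" assume "\<forall>S\<in>K. open S"
  moreover have "{v. v \<noteq> 0 \<and> proj_pt v \<in> \<Union>K} = (\<Union>S\<in>K. {v. v \<noteq> 0 \<and> proj_pt v \<in> S})"
    by auto
  ultimately show "open (\<Union>K)"
    by (simp only: open_proj_line_def) (rule open_UN, blast)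
qed

end

lift_definition proj_ratio :: "proj_line \<Rightarrow> complex" is "\<lambda>v. fst v / snd v"
  by (auto simp: proj_rel_def)

lift_definition proj_ratio' :: "proj_line \<Rightarrow> complex" is "\<lambda>v. snd v / fst v"
  by (auto simp: proj_rel_def)

definition projective_line :: "(proj_line, 1) mfd" where
  "projective_line =
     \<lparr> points = UNIV,
       atlas = {(range (\<lambda>t. proj_pt (t, 1)), \<lambda>p. \<chi> i. proj_ratio p),
                (range (\<lambda>t. proj_pt (1, t)), \<lambda>p. \<chi> i. proj_ratio' p)} \<rparr>"


section \<open>Invertible sheaves\<close>

text \<open>An invertible sheaf is given as a holomorphic line bundle by an open cover \<open>lb_dom i\<close>
  and transition functions \<open>g i j = lb_trans i j\<close>: a section is a family of functions \<open>s i\<close> on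
  \<open>lb_dom i\<close> with \<open>s i = g i j * s j\<close> on the overlaps. Equivalently, local generators \<open>e i\<close>
  satisfy \<open>e j = g i j * e i\<close>. A cover indexed by the points of \<open>X\<close> is no restriction: choose a
  trivialising neighbourhood of every point.\<close>

definition holo_fun ::
    "('a::topological_space, 'n::finite) mfd \<Rightarrow> 'a set \<Rightarrow> ('a \<Rightarrow> complex) \<Rightarrow> bool" where
  "holo_fun X W f \<longleftrightarrow> (\<forall>\<phi>\<in>atlas X. holo_on (f \<circ> chart_inv \<phi>) (snd \<phi> ` (fst \<phi> \<inter> W)))"

record ('a, 'i) line_bundle =
  lb_index :: "'i set"
  lb_dom :: "'i \<Rightarrow> 'a set"
  lb_trans :: "'i \<Rightarrow> 'i \<Rightarrow> 'a \<Rightarrow> complex"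

definition holo_line_bundle ::
    "('a::topological_space, 'n::finite) mfd \<Rightarrow> ('a, 'i) line_bundle \<Rightarrow> bool" where
  "holo_line_bundle X L \<longleftrightarrow>
     (\<forall>i\<in>lb_index L. openin (mtop X) (lb_dom L i)) \<and>
     (\<Union>i\<in>lb_index L. lb_dom L i) = points X \<and>
     (\<forall>i\<in>lb_index L. \<forall>j\<in>lb_index L.
        holo_fun X (lb_dom L i \<inter> lb_dom L j) (lb_trans L i j) \<and>
        (\<forall>x\<in>lb_dom L i \<inter> lb_dom L j. lb_trans L i j x \<noteq> 0)) \<and>
     (\<forall>i\<in>lb_index L. \<forall>j\<in>lb_index L. \<forall>k\<in>lb_index L.
        \<forall>x\<in>lb_dom L i \<inter> lb_dom L j \<inter> lb_dom L k.
          lb_trans L i j x * lb_trans L j k x = lb_trans L i k x)"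

definition lb_trivial :: "('a, 'n::finite) mfd \<Rightarrow> ('a, unit) line_bundle" where
  "lb_trivial X = \<lparr> lb_index = UNIV, lb_dom = (\<lambda>_. points X), lb_trans = (\<lambda>_ _ _. 1) \<rparr>"

definition lb_tensor ::
    "('a, 'i) line_bundle \<Rightarrow> ('a, 'j) line_bundle \<Rightarrow> ('a, 'i \<times> 'j) line_bundle" where
  "lb_tensor L M =
     \<lparr> lb_index = lb_index L \<times> lb_index M,
       lb_dom = (\<lambda>(i, j). lb_dom L i \<inter> lb_dom M j),
       lb_trans = (\<lambda>(i, j) (i', j') x. lb_trans L i i' x * lb_trans M j j' x) \<rparr>"

definition lb_dual :: "('a, 'i) line_bundle \<Rightarrow> ('a, 'i) line_bundle" where
  "lb_dual L = L\<lparr> lb_trans := (\<lambda>i j x. inverse (lb_trans L i j x)) \<rparr>"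

text \<open>An isomorphism sends the local section \<open>s i\<close> of \<open>L\<close> to \<open>h i j * s i\<close> in the trivialisation
  \<open>j\<close> of \<open>M\<close>; the last condition says that these fit together.\<close>

definition lb_iso :: "('a::topological_space, 'n::finite) mfd \<Rightarrow>
    ('a, 'i) line_bundle \<Rightarrow> ('a, 'j) line_bundle \<Rightarrow> bool" where
  "lb_iso X L M \<longleftrightarrow>
     (\<exists>h :: 'i \<Rightarrow> 'j \<Rightarrow> 'a \<Rightarrow> complex.
        (\<forall>i\<in>lb_index L. \<forall>j\<in>lb_index M.
           holo_fun X (lb_dom L i \<inter> lb_dom M j) (h i j) \<and>
           (\<forall>x\<in>lb_dom L i \<inter> lb_dom M j. h i j x \<noteq> 0)) \<and>
        (\<forall>i\<in>lb_index L. \<forall>i'\<in>lb_index L. \<forall>j\<in>lb_index M. \<forall>j'\<in>lb_index M.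
           \<forall>x\<in>lb_dom L i \<inter> lb_dom L i' \<inter> lb_dom M j \<inter> lb_dom M j'.
             h i j x * lb_trans L i i' x = lb_trans M j j' x * h i' j' x))"

text \<open>\<open>\<O>(K)\<close> is trivialised over a chart \<open>z\<close> by \<open>dz\<^sub>1 \<and> \<dots> \<and> dz\<^sub>n\<close>. If \<open>w\<close> is a second chart then
  \<open>dw\<^sub>1 \<and> \<dots> \<and> dw\<^sub>n = det (\<partial>w/\<partial>z) dz\<^sub>1 \<and> \<dots> \<and> dz\<^sub>n\<close>.\<close>

definition canonical_bundle ::
    "('a, 'n::finite) mfd \<Rightarrow> ('a, ('a, 'n) chart) line_bundle" where
  "canonical_bundle X =
     \<lparr> lb_index = atlas X, lb_dom = fst,
       lb_trans = (\<lambda>\<phi> \<psi> x. det (jacobian_at (transition \<phi> \<psi>) (snd \<phi> x))) \<rparr>"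


section \<open>Symmetric differentials with values in a line bundle\<close>

text \<open>In a chart \<open>z\<close> and a trivialisation \<open>e\<close> of \<open>L\<close>, a section of \<open>S\<^sup>k\<Omega>\<^sup>1 \<otimes> L\<close> is
  \<open>(\<Sum>\<alpha>. c \<alpha> dz\<^sup>\<alpha>) \<otimes> e\<close>, the sum over the multi-indices of total degree \<open>k\<close>. The polynomial in
  \<open>dz\<close> is determined by its values \<open>\<Sum>\<alpha>. c \<alpha> v\<^sup>\<alpha>\<close> on the tangent vectors \<open>v\<close>, so the change of
  coordinates can be expressed by substituting the derivative of the transition map.\<close>

definition multi_indices :: "nat \<Rightarrow> ('n::finite \<Rightarrow> nat) set" where
  "multi_indices k = {\<alpha>. (\<Sum>i\<in>UNIV. \<alpha> i) = k}"

definition sym_eval ::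
    "nat \<Rightarrow> (('n::finite \<Rightarrow> nat) \<Rightarrow> complex) \<Rightarrow> complex ^ 'n \<Rightarrow> complex" where
  "sym_eval k c v = (\<Sum>\<alpha>\<in>multi_indices k. c \<alpha> * (\<Prod>i\<in>UNIV. (v $ i) ^ \<alpha> i))"

type_synonym ('a, 'n, 'i) sym_section =
  "('a, 'n) chart \<Rightarrow> 'i \<Rightarrow> 'a \<Rightarrow> ('n \<Rightarrow> nat) \<Rightarrow> complex"

definition sym_diff_section :: "nat \<Rightarrow> ('a::topological_space, 'n::finite) mfd \<Rightarrow>
    ('a, 'i) line_bundle \<Rightarrow> ('a, 'n, 'i) sym_section \<Rightarrow> bool" where
  "sym_diff_section k X L \<omega> \<longleftrightarrow>
     (\<forall>\<phi>\<in>atlas X. \<forall>i\<in>lb_index L. \<forall>\<alpha>\<in>multi_indices k.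
        holo_fun X (fst \<phi> \<inter> lb_dom L i) (\<lambda>x. \<omega> \<phi> i x \<alpha>)) \<and>
     (\<forall>\<phi>\<in>atlas X. \<forall>\<psi>\<in>atlas X. \<forall>i\<in>lb_index L. \<forall>j\<in>lb_index L.
        \<forall>x\<in>fst \<phi> \<inter> fst \<psi> \<inter> lb_dom L i \<inter> lb_dom L j. \<forall>v.
          sym_eval k (\<omega> \<phi> i x) v =
          lb_trans L i j x *
          sym_eval k (\<omega> \<psi> j x) (jacobian_at (transition \<phi> \<psi>) (snd \<phi> x) *v v))"

definition sym_nonzero :: "nat \<Rightarrow> ('a, 'n::finite) mfd \<Rightarrow> ('a, 'i) line_bundle \<Rightarrow>
    ('a, 'n, 'i) sym_section \<Rightarrow> bool" where
  "sym_nonzero k X L \<omega> \<longleftrightarrow>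
     (\<exists>\<phi>\<in>atlas X. \<exists>i\<in>lb_index L. \<exists>x\<in>fst \<phi> \<inter> lb_dom L i. \<exists>\<alpha>\<in>multi_indices k. \<omega> \<phi> i x \<alpha> \<noteq> 0)"

definition semi_special_tensor :: "('a::topological_space, 'n::finite) mfd \<Rightarrow>
    ('a, 'i) line_bundle \<Rightarrow> ('a, 'n, ('a, 'n) chart \<times> 'i) sym_section \<Rightarrow> bool" where
  "semi_special_tensor X \<eta> \<omega> \<longleftrightarrow>
     holo_line_bundle X \<eta> \<and> lb_iso X (lb_tensor \<eta> \<eta>) (lb_trivial X) \<and>
     sym_diff_section CARD('n) X (lb_tensor (lb_dual (canonical_bundle X)) \<eta>) \<omega> \<and>
     sym_nonzero CARD('n) X (lb_tensor (lb_dual (canonical_bundle X)) \<eta>) \<omega>"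

end

theory Submission
  imports Defs "HOL-Complex_Analysis.Conformal_Mappings"
begin

text \<open>Let \<open>M\<close> be the projective line or the half-plane. In product charts \<open>z\<close> of \<open>M\<^sup>n\<close> consider the
  expression \<open>dz\<^sub>1 \<cdots> dz\<^sub>n / (dz\<^sub>1 \<and> \<dots> \<and> dz\<^sub>n)\<close>, a section of \<open>S\<^sup>n\<Omega>\<^sup>1(-K)\<close>. A change of coordinates, or an
  automorphism of \<open>M\<^sup>n\<close>, whose derivative is a monomial matrix (one nonzero entry in every row and column)
  multiplies numerator and denominator by the product of the nonzero entries, and the denominator in
  addition by the sign of the underlying permutation. So the expression is invariant up to sign. If \<open>M\<^sup>n\<close>
  covers \<open>X\<close> and all deck transformations have monomial derivatives, then the expression descends to
  \<open>X\<close> as a section with values in the bundle \<open>\<eta>\<close> that is given by these signs; a cocycle of signs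
  has trivial square. This is the content of the locale \<open>monomial_coordinates\<close>, whose coordinates
  \<open>\<zeta> a\<close> are those of \<open>M\<^sup>n\<close> composed with local sections of the covering. The coefficients of the section
  are holomorphic because partial derivatives of holomorphic functions are, by Cauchy's formula
  (\<open>holo_on_partial_deriv\<close>).

  Two local sections of the covering differ by a deck transformation, because the covering space is simply
  connected: lifting paths produces a deck transformation between any two points of one fibre
  (\<open>covering_deck_transformation\<close>). It remains to see that the automorphisms of \<open>M\<^sup>n\<close> have monomial
  derivatives.

  For the half-plane, the Schwarz-Pick inequality (\<open>half_plane_schwarz_pick\<close>) says that the derivative,
  rescaled by the imaginary parts of the coordinates of the point and of its image, does not increase the
  maximum norm. The same holds for the inverse, and a linear isometry of the maximum norm is monomial
  (\<open>contraction_inverse_monomial\<close>).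

  For the projective line, let \<open>F\<close> be an automorphism with derivative \<open>D\<close> at \<open>x\<close>, and let \<open>S\<^sub>t\<close> be the
  dilation of the \<open>j\<close>-th factor by \<open>exp t\<close> that fixes \<open>x\<close>. For \<open>i \<noteq> k\<close>, the \<open>i\<close>-th component of
  \<open>F \<circ> S\<^sub>t \<circ> F\<^sup>-\<^sup>1\<close>, restricted to the line through \<open>F x\<close> in the direction of the \<open>k\<close>-th factor, is a map of the
  projective line to itself. It is constant for \<open>t = 0\<close>, so for small \<open>t\<close> its image lies in one affine
  chart, and it is constant by Liouville's theorem. Its derivative at \<open>F x\<close> is
  \<open>(exp t - 1) D\<^sub>i\<^sub>j (D\<^sup>-\<^sup>1)\<^sub>j\<^sub>k\<close>, so \<open>D\<^sub>i\<^sub>j (D\<^sup>-\<^sup>1)\<^sub>j\<^sub>k = 0\<close> whenever \<open>i \<noteq> k\<close>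
  (\<open>proj_line_power_automorphism_entries\<close>), and this forces \<open>D\<close> to be monomial.\<close>

section \<open>Complex differentiability in several variables\<close>

lemma bounded_linear_axis: "bounded_linear (axis j :: 'b::real_normed_vector \<Rightarrow> 'b ^ 'm::finite)"
proof (rule bounded_linear_intro[where K = 1])
  show "axis j (x + y) = axis j x + axis j y" for x y :: 'b
    by (simp add: vec_eq_iff axis_def)
  show "axis j (r *\<^sub>R x) = r *\<^sub>R axis j x" for r and x :: 'b
    by (simp add: vec_eq_iff axis_def)
  show "norm (axis j x :: 'b ^ 'm) \<le> norm x * 1" for x :: 'b
    by (simp add: norm_vec_def axis_def L2_set_def if_distrib[of norm] if_distrib[of "\<lambda>x. x ^ 2"] cong: if_cong)
qed

lemma has_derivative_vec_components:
  fixes f :: "'a::real_normed_vector \<Rightarrow> 'b::real_normed_vector ^ 'm::finite"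
  assumes "\<And>j. ((\<lambda>x. f x $ j) has_derivative (\<lambda>v. f' v $ j)) (at x within S)"
  shows "(f has_derivative f') (at x within S)"
proof -
  have eq: "(\<Sum>j\<in>UNIV. axis j (v $ j)) = v" for v :: "'b ^ 'm"
    by (simp add: vec_eq_iff axis_def sum.delta')
  have "((\<lambda>x. \<Sum>j\<in>UNIV. axis j (f x $ j)) has_derivative (\<lambda>v. \<Sum>j\<in>UNIV. axis j (f' v $ j))) (at x within S)"
    by (intro has_derivative_sum bounded_linear.has_derivative[OF bounded_linear_axis] assms)
  then show ?thesis
    by (simp add: eq)
qed

text \<open>A real derivative of the form \<open>v \<mapsto> D v\<close> with a complex matrix \<open>D\<close> is a complex linear one. Holomorphy of
  maps is used in this form throughout, since it makes the chain rule a matrix product.\<close>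

lemma holo_vec_on_iff:
  "holo_vec_on F S \<longleftrightarrow> (\<forall>z\<in>S. \<exists>D. (F has_derivative (*v) D) (at z))"
proof
  assume L: "holo_vec_on F S"
  show "\<forall>z\<in>S. \<exists>D. (F has_derivative (*v) D) (at z)"
  proof
    fix z assume "z \<in> S"
    then have "\<forall>j. \<exists>a. ((\<lambda>z. F z $ j) has_derivative (\<lambda>v. \<Sum>i\<in>UNIV. a $ i * v $ i)) (at z)"
      using L by (auto simp: holo_vec_on_def holo_on_def)
    from choice[OF this] obtain a
      where "\<forall>j. ((\<lambda>z. F z $ j) has_derivative (\<lambda>v. \<Sum>i\<in>UNIV. a j $ i * v $ i)) (at z)" ..
    then have "(F has_derivative (*v) (\<chi> j. a j)) (at z)"
      by (intro has_derivative_vec_components) (simp add: matrix_vector_mult_def)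
    then show "\<exists>D. (F has_derivative (*v) D) (at z)" ..
  qed
next
  assume R: "\<forall>z\<in>S. \<exists>D. (F has_derivative (*v) D) (at z)"
  show "holo_vec_on F S"
    unfolding holo_vec_on_def holo_on_def
  proof (intro allI ballI)
    fix j z assume "z \<in> S"
    then obtain D where "(F has_derivative (*v) D) (at z)"
      using R by blast
    then have "((\<lambda>z. F z $ j) has_derivative (\<lambda>v. (D *v v) $ j)) (at z)"
      by (rule bounded_linear.has_derivative[OF bounded_linear_vec_nth])
    then show "\<exists>a. ((\<lambda>z. F z $ j) has_derivative (\<lambda>v. \<Sum>i\<in>UNIV. a $ i * v $ i)) (at z)"
      by (auto simp: matrix_vector_mult_def)
  qed
qed

lemma jacobian_at_eq:
  assumes "(F has_derivative (*v) D) (at z)"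
  shows "jacobian_at F z = D"
  by (simp add: jacobian_at_def frechet_derivative_at[OF assms, symmetric])

lemma has_derivative_matrix_unique:
  fixes F :: "complex ^ 'n::finite \<Rightarrow> complex ^ 'm::finite"
  assumes "(F has_derivative (*v) D) (at z)" "(F has_derivative (*v) E) (at z)"
  shows "D = E"
  using jacobian_at_eq[OF assms(1)] jacobian_at_eq[OF assms(2)] by simp

lemma has_derivative_matrix_compose:
  assumes "(F has_derivative (*v) D) (at z)" "(G has_derivative (*v) E) (at (F z))"
  shows "(G \<circ> F has_derivative (*v) (E ** D)) (at z)"
  using diff_chain_at[OF assms] by (simp add: o_def matrix_vector_mul_assoc)

text \<open>Complex linearity of the real derivative is the form of holomorphy that the rules for sums
  and products preserve most directly.\<close>

lemma linear_form_homogeneous: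
  "(\<Sum>i\<in>UNIV. a $ i * (c *s v) $ i) = c * (\<Sum>i\<in>UNIV. a $ i * v $ i)" for c :: complex
  by (simp add: sum_distrib_left mult.left_commute)

lemma holo_on_iff_homogeneous:
  "holo_on f S \<longleftrightarrow> (\<forall>z\<in>S. \<exists>L. (f has_derivative L) (at z) \<and> (\<forall>c v. L (c *s v) = c * L v))"
proof
  assume "holo_on f S"
  then show "\<forall>z\<in>S. \<exists>L. (f has_derivative L) (at z) \<and> (\<forall>c v. L (c *s v) = c * L v)"
    unfolding holo_on_def using linear_form_homogeneous by fast
next
  assume R: "\<forall>z\<in>S. \<exists>L. (f has_derivative L) (at z) \<and> (\<forall>c v. L (c *s v) = c * L v)"
  show "holo_on f S"
    unfolding holo_on_def
  proof
    fix z assume "z \<in> S"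
    then obtain L where L: "(f has_derivative L) (at z)" and h: "\<And>c v. L (c *s v) = c * L v"
      using R by blast
    have "L v = (\<Sum>i\<in>UNIV. (\<chi> i. L (axis i 1)) $ i * v $ i)" for v
    proof -
      have "L v = L (\<Sum>i\<in>UNIV. v $ i *s axis i 1)"
        by (simp add: basis_expansion)
      also have "\<dots> = (\<Sum>i\<in>UNIV. L (v $ i *s axis i 1))"
        by (rule linear_sum[OF has_derivative_linear[OF L]])
      finally show ?thesis
        by (simp add: h mult.commute)
    qed
    then have "L = (\<lambda>v. \<Sum>i\<in>UNIV. (\<chi> i. L (axis i 1)) $ i * v $ i)"
      by (rule ext)
    then show "\<exists>a. (f has_derivative (\<lambda>v. \<Sum>i\<in>UNIV. a $ i * v $ i)) (at z)"
      using L by metis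
  qed
qed

lemma holo_on_const [simp]: "holo_on (\<lambda>_. c) S"
  unfolding holo_on_iff_homogeneous by (intro ballI exI[of _ "\<lambda>_. 0"]) simp

lemma holo_on_add:
  assumes "holo_on f S" "holo_on g S"
  shows "holo_on (\<lambda>z. f z + g z) S"
  unfolding holo_on_iff_homogeneous
proof
  fix z assume "z \<in> S"
  obtain L where "(f has_derivative L) (at z)" "\<forall>c v. L (c *s v) = c * L v"
    using assms(1) \<open>z \<in> S\<close> unfolding holo_on_iff_homogeneous by blast
  moreover obtain M where "(g has_derivative M) (at z)" "\<forall>c v. M (c *s v) = c * M v"
    using assms(2) \<open>z \<in> S\<close> unfolding holo_on_iff_homogeneous by blast
  ultimately show "\<exists>L. ((\<lambda>z. f z + g z) has_derivative L) (at z) \<and> (\<forall>c v. L (c *s v) = c * L v)"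
    by (intro exI[of _ "\<lambda>v. L v + M v"] conjI has_derivative_add) (auto simp: algebra_simps)
qed

lemma holo_on_mult:
  assumes "holo_on f S" "holo_on g S"
  shows "holo_on (\<lambda>z. f z * g z) S"
  unfolding holo_on_iff_homogeneous
proof
  fix z assume "z \<in> S"
  obtain L where "(f has_derivative L) (at z)" "\<forall>c v. L (c *s v) = c * L v"
    using assms(1) \<open>z \<in> S\<close> unfolding holo_on_iff_homogeneous by blast
  moreover obtain M where "(g has_derivative M) (at z)" "\<forall>c v. M (c *s v) = c * M v"
    using assms(2) \<open>z \<in> S\<close> unfolding holo_on_iff_homogeneous by blast
  ultimately show "\<exists>L. ((\<lambda>z. f z * g z) has_derivative L) (at z) \<and> (\<forall>c v. L (c *s v) = c * L v)"
    by (intro exI[of _ "\<lambda>v. f z * M v + L v * g z"] conjI has_derivative_mult) (auto simp: algebra_simps)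
qed

lemma holo_on_inverse:
  assumes "holo_on f S" "\<And>z. z \<in> S \<Longrightarrow> f z \<noteq> 0"
  shows "holo_on (\<lambda>z. inverse (f z)) S"
  unfolding holo_on_iff_homogeneous
proof
  fix z assume "z \<in> S"
  then obtain L where "(f has_derivative L) (at z)" "\<forall>c v. L (c *s v) = c * L v"
    using assms(1) unfolding holo_on_iff_homogeneous by blast
  with assms(2)[OF \<open>z \<in> S\<close>]
  show "\<exists>L. ((\<lambda>z. inverse (f z)) has_derivative L) (at z) \<and> (\<forall>c v. L (c *s v) = c * L v)"
    by (intro exI[of _ "\<lambda>v. - (inverse (f z) * L v * inverse (f z))"] conjI Deriv.has_derivative_inverse)
       (auto simp: algebra_simps)
qed

lemma holo_on_divide:
  "holo_on f S \<Longrightarrow> holo_on g S \<Longrightarrow> (\<And>z. z \<in> S \<Longrightarrow> g z \<noteq> 0) \<Longrightarrow> holo_on (\<lambda>z. f z / g z) S"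
  unfolding divide_inverse by (intro holo_on_mult holo_on_inverse)

lemma holo_on_sum: "(\<And>i. i \<in> I \<Longrightarrow> holo_on (f i) S) \<Longrightarrow> holo_on (\<lambda>z. \<Sum>i\<in>I. f i z) S"
  by (induction I rule: infinite_finite_induct) (auto intro: holo_on_add)

lemma holo_on_prod: "(\<And>i. i \<in> I \<Longrightarrow> holo_on (f i) S) \<Longrightarrow> holo_on (\<lambda>z. \<Prod>i\<in>I. f i z) S"
  by (induction I rule: infinite_finite_induct) (auto intro: holo_on_mult)

lemma holo_on_det:
  fixes A :: "complex ^ 'k::finite \<Rightarrow> complex ^ 'n::finite ^ 'n"
  shows "(\<And>i j. holo_on (\<lambda>z. A z $ i $ j) S) \<Longrightarrow> holo_on (\<lambda>z. det (A z)) S"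
  unfolding det_def by (intro holo_on_sum holo_on_mult holo_on_prod holo_on_const)

lemma holo_on_matrix_vector_mult:
  fixes A :: "complex ^ 'k::finite \<Rightarrow> complex ^ 'n::finite ^ 'm::finite"
  shows "(\<And>i j. holo_on (\<lambda>z. A z $ i $ j) S) \<Longrightarrow> holo_on (\<lambda>z. (A z *v v) $ i) S"
  by (simp add: matrix_vector_mult_def) (intro holo_on_sum holo_on_mult holo_on_const)

text \<open>Holomorphy depends only on germs, so locally a function may be replaced by a formula that holds
  nearby.\<close>

lemma holo_on_locally:
  assumes "\<And>z. z \<in> S \<Longrightarrow> \<exists>g T. holo_on g T \<and> z \<in> T \<and> (\<forall>\<^sub>F w in nhds z. f w = g w)"
  shows "holo_on f S"
  unfolding holo_on_def
proof
  fix z assume "z \<in> S"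
  then obtain g T where g: "holo_on g T" "z \<in> T" "\<forall>\<^sub>F w in nhds z. f w = g w"
    using assms[OF \<open>z \<in> S\<close>] by blast
  then obtain a where "(g has_derivative (\<lambda>v. \<Sum>i\<in>UNIV. a $ i * v $ i)) (at z)"
    by (auto simp: holo_on_def)
  moreover have "\<forall>\<^sub>F w in at z. g w = f w"
    using g(3) unfolding eventually_at_filter by eventually_elim simp
  moreover have "g z = f z"
    using eventually_nhds_x_imp_x[OF g(3)] by simp
  ultimately have "(f has_derivative (\<lambda>v. \<Sum>i\<in>UNIV. a $ i * v $ i)) (at z)"
    by (intro has_derivative_transform_eventually[of g _ z UNIV f]) auto
  then show "\<exists>a. (f has_derivative (\<lambda>v. \<Sum>i\<in>UNIV. a $ i * v $ i)) (at z)" ..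
qed

lemma holo_on_compose:
  assumes "holo_on g T" "holo_vec_on F S" "F ` S \<subseteq> T"
  shows "holo_on (g \<circ> F) S"
  unfolding holo_on_iff_homogeneous
proof
  fix z assume "z \<in> S"
  then obtain D where D: "(F has_derivative (*v) D) (at z)"
    using assms by (auto simp: holo_vec_on_iff)
  obtain L where L: "(g has_derivative L) (at (F z))" "\<forall>c v. L (c *s v) = c * L v"
    using assms \<open>z \<in> S\<close> unfolding holo_on_iff_homogeneous by blast
  show "\<exists>L. (g \<circ> F has_derivative L) (at z) \<and> (\<forall>c v. L (c *s v) = c * L v)"
    using diff_chain_at[OF D L(1)] L(2)
    by (intro exI[of _ "L \<circ> (*v) D"]) (simp add: vector_scalar_commute)
qed

subsection \<open>Derivatives of holomorphic functions\<close>

definition partial_deriv :: "(complex ^ 'n::finite \<Rightarrow> complex) \<Rightarrow> 'n \<Rightarrow> complex ^ 'n \<Rightarrow> complex" where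
  "partial_deriv f i z = frechet_derivative f (at z) (axis i 1)"

lemma holo_on_has_derivative_partial:
  assumes "holo_on f S" "z \<in> S"
  shows "(f has_derivative (\<lambda>v. \<Sum>i\<in>UNIV. partial_deriv f i z * v $ i)) (at z)"
proof -
  obtain a where a: "(f has_derivative (\<lambda>v. \<Sum>i\<in>UNIV. a $ i * v $ i)) (at z)"
    using assms by (auto simp: holo_on_def)
  have "partial_deriv f i z = a $ i" for i
    by (simp add: partial_deriv_def frechet_derivative_at[OF a, symmetric] axis_def
        if_distrib[of "\<lambda>x. _ * x"] cong: if_cong)
  then show ?thesis
    using a by simp
qed

lemma norm_axis_complex: "norm (axis i c :: complex ^ 'n::finite) = norm c"
  by (simp add: norm_vec_def axis_def L2_set_def if_distrib[of norm] if_distrib[of "\<lambda>x. x ^ 2"] cong: if_cong)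

lemma has_derivative_along_axis:
  assumes "(f has_derivative (\<lambda>v. \<Sum>i\<in>UNIV. a i * v $ i)) (at (z + axis i c))"
  shows "((\<lambda>c. f (z + axis i c)) has_field_derivative a i) (at c)"
proof -
  have "((\<lambda>c. z + axis i c) has_derivative axis i) (at c)"
    using has_derivative_add[OF has_derivative_const
        bounded_linear.has_derivative[OF bounded_linear_axis has_derivative_ident]]
    by simp
  from diff_chain_at[where f = "\<lambda>c. z + axis i c", OF this assms]
  have "((\<lambda>c. f (z + axis i c)) has_derivative (\<lambda>v. \<Sum>k\<in>UNIV. a k * axis i v $ k)) (at c)"
    by (simp add: o_def)
  moreover have "(\<lambda>v. \<Sum>k\<in>UNIV. a k * axis i v $ k) = (*) (a i)"
    by (simp add: fun_eq_iff axis_def if_distrib[of "\<lambda>x. _ * x"] cong: if_cong)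
  ultimately show ?thesis
    by (simp add: has_field_derivative_def)
qed

text \<open>Cauchy's formula in the single variable \<open>z\<^sub>i\<close>.\<close>

lemma partial_deriv_eq_integral:
  fixes z :: "complex ^ 'n::finite"
  assumes f: "holo_on f S" and r: "r > 0" and S: "\<And>c. norm c \<le> r \<Longrightarrow> z + axis i c \<in> S"
  shows "partial_deriv f i z =
    integral (cbox 0 1) (\<lambda>t. f (z + axis i (r * exp (2 * of_real pi * \<i> * of_real t))) /
                              (r * exp (2 * of_real pi * \<i> * of_real t)))"
proof -
  define g where "g = (\<lambda>c. f (z + axis i c))"
  have dg: "(g has_field_derivative partial_deriv f i (z + axis i c)) (at c)" if "norm c \<le> r" for c
    unfolding g_def
    by (rule has_derivative_along_axis[OF holo_on_has_derivative_partial[OF f S[OF that]]])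
  have hol: "g holomorphic_on ball 0 r"
    by (subst holomorphic_on_open) (auto intro!: exI dg)
  have cont: "continuous_on (cball 0 r) g"
    by (intro continuous_at_imp_continuous_on ballI DERIV_isCont[OF dg]) auto
  have "(g has_field_derivative
      (1 / (2 * of_real pi * \<i>) * contour_integral (circlepath 0 r) (\<lambda>u. g u / (u - 0)^2))) (at 0)"
    by (rule Cauchy_derivative_integral_circlepath[OF cont hol]) (use r in auto)
  moreover have axis_0: "axis i 0 = (0 :: complex ^ 'n)"
    by simp
  have "(g has_field_derivative partial_deriv f i z) (at 0)"
    using dg[of 0] r unfolding axis_0 by simp
  ultimately have "partial_deriv f i z = 1 / (2 * of_real pi * \<i>) * contour_integral (circlepath 0 r) (\<lambda>u. g u / (u - 0)^2)"
    by (rule DERIV_unique[rotated])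
  also have "\<dots> = 1 / (2 * of_real pi * \<i>) * integral {0..1} (\<lambda>t. (2 * of_real pi * \<i>) *
     (g (r * exp (2 * of_real pi * \<i> * of_real t)) / (r * exp (2 * of_real pi * \<i> * of_real t))))"
    unfolding contour_integral_integral
    by (rule arg_cong[of _ _ "(*) _"], rule integral_cong)
       (unfold vector_derivative_circlepath, use r in \<open>simp add: circlepath power2_eq_square field_simps\<close>)
  also have "\<dots> = integral {0..1} (\<lambda>t. g (r * exp (2 * of_real pi * \<i> * of_real t)) / (r * exp (2 * of_real pi * \<i> * of_real t)))"
    by (subst integral_mult_right) simp
  finally show ?thesis
    by (simp add: g_def cbox_interval)
qed

text \<open>Cauchy's formula writes a partial derivative as an integral of values of \<open>f\<close> over a circle in one
  coordinate direction. Differentiating under the integral sign gives a derivative that is again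
  complex linear.\<close>

lemma holo_on_partial_deriv:
  fixes f :: "complex ^ 'n::finite \<Rightarrow> complex"
  assumes f: "holo_on f S" and S: "open S"
  shows "holo_on (partial_deriv f i) S"
proof -
  define e where "e = (\<lambda>t::real. exp (2 * of_real pi * \<i> * of_real t))"
  have norm_e: "norm (e t) = 1" for t
    by (simp add: e_def)
  have cont_e: "continuous_on A e" for A
    unfolding e_def by (intro continuous_intros)
  have cont_axis: "continuous_on A (axis i :: complex \<Rightarrow> complex ^ 'n)" for i A
    by (rule linear_continuous_on[OF bounded_linear_axis])
  \<comment> \<open>A ball around which circles of its own radius stay inside the domain.\<close>
  have small: "\<exists>r>0. \<forall>z\<in>ball z0 r. \<forall>i c. norm c \<le> r \<longrightarrow> z + axis i c \<in> S" if z0: "z0 \<in> S" for z0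
  proof -
    obtain \<epsilon> where \<epsilon>: "\<epsilon> > 0" "ball z0 \<epsilon> \<subseteq> S"
      using S z0 open_contains_ball by blast
    have "z + axis i c \<in> S" if "z \<in> ball z0 (\<epsilon>/2)" "norm c \<le> \<epsilon>/2" for z i c
    proof -
      have "dist z0 (z + axis i c) \<le> dist z0 z + norm (axis i c :: complex ^ 'n)"
        using norm_triangle_ineq4[of "z0 - z" "axis i c"] by (simp add: dist_norm algebra_simps)
      then show ?thesis
        using that \<epsilon> by (auto simp: norm_axis_complex)
    qed
    then show ?thesis
      using \<epsilon>(1) by (intro exI[of _ "\<epsilon>/2"]) auto
  qed
  have cont_f: "continuous_on S f"
    by (intro continuous_at_imp_continuous_on ballI)
       (rule has_derivative_continuous[OF holo_on_has_derivative_partial[OF f]])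
  have kernel_cont: "continuous_on (ball z0 r \<times> cbox 0 1) (\<lambda>(z, t). h (z + axis i (r * e t)) / (r * e t))"
    if "r > 0" "\<forall>z\<in>ball z0 r. \<forall>i c. norm c \<le> r \<longrightarrow> z + axis i c \<in> S" "continuous_on S h"
    for z0 r h i
  proof -
    have "(z + axis i (of_real r * e t)) \<in> S" if "z \<in> ball z0 r" for z t
      using that \<open>\<forall>z\<in>ball z0 r. _\<close> \<open>r > 0\<close> by (simp add: norm_mult norm_e)
    then show ?thesis
      unfolding case_prod_beta using \<open>r > 0\<close> norm_e
      by (intro continuous_intros continuous_on_compose2[OF that(3)] continuous_on_compose2[OF cont_axis]
            continuous_on_compose2[OF cont_e])
         (auto simp: e_def)
  qed
  \<comment> \<open>Differentiation under the integral sign needs an integrand whose derivative is jointly continuous, and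
    this derivative consists of partial derivatives of \<open>f\<close>; their continuity also follows from Cauchy's formula.\<close>
  have cont_pd: "continuous_on S (partial_deriv f j)" for j
  proof (rule continuous_at_imp_continuous_on, rule ballI)
    fix z0 assume "z0 \<in> S"
    then obtain r where r: "r > 0" "\<forall>z\<in>ball z0 r. \<forall>i c. norm c \<le> r \<longrightarrow> z + axis i c \<in> S"
      using small by blast
    have "continuous_on (ball z0 r) (\<lambda>z. integral (cbox 0 1) (\<lambda>t. f (z + axis j (r * e t)) / (r * e t)))"
      by (rule integral_continuous_on_param[OF kernel_cont[OF r cont_f]])
    moreover have "integral (cbox 0 1) (\<lambda>t. f (z + axis j (r * e t)) / (r * e t)) = partial_deriv f j z"
      if "z \<in> ball z0 r" for z
      using partial_deriv_eq_integral[OF f r(1), of z j] r(2) that by (simp add: e_def)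
    ultimately have "continuous_on (ball z0 r) (partial_deriv f j)"
      by (rule continuous_on_eq)
    then show "isCont (partial_deriv f j) z0"
      by (rule continuous_on_interior) (use r(1) in simp)
  qed
  show ?thesis
    unfolding holo_on_iff_homogeneous
  proof
    fix z0 assume z0: "z0 \<in> S"
    then obtain r where r: "r > 0" "\<forall>z\<in>ball z0 r. \<forall>i c. norm c \<le> r \<longrightarrow> z + axis i c \<in> S"
      using small by blast
    have inS: "(z + axis i (of_real r * e t)) \<in> S" if "z \<in> ball z0 r" for z t
      using that r by (simp add: norm_mult norm_e)
    define fx where "fx = (\<lambda>z t. Blinfun (\<lambda>v. \<Sum>j\<in>UNIV. (partial_deriv f j (z + axis i (r * e t)) / (r * e t)) * v $ j))"
    have fx: "blinfun_apply (fx z t) = (\<lambda>v. \<Sum>j\<in>UNIV. (partial_deriv f j (z + axis i (r * e t)) / (r * e t)) * v $ j)" for z t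
      unfolding fx_def
      by (rule bounded_linear_Blinfun_apply)
         (intro bounded_linear_sum bounded_linear_const_mult bounded_linear_vec_nth)
    have cont_fx: "continuous_on (ball z0 r \<times> cbox 0 1) (\<lambda>(z, t). fx z t)"
    proof (rule continuous_on_blinfun_componentwise)
      fix b :: "complex ^ 'n"
      show "continuous_on (ball z0 r \<times> cbox 0 1) (\<lambda>x. blinfun_apply (case x of (z, t) \<Rightarrow> fx z t) b)"
        unfolding case_prod_beta fx
        by (intro continuous_on_sum continuous_on_mult continuous_on_const
              kernel_cont[OF r cont_pd, unfolded case_prod_beta])
    qed
    have "((\<lambda>z. integral (cbox 0 1) (\<lambda>t. f (z + axis i (r * e t)) / (r * e t)))
        has_derivative blinfun_apply (integral (cbox 0 1) (fx z0))) (at z0 within ball z0 r)"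
    proof (rule leibniz_rule[OF _ _ cont_fx])
      fix z and t :: real assume z: "z \<in> ball z0 r"
      have "((\<lambda>z. f (z + axis i (r * e t)) / (r * e t)) has_derivative
         (\<lambda>v. (\<Sum>j\<in>UNIV. partial_deriv f j (z + axis i (r * e t)) * v $ j) / (r * e t))) (at z)"
        by (intro bounded_linear.has_derivative[OF bounded_linear_divide]
            has_derivative_compose[where f = "\<lambda>z. z + axis i (r * e t)" and f' = "\<lambda>v. v",
              OF _ holo_on_has_derivative_partial[OF f inS[OF z]]])
           (auto intro!: derivative_eq_intros)
      then show "((\<lambda>z. f (z + axis i (r * e t)) / (r * e t)) has_derivative blinfun_apply (fx z t)) (at z within ball z0 r)"
        by (auto simp: fx sum_divide_distrib intro: has_derivative_at_withinI)
    next
      fix z assume z: "z \<in> ball z0 r"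
      show "(\<lambda>t. f (z + axis i (r * e t)) / (r * e t)) integrable_on cbox 0 1"
        using z by (intro integrable_continuous continuous_on_compose2[OF kernel_cont[OF r cont_f], of _ "\<lambda>t. (z, t)", simplified])
          (auto intro!: continuous_intros)
    qed (use r in auto)
    moreover have "at z0 within ball z0 r = at z0"
      using r(1) by (intro at_within_open) simp_all
    ultimately have der: "((\<lambda>z. integral (cbox 0 1) (\<lambda>t. f (z + axis i (r * e t)) / (r * e t)))
        has_derivative blinfun_apply (integral (cbox 0 1) (fx z0))) (at z0)"
      by (simp only:)
    have "(partial_deriv f i has_derivative blinfun_apply (integral (cbox 0 1) (fx z0))) (at z0)"
    proof (rule has_derivative_transform_within_open[OF der open_ball])
      show "z0 \<in> ball z0 r"
        using r by simp
      show "integral (cbox 0 1) (\<lambda>t. f (z + axis i (r * e t)) / (r * e t)) = partial_deriv f i z"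
        if "z \<in> ball z0 r" for z
        using partial_deriv_eq_integral[OF f r(1), of z i] r(2) that by (simp add: e_def)
    qed
    moreover have "blinfun_apply (integral (cbox 0 1) (fx z0)) v = integral (cbox 0 1) (\<lambda>t. blinfun_apply (fx z0 t) v)" for v
      by (intro blinfun_apply_integral integrable_continuous
            continuous_on_compose2[OF cont_fx, of _ "\<lambda>t. (z0, t)", simplified])
         (use r(1) in \<open>auto intro!: continuous_intros\<close>)
    then have "blinfun_apply (integral (cbox 0 1) (fx z0)) (c *s v) = c * blinfun_apply (integral (cbox 0 1) (fx z0)) v" for c v
      by (simp add: fx flip: integral_mult_right) (simp add: sum_distrib_left mult_ac)
    ultimately show "\<exists>L. (partial_deriv f i has_derivative L) (at z0) \<and> (\<forall>c v. L (c *s v) = c * L v)"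
      by blast
  qed
qed

lemma holo_on_jacobian_entry:
  fixes F :: "complex ^ 'n::finite \<Rightarrow> complex ^ 'm::finite"
  assumes F: "holo_vec_on F S" and S: "open S"
  shows "holo_on (\<lambda>z. jacobian_at F z $ i $ j) S"
proof (rule holo_on_locally)
  fix z assume z: "z \<in> S"
  have "jacobian_at F w $ i $ j = partial_deriv (\<lambda>z. F z $ i) j w" if w: "w \<in> S" for w
  proof -
    obtain D where D: "(F has_derivative (*v) D) (at w)"
      using F w unfolding holo_vec_on_iff by blast
    then have "((\<lambda>z. F z $ i) has_derivative (\<lambda>v. (D *v v) $ i)) (at w)"
      by (rule bounded_linear.has_derivative[OF bounded_linear_vec_nth])
    then show ?thesis
      by (simp add: partial_deriv_def jacobian_at_eq[OF D] frechet_derivative_at[symmetric]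
          matrix_vector_mult_def axis_def if_distrib[of "\<lambda>x. _ * x"] cong: if_cong)
  qed
  then have "\<forall>\<^sub>F w in nhds z. jacobian_at F w $ i $ j = partial_deriv (\<lambda>z. F z $ i) j w"
    using S z eventually_nhds by blast
  moreover have "holo_on (partial_deriv (\<lambda>z. F z $ i) j) S"
    using F S by (intro holo_on_partial_deriv) (auto simp: holo_vec_on_def)
  ultimately show "\<exists>g T. holo_on g T \<and> z \<in> T \<and> (\<forall>\<^sub>F w in nhds z. jacobian_at F w $ i $ j = g w)"
    using z by blast
qed

section \<open>Monomial matrices\<close>

definition monomial_matrix :: "complex ^ 'n::finite ^ 'n \<Rightarrow> bool" where
  "monomial_matrix N \<longleftrightarrow> det N \<noteq> 0 \<and> (\<exists>\<sigma>. \<forall>i j. N $ i $ j \<noteq> 0 \<longrightarrow> j = \<sigma> i)"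

text \<open>The sign of the underlying permutation: both \<open>\<Prod>\<^sub>i (N 1)\<^sub>i\<close> and, up to that sign, \<open>det N\<close>
  are the product of the nonzero entries.\<close>

definition monomial_sign :: "complex ^ 'n::finite ^ 'n \<Rightarrow> complex" where
  "monomial_sign N = (\<Prod>i\<in>UNIV. (N *v 1) $ i) / det N"

text \<open>If \<open>\<sigma>\<close> were not a permutation, some column would vanish and so would the determinant.\<close>

lemma monomial_matrixE:
  fixes N :: "complex ^ 'n::finite ^ 'n"
  assumes "monomial_matrix N"
  obtains \<sigma> where "\<sigma> permutes UNIV" "\<And>i j. j \<noteq> \<sigma> i \<Longrightarrow> N $ i $ j = 0"
proof -
  obtain \<sigma> where d: "det N \<noteq> 0" and \<sigma>: "\<And>i j. j \<noteq> \<sigma> i \<Longrightarrow> N $ i $ j = 0"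
    using assms by (auto simp: monomial_matrix_def)
  have "surj \<sigma>"
  proof (rule ccontr)
    assume "\<not> surj \<sigma>"
    then obtain k where "k \<notin> range \<sigma>"
      by auto
    then have "column k N = 0"
      using \<sigma> by (auto simp: column_def vec_eq_iff)
    then have "row k (transpose N) = 0"
      by simp
    then have "det (transpose N) = 0"
      by (rule det_zero_row)
    then show False
      using d by (simp add: det_transpose)
  qed
  then have "bij \<sigma>"
    by (simp add: finite_UNIV_surj_inj bij_def)
  then show ?thesis
    using that \<sigma> by (metis bij_imp_permutes UNIV_I)
qed

text \<open>Only the underlying permutation contributes to the expansion of the determinant. This is the point of
  the whole construction: the product of the coordinates is multiplied by the determinant up to sign.\<close>

lemma
  fixes N :: "complex ^ 'n::finite ^ 'n"
  assumes N: "monomial_matrix N"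
  shows monomial_sign_square: "monomial_sign N * monomial_sign N = 1"
    and prod_monomial_matrix:
      "(\<Prod>i\<in>UNIV. (N *v v) $ i) = monomial_sign N * det N * (\<Prod>i\<in>UNIV. v $ i)"
proof -
  obtain \<sigma> where \<sigma>: "\<sigma> permutes UNIV" and N0: "\<And>i j. j \<noteq> \<sigma> i \<Longrightarrow> N $ i $ j = 0"
    using monomial_matrixE[OF N] by blast
  have entry: "(N *v v) $ i = N $ i $ \<sigma> i * v $ \<sigma> i" for i v
  proof -
    have "(N *v v) $ i = (\<Sum>j\<in>UNIV. N $ i $ j * v $ j)"
      by (simp add: matrix_vector_mult_def)
    also have "\<dots> = (\<Sum>j\<in>{\<sigma> i}. N $ i $ j * v $ j)"
      by (rule sum.mono_neutral_right) (auto simp: N0)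
    finally show ?thesis by simp
  qed
  have "det N = (\<Sum>p\<in>{\<sigma>}. of_int (sign p) * (\<Prod>i\<in>UNIV. N $ i $ p i))"
    unfolding det_def
  proof (rule sum.mono_neutral_right)
    show "\<forall>p\<in>{p. p permutes UNIV} - {\<sigma>}. of_int (sign p) * (\<Prod>i\<in>UNIV. N $ i $ p i) = 0"
    proof
      fix p assume "p \<in> {p. p permutes UNIV} - {\<sigma>}"
      then obtain i where "p i \<noteq> \<sigma> i"
        by (auto simp: fun_eq_iff)
      then have "(\<Prod>i\<in>UNIV. N $ i $ p i) = 0"
        using N0 by (intro prod_zero) auto
      then show "of_int (sign p) * (\<Prod>i\<in>UNIV. N $ i $ p i) = 0"
        by simp
    qed
  qed (use \<sigma> in \<open>auto simp: finite_permutations\<close>)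
  then have det: "det N = of_int (sign \<sigma>) * (\<Prod>i\<in>UNIV. N $ i $ \<sigma> i)"
    by simp
  have sgn: "of_int (sign \<sigma>) * of_int (sign \<sigma>) = (1::complex)"
    by (simp add: sign_def)
  have d: "det N \<noteq> 0"
    using N by (simp add: monomial_matrix_def)
  have ms: "monomial_sign N = of_int (sign \<sigma>)"
    using d sgn by (simp add: monomial_sign_def entry det field_simps)
  show "monomial_sign N * monomial_sign N = 1"
    by (simp add: ms sgn)
  have "(\<Prod>i\<in>UNIV. (N *v v) $ i) = (\<Prod>i\<in>UNIV. N $ i $ \<sigma> i) * (\<Prod>i\<in>UNIV. v $ \<sigma> i)"
    by (simp add: entry prod.distrib)
  also have "(\<Prod>i\<in>UNIV. v $ \<sigma> i) = (\<Prod>i\<in>UNIV. v $ i)"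
    using prod.permute[OF \<sigma>, of "\<lambda>i. v $ i"] by (simp add: o_def)
  also have "(\<Prod>i\<in>UNIV. N $ i $ \<sigma> i) = monomial_sign N * det N"
    unfolding ms det by (simp add: mult.assoc[symmetric] sgn)
  finally show "(\<Prod>i\<in>UNIV. (N *v v) $ i) = monomial_sign N * det N * (\<Prod>i\<in>UNIV. v $ i)" .
qed

lemma monomial_sign_mult:
  fixes N M :: "complex ^ 'n::finite ^ 'n"
  assumes N: "monomial_matrix N" and M: "monomial_matrix M"
  shows "monomial_sign (N ** M) = monomial_sign N * monomial_sign M"
proof -
  have "(\<Prod>i\<in>UNIV. ((N ** M) *v 1) $ i) = monomial_sign N * det N * (monomial_sign M * det M)"
    using prod_monomial_matrix[OF M, of 1]
    by (simp add: matrix_vector_mul_assoc[symmetric] prod_monomial_matrix[OF N])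
  then show ?thesis
    using N M by (simp add: monomial_sign_def[of "N ** M"] det_mul monomial_matrix_def)
qed

section \<open>Products of linear forms as symmetric tensors\<close>

text \<open>The coefficient of \<open>dz\<^sup>\<alpha>\<close> in the product over \<open>i\<close> of the linear forms \<open>\<Sum>\<^sub>j A\<^sub>i\<^sub>j dz\<^sub>j\<close>: the function \<open>f\<close> chooses a term
  from every factor.\<close>

definition prod_form_coeff :: "complex ^ 'n::finite ^ 'n \<Rightarrow> ('n \<Rightarrow> nat) \<Rightarrow> complex" where
  "prod_form_coeff A \<alpha> = (\<Sum>f | \<forall>j. card {i. f i = j} = \<alpha> j. \<Prod>i\<in>UNIV. A $ i $ f i)"

lemma finite_multi_indices: "finite (multi_indices k :: ('n::finite \<Rightarrow> nat) set)"
proof (rule finite_subset)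
  show "multi_indices k \<subseteq> (PiE UNIV (\<lambda>_::'n. {..k}))"
    by (auto simp: multi_indices_def intro!: member_le_sum)
qed (simp add: finite_PiE)

lemma sym_eval_prod_form_coeff:
  fixes A :: "complex ^ 'n::finite ^ 'n"
  shows "sym_eval CARD('n) (prod_form_coeff A) v = (\<Prod>i\<in>UNIV. (A *v v) $ i)"
proof -
  define content where "content = (\<lambda>(f::'n \<Rightarrow> 'n) j. card {i. f i = j})"
  define T where "T = (\<lambda>f. (\<Prod>i\<in>UNIV. A $ i $ f i) * (\<Prod>i\<in>UNIV. v $ f i))"
  have content: "content f \<in> multi_indices CARD('n)" for f
    using sum.group[of "UNIV :: 'n set" "UNIV :: 'n set" f "\<lambda>_. 1::nat"]
    by (simp add: multi_indices_def content_def)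
  have mono: "(\<Prod>i\<in>UNIV. v $ f i) = (\<Prod>j\<in>UNIV. v $ j ^ content f j)" for f
  proof -
    have "(\<Prod>j\<in>UNIV. \<Prod>i | i \<in> UNIV \<and> f i = j. v $ f i) = (\<Prod>i\<in>UNIV. v $ f i)"
      by (rule prod.group) auto
    moreover have "(\<Prod>i | i \<in> UNIV \<and> f i = j. v $ f i) = v $ j ^ content f j" for j
      by (simp add: content_def)
    ultimately show ?thesis by simp
  qed
  have "(\<Prod>i\<in>UNIV. (A *v v) $ i) = (\<Sum>f\<in>PiE UNIV (\<lambda>_. UNIV). \<Prod>i\<in>UNIV. A $ i $ f i * v $ f i)"
    unfolding matrix_vector_mult_def by (simp add: prod_sum_PiE)
  also have "\<dots> = (\<Sum>f\<in>UNIV. T f)"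
    by (simp add: T_def prod.distrib)
  also have "\<dots> = (\<Sum>\<alpha>\<in>multi_indices CARD('n). \<Sum>f | f \<in> UNIV \<and> content f = \<alpha>. T f)"
    by (rule sum.group[symmetric]) (use content in \<open>auto simp: finite_multi_indices\<close>)
  also have "\<dots> = (\<Sum>\<alpha>\<in>multi_indices CARD('n). prod_form_coeff A \<alpha> * (\<Prod>j\<in>UNIV. v $ j ^ \<alpha> j))"
  proof (rule sum.cong[OF refl])
    fix \<alpha> :: "'n \<Rightarrow> nat"
    have "{f. \<forall>j. card {i. f i = j} = \<alpha> j} = {f. f \<in> UNIV \<and> content f = \<alpha>}"
      by (auto simp: content_def)
    then show "(\<Sum>f | f \<in> UNIV \<and> content f = \<alpha>. T f) = prod_form_coeff A \<alpha> * (\<Prod>j\<in>UNIV. v $ j ^ \<alpha> j)"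
      by (auto simp: prod_form_coeff_def T_def mono sum_distrib_right intro!: sum.cong)
  qed
  finally show ?thesis
    by (simp add: sym_eval_def)
qed

lemma sym_eval_cmult: "sym_eval k (\<lambda>\<alpha>. e * c \<alpha>) v = e * sym_eval k c v"
  by (simp add: sym_eval_def sum_distrib_left mult.assoc)

lemma holo_on_prod_form_coeff:
  fixes A :: "complex ^ 'k::finite \<Rightarrow> complex ^ 'n::finite ^ 'n"
  assumes "\<And>i j. holo_on (\<lambda>z. A z $ i $ j) S"
  shows "holo_on (\<lambda>z. prod_form_coeff (A z) \<alpha>) S"
  unfolding prod_form_coeff_def by (intro holo_on_sum holo_on_prod assms)

text \<open>Choose \<open>v\<close> such that all the forms take the value 1.\<close>

lemma invertible_prod_form_nonzero:
  fixes A :: "complex ^ 'n::finite ^ 'n"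
  assumes "det A \<noteq> 0"
  obtains v where "(\<Prod>i\<in>UNIV. (A *v v) $ i) = 1"
proof -
  obtain B where "A ** B = mat 1"
    using assms by (auto simp: invertible_det_nz[symmetric] invertible_def)
  then have "A *v (B *v 1) = 1"
    by (simp add: matrix_vector_mul_assoc)
  then show ?thesis
    using that[of "B *v 1"] by simp
qed

section \<open>Maps that are complex differentiable at a point\<close>

text \<open>The conditions on an atlas that concern one chart at a time. Compatibility of the charts is a separate
  matter: it says that the identity is complex differentiable.\<close>

definition charted :: "('a::topological_space, 'n::finite) mfd \<Rightarrow> bool" where
  "charted X \<longleftrightarrow> \<Union>(fst ` atlas X) = points X \<and>
     (\<forall>\<phi>\<in>atlas X. openin (mtop X) (fst \<phi>) \<and> open (snd \<phi> ` fst \<phi>) \<and>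
        homeomorphism (fst \<phi>) (snd \<phi> ` fst \<phi>) (snd \<phi>) (chart_inv \<phi>))"

lemma complex_manifold_charted: "complex_manifold X \<Longrightarrow> charted X"
  by (simp add: complex_manifold_def charted_def)

lemma chartedD:
  assumes "charted X" "\<phi> \<in> atlas X"
  shows "openin (mtop X) (fst \<phi>)" "open (snd \<phi> ` fst \<phi>)"
    "homeomorphism (fst \<phi>) (snd \<phi> ` fst \<phi>) (snd \<phi>) (chart_inv \<phi>)" "fst \<phi> \<subseteq> points X"
  using assms openin_imp_subset unfolding charted_def by blast+

lemma charted_obtain_chart:
  assumes "charted X" "x \<in> points X"
  obtains \<phi> where "\<phi> \<in> atlas X" "x \<in> fst \<phi>"
proof -
  have "x \<in> \<Union>(fst ` atlas X)"
    using assms by (simp add: charted_def)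
  then show ?thesis
    using that by blast
qed

lemma chart_inv_left: "charted X \<Longrightarrow> \<phi> \<in> atlas X \<Longrightarrow> x \<in> fst \<phi> \<Longrightarrow> chart_inv \<phi> (snd \<phi> x) = x"
  using homeomorphism_apply1 chartedD(3) by blast

lemma chart_image_open:
  assumes X: "charted X" and \<phi>: "\<phi> \<in> atlas X" and U: "openin (mtop X) U"
  shows "open (snd \<phi> ` (fst \<phi> \<inter> U))"
proof -
  obtain T where T: "open T" "U = points X \<inter> T"
    using U by (auto simp: openin_open)
  then have "fst \<phi> \<inter> U = fst \<phi> \<inter> T"
    using chartedD(4)[OF X \<phi>] by blast
  then have "openin (top_of_set (fst \<phi>)) (fst \<phi> \<inter> U)"
    using T(1) by (auto simp: openin_open)
  then have "openin (top_of_set (snd \<phi> ` fst \<phi>)) (snd \<phi> ` (fst \<phi> \<inter> U))"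
    by (rule homeomorphism_imp_open_map[OF chartedD(3)[OF X \<phi>]])
  then show ?thesis
    using openin_open_trans chartedD(2)[OF X \<phi>] by blast
qed

lemma eventually_chart_inv:
  assumes X: "charted X" and \<phi>: "\<phi> \<in> atlas X" and U: "openin (mtop X) U" and x: "x \<in> fst \<phi>" "x \<in> U"
  shows "\<forall>\<^sub>F z in nhds (snd \<phi> x). chart_inv \<phi> z \<in> fst \<phi> \<inter> U \<and> snd \<phi> (chart_inv \<phi> z) = z"
  unfolding eventually_nhds
proof (intro exI conjI ballI)
  show "open (snd \<phi> ` (fst \<phi> \<inter> U))"
    by (rule chart_image_open[OF X \<phi> U])
  show "snd \<phi> x \<in> snd \<phi> ` (fst \<phi> \<inter> U)"
    using x by blast
  fix z assume "z \<in> snd \<phi> ` (fst \<phi> \<inter> U)"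
  then show "chart_inv \<phi> z \<in> fst \<phi> \<inter> U" "snd \<phi> (chart_inv \<phi> z) = z"
    using chart_inv_left[OF X \<phi>] by auto
qed

lemma has_derivative_cong_nhds:
  assumes "(F has_derivative F') (at z)" "\<forall>\<^sub>F w in nhds z. F w = G w"
  shows "(G has_derivative F') (at z)"
proof (rule has_derivative_transform_eventually[OF assms(1)])
  show "\<forall>\<^sub>F w in at z. F w = G w"
    using assms(2) unfolding eventually_at_filter by eventually_elim simp
  show "F z = G z"
    using eventually_nhds_x_imp_x[OF assms(2)] .
qed simp

text \<open>Complex differentiability at one point, in all charts around it. Local continuity is included because the
  expression of a composition in charts makes sense near the point only if the first map sends a
  neighbourhood into a chart.\<close>

definition mdiff_at :: "('a::topological_space, 'n::finite) mfd \<Rightarrow>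
    ('b::topological_space, 'm::finite) mfd \<Rightarrow> ('a \<Rightarrow> 'b) \<Rightarrow> 'a \<Rightarrow> bool" where
  "mdiff_at X Y f x \<longleftrightarrow>
     (\<forall>V. openin (mtop Y) V \<longrightarrow> f x \<in> V \<longrightarrow> (\<exists>U. openin (mtop X) U \<and> x \<in> U \<and> f ` U \<subseteq> V)) \<and>
     (\<forall>\<phi>\<in>atlas X. \<forall>\<psi>\<in>atlas Y. x \<in> fst \<phi> \<longrightarrow> f x \<in> fst \<psi> \<longrightarrow>
        (\<exists>D. (snd \<psi> \<circ> f \<circ> chart_inv \<phi> has_derivative (*v) D) (at (snd \<phi> x))))"

lemma mdiff_atD1:
  assumes "mdiff_at X Y f x" "openin (mtop Y) V" "f x \<in> V"
  obtains U where "openin (mtop X) U" "x \<in> U" "f ` U \<subseteq> V"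
  using assms unfolding mdiff_at_def by blast

lemma mdiff_atD2:
  assumes "mdiff_at X Y f x" "\<phi> \<in> atlas X" "\<psi> \<in> atlas Y" "x \<in> fst \<phi>" "f x \<in> fst \<psi>"
  obtains D where "(snd \<psi> \<circ> f \<circ> chart_inv \<phi> has_derivative (*v) D) (at (snd \<phi> x))"
  using assms unfolding mdiff_at_def by blast

lemma has_derivative_chart_cong:
  assumes X: "charted X" "\<phi> \<in> atlas X" "x \<in> fst \<phi>"
    and U: "openin (mtop X) U" "x \<in> U" "\<And>y. y \<in> U \<Longrightarrow> f y = g y"
    and D: "(c \<circ> f \<circ> chart_inv \<phi> has_derivative F') (at (snd \<phi> x))"
  shows "(c \<circ> g \<circ> chart_inv \<phi> has_derivative F') (at (snd \<phi> x))"
proof (rule has_derivative_cong_nhds[OF D])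
  show "\<forall>\<^sub>F w in nhds (snd \<phi> x). (c \<circ> f \<circ> chart_inv \<phi>) w = (c \<circ> g \<circ> chart_inv \<phi>) w"
    using eventually_chart_inv[OF X(1,2) U(1) X(3) U(2)]
    by eventually_elim (simp add: U(3))
qed

lemma mdiff_at_cong:
  assumes X: "charted X" and f: "mdiff_at X Y f x"
    and U: "openin (mtop X) U" "x \<in> U" "\<And>y. y \<in> U \<Longrightarrow> f y = g y"
  shows "mdiff_at X Y g x"
  unfolding mdiff_at_def
proof (intro conjI allI impI ballI)
  fix V assume V: "openin (mtop Y) V" "g x \<in> V"
  then have "f x \<in> V"
    using U(2,3) by simp
  from mdiff_atD1[OF f V(1) this] obtain W where W: "openin (mtop X) W" "x \<in> W" "f ` W \<subseteq> V" .
  have "g ` (W \<inter> U) \<subseteq> V"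
  proof
    fix y assume "y \<in> g ` (W \<inter> U)"
    then obtain w where "w \<in> W" "w \<in> U" "y = g w"
      by blast
    then have "y = f w" "w \<in> W"
      using U(3) by simp_all
    then show "y \<in> V"
      using W(3) by blast
  qed
  then show "\<exists>U. openin (mtop X) U \<and> x \<in> U \<and> g ` U \<subseteq> V"
    using W U by (intro exI[of _ "W \<inter> U"]) auto
next
  fix \<phi> \<psi> assume A: "\<phi> \<in> atlas X" "\<psi> \<in> atlas Y" "x \<in> fst \<phi>" "g x \<in> fst \<psi>"
  then have "f x \<in> fst \<psi>"
    using U(2,3) by simp
  from mdiff_atD2[OF f A(1-3) this]
  obtain D where "(snd \<psi> \<circ> f \<circ> chart_inv \<phi> has_derivative (*v) D) (at (snd \<phi> x))" .
  from has_derivative_chart_cong[OF X A(1,3) U this]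
  show "\<exists>D. (snd \<psi> \<circ> g \<circ> chart_inv \<phi> has_derivative (*v) D) (at (snd \<phi> x))" ..
qed

text \<open>The chain rule in charts. The last coordinate map \<open>c\<close> is arbitrary, so that the rule also applies to
  coordinates that do not belong to an atlas.\<close>

lemma has_derivative_chart_compose:
  fixes c :: "'c \<Rightarrow> complex ^ 'k::finite"
    and X :: "('a::topological_space, 'n::finite) mfd" and Y :: "('b::topological_space, 'm::finite) mfd"
  assumes X: "charted X" "\<phi> \<in> atlas X" "x \<in> fst \<phi>" and Y: "charted Y" "\<kappa> \<in> atlas Y" "f x \<in> fst \<kappa>"
    and f: "mdiff_at X Y f x"
    and D: "(snd \<kappa> \<circ> f \<circ> chart_inv \<phi> has_derivative (*v) D) (at (snd \<phi> x))"
    and E: "(c \<circ> g \<circ> chart_inv \<kappa> has_derivative (*v) E) (at (snd \<kappa> (f x)))"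
  shows "(c \<circ> (g \<circ> f) \<circ> chart_inv \<phi> has_derivative (*v) (E ** D)) (at (snd \<phi> x))"
proof (rule has_derivative_cong_nhds)
  have "(snd \<kappa> \<circ> f \<circ> chart_inv \<phi>) (snd \<phi> x) = snd \<kappa> (f x)"
    by (simp add: chart_inv_left[OF X])
  then show "((c \<circ> g \<circ> chart_inv \<kappa>) \<circ> (snd \<kappa> \<circ> f \<circ> chart_inv \<phi>) has_derivative (*v) (E ** D)) (at (snd \<phi> x))"
    using has_derivative_matrix_compose[OF D, of "c \<circ> g \<circ> chart_inv \<kappa>" E] E by simp
  from mdiff_atD1[OF f chartedD(1)[OF Y(1,2)] Y(3)]
  obtain U where U: "openin (mtop X) U" "x \<in> U" "f ` U \<subseteq> fst \<kappa>" .
  show "\<forall>\<^sub>F w in nhds (snd \<phi> x). ((c \<circ> g \<circ> chart_inv \<kappa>) \<circ> (snd \<kappa> \<circ> f \<circ> chart_inv \<phi>)) w =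
      (c \<circ> (g \<circ> f) \<circ> chart_inv \<phi>) w"
    using eventually_chart_inv[OF X(1,2) U(1) X(3) U(2)]
  proof eventually_elim
    case (elim w)
    then have "f (chart_inv \<phi> w) \<in> fst \<kappa>"
      using U(3) by blast
    then show ?case
      by (simp add: chart_inv_left[OF Y(1,2)])
  qed
qed

lemma mdiff_at_compose:
  assumes X: "charted X" and Y: "charted Y" and fx: "f x \<in> points Y"
    and f: "mdiff_at X Y f x" and g: "mdiff_at Y Z g (f x)"
  shows "mdiff_at X Z (g \<circ> f) x"
  unfolding mdiff_at_def
proof (intro conjI allI impI ballI)
  fix V assume V: "openin (mtop Z) V" "(g \<circ> f) x \<in> V"
  then have "g (f x) \<in> V"
    by simp
  from mdiff_atD1[OF g V(1) this] obtain U where U: "openin (mtop Y) U" "f x \<in> U" "g ` U \<subseteq> V" .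
  from mdiff_atD1[OF f U(1,2)] obtain W where "openin (mtop X) W" "x \<in> W" "f ` W \<subseteq> U" .
  then show "\<exists>U. openin (mtop X) U \<and> x \<in> U \<and> (g \<circ> f) ` U \<subseteq> V"
    using U(3) by (intro exI[of _ W]) auto
next
  fix \<phi> \<psi> assume A: "\<phi> \<in> atlas X" "\<psi> \<in> atlas Z" "x \<in> fst \<phi>" "(g \<circ> f) x \<in> fst \<psi>"
  obtain \<kappa> where \<kappa>: "\<kappa> \<in> atlas Y" "f x \<in> fst \<kappa>"
    using charted_obtain_chart[OF Y fx] .
  from mdiff_atD2[OF f A(1) \<kappa>(1) A(3) \<kappa>(2)]
  obtain D where D: "(snd \<kappa> \<circ> f \<circ> chart_inv \<phi> has_derivative (*v) D) (at (snd \<phi> x))" .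
  have "g (f x) \<in> fst \<psi>"
    using A(4) by simp
  from mdiff_atD2[OF g \<kappa>(1) A(2) \<kappa>(2) this]
  obtain E where "(snd \<psi> \<circ> g \<circ> chart_inv \<kappa> has_derivative (*v) E) (at (snd \<kappa> (f x)))" .
  from has_derivative_chart_compose[OF X A(1,3) Y \<kappa> f D this]
  show "\<exists>D. (snd \<psi> \<circ> (g \<circ> f) \<circ> chart_inv \<phi> has_derivative (*v) D) (at (snd \<phi> x))" ..
qed

lemma holo_map_mdiff_at:
  assumes f: "holo_map X Y f" and x: "x \<in> points X"
  shows "mdiff_at X Y f x"
  unfolding mdiff_at_def
proof (intro conjI allI impI ballI)
  fix V assume V: "openin (mtop Y) V" "f x \<in> V"
  have "f \<in> points X \<rightarrow> points Y" "continuous_on (points X) f"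
    using f by (auto simp: holo_map_def)
  then have "openin (mtop X) (points X \<inter> f -` V)"
    using V(1) by (intro continuous_openin_preimage)
  then show "\<exists>U. openin (mtop X) U \<and> x \<in> U \<and> f ` U \<subseteq> V"
    using V(2) x by (intro exI[of _ "points X \<inter> f -` V"]) auto
next
  fix \<phi> \<psi> assume "\<phi> \<in> atlas X" "\<psi> \<in> atlas Y" "x \<in> fst \<phi>" "f x \<in> fst \<psi>"
  then show "\<exists>D. (snd \<psi> \<circ> f \<circ> chart_inv \<phi> has_derivative (*v) D) (at (snd \<phi> x))"
    using f unfolding holo_map_def holo_vec_on_iff by blast
qed

lemma complex_manifold_mdiff_id:
  assumes "complex_manifold X"
  shows "mdiff_at X X (\<lambda>x. x) x"
  unfolding mdiff_at_def
proof (intro conjI allI impI ballI)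
  fix \<phi> \<psi> assume A: "\<phi> \<in> atlas X" "\<psi> \<in> atlas X" "x \<in> fst \<phi>" "x \<in> fst \<psi>"
  then have "holo_vec_on (transition \<phi> \<psi>) (snd \<phi> ` (fst \<phi> \<inter> fst \<psi>))"
    using assms by (simp add: complex_manifold_def)
  then show "\<exists>D. (snd \<psi> \<circ> (\<lambda>x. x) \<circ> chart_inv \<phi> has_derivative (*v) D) (at (snd \<phi> x))"
    using A(3,4) unfolding holo_vec_on_iff transition_def by (auto simp: o_def)
qed auto

lemma points_mfd_restrict [simp]: "points (mfd_restrict X W) = points X \<inter> W"
  by (simp add: mfd_restrict_def)

lemma atlas_mfd_restrict: "\<phi> \<in> atlas X \<Longrightarrow> (fst \<phi> \<inter> W, snd \<phi>) \<in> atlas (mfd_restrict X W)"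
  unfolding mfd_restrict_def mfd.select_convs by blast

text \<open>Near the point, the charts of the open submanifold have the same inverses as those of the manifold.\<close>

lemma mdiff_at_restrict:
  assumes X: "charted X" "openin (mtop X) W" "x \<in> W" and Y: "openin (mtop Y) W'" "f x \<in> W'"
    and f: "mdiff_at (mfd_restrict X W) (mfd_restrict Y W') f x"
  shows "mdiff_at X Y f x"
  unfolding mdiff_at_def
proof (intro conjI allI impI ballI)
  have ptW: "points X \<inter> W = W" "points Y \<inter> W' = W'"
    using X(2) Y(1) openin_imp_subset by blast+
  fix V assume V: "openin (mtop Y) V" "f x \<in> V"
  have "openin (top_of_set W') (W' \<inter> V)"
  proof -
    obtain T where "open T" "V = points Y \<inter> T"
      using V(1) by (auto simp: openin_open)
    then show ?thesis
      using ptW(2) by (auto simp: openin_open intro!: exI[of _ T])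
  qed
  then have "openin (mtop (mfd_restrict Y W')) (W' \<inter> V)" "f x \<in> W' \<inter> V"
    using V(2) Y(2) by (simp_all add: ptW)
  from mdiff_atD1[OF f this] obtain U where "openin (mtop (mfd_restrict X W)) U" "x \<in> U" "f ` U \<subseteq> W' \<inter> V" .
  moreover from this have "openin (mtop X) U"
    using X(2) openin_trans by (simp add: ptW) blast
  ultimately show "\<exists>U. openin (mtop X) U \<and> x \<in> U \<and> f ` U \<subseteq> V"
    by blast
next
  fix \<phi> \<psi> assume A: "\<phi> \<in> atlas X" "\<psi> \<in> atlas Y" "x \<in> fst \<phi>" "f x \<in> fst \<psi>"
  let ?\<phi> = "(fst \<phi> \<inter> W, snd \<phi>)" and ?\<psi> = "(fst \<psi> \<inter> W', snd \<psi>)"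
  have "?\<phi> \<in> atlas (mfd_restrict X W)" "?\<psi> \<in> atlas (mfd_restrict Y W')"
    by (rule atlas_mfd_restrict[OF A(1)], rule atlas_mfd_restrict[OF A(2)])
  moreover have "x \<in> fst ?\<phi>" "f x \<in> fst ?\<psi>"
    using A(3,4) X(3) Y(2) by simp_all
  ultimately obtain D where "(snd ?\<psi> \<circ> f \<circ> chart_inv ?\<phi> has_derivative (*v) D) (at (snd ?\<phi> x))"
    by (rule mdiff_atD2[OF f])
  then have D: "(snd \<psi> \<circ> f \<circ> chart_inv ?\<phi> has_derivative (*v) D) (at (snd \<phi> x))"
    by simp
  have inj: "inj_on (snd \<phi>) (fst \<phi>)"
    by (rule inj_on_inverseI[where g = "chart_inv \<phi>"]) (rule chart_inv_left[OF X(1) A(1)])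
  have "\<forall>\<^sub>F w in nhds (snd \<phi> x). (snd \<psi> \<circ> f \<circ> chart_inv ?\<phi>) w = (snd \<psi> \<circ> f \<circ> chart_inv \<phi>) w"
    using eventually_chart_inv[OF X(1) A(1) X(2) A(3) X(3)]
  proof eventually_elim
    case (elim w)
    have "chart_inv ?\<phi> (snd \<phi> (chart_inv \<phi> w)) = chart_inv \<phi> w"
      unfolding chart_inv_def[of ?\<phi>] fst_conv snd_conv
      using elim inj_on_subset[OF inj] by (intro inv_into_f_f) simp_all
    then show ?case
      using elim by simp
  qed
  from has_derivative_cong_nhds[OF D this]
  show "\<exists>D. (snd \<psi> \<circ> f \<circ> chart_inv \<phi> has_derivative (*v) D) (at (snd \<phi> x))" ..
qed

lemma locally_biholo_local_inverse:
  assumes p: "locally_biholo_map Y X p" and Y: "charted Y" and X: "charted X" and y: "y \<in> points Y"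
  obtains W g where "y \<in> W" "openin (mtop Y) W" "openin (mtop X) (p ` W)"
    "\<And>w. w \<in> W \<Longrightarrow> g (p w) = w" "\<And>w. w \<in> W \<Longrightarrow> mdiff_at Y X p w"
    "\<And>x. x \<in> p ` W \<Longrightarrow> mdiff_at X Y g x"
proof -
  obtain W where W: "y \<in> W" "openin (mtop Y) W" "openin (mtop X) (p ` W)"
    and b: "biholo_map (mfd_restrict Y W) (mfd_restrict X (p ` W)) p"
    using p y unfolding locally_biholo_map_def by blast
  have ptW: "points Y \<inter> W = W" "points X \<inter> p ` W = p ` W"
    using W(2,3) openin_imp_subset by blast+
  obtain g where g: "holo_map (mfd_restrict X (p ` W)) (mfd_restrict Y W) g"
      "\<forall>x\<in>W. g (p x) = x" and pm: "holo_map (mfd_restrict Y W) (mfd_restrict X (p ` W)) p"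
    using b unfolding biholo_map_def points_mfd_restrict ptW by blast
  show ?thesis
  proof (rule that[OF W])
    show "g (p w) = w" if "w \<in> W" for w
      using g(2) that by blast
    show "mdiff_at Y X p w" if "w \<in> W" for w
    proof (rule mdiff_at_restrict[OF Y W(2) that W(3)])
      show "mdiff_at (mfd_restrict Y W) (mfd_restrict X (p ` W)) p w"
        by (rule holo_map_mdiff_at[OF pm]) (use that ptW in simp)
    qed (use that in blast)
    show "mdiff_at X Y g x" if "x \<in> p ` W" for x
    proof (rule mdiff_at_restrict[OF X W(3) that W(2)])
      show "g x \<in> W"
        using g(2) that by auto
      show "mdiff_at (mfd_restrict X (p ` W)) (mfd_restrict Y W) g x"
        by (rule holo_map_mdiff_at[OF g(1)]) (use that ptW in simp)
    qed
  qed
qed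

section \<open>Powers of one-dimensional manifolds\<close>

definition power_chart :: "('n::finite \<Rightarrow> ('a, 1) chart) \<Rightarrow> ('a ^ 'n, 'n) chart" where
  "power_chart c = ({p. \<forall>i. p $ i \<in> fst (c i)}, \<lambda>p. \<chi> i. snd (c i) (p $ i) $ 1)"

lemma atlas_mfd_power: "atlas (mfd_power M) = power_chart ` {c. \<forall>i. c i \<in> atlas M}"
  unfolding mfd_power_def mfd.select_convs power_chart_def by blast

lemma points_mfd_power: "points (mfd_power M) = {p. \<forall>i. p $ i \<in> points M}"
  by (simp add: mfd_power_def)

lemma vec_nth_1: "vec (v $ 1) = (v :: 'a ^ 1)"
  by (simp add: vec_eq_iff forall_1)

lemma snd_power_chart_nth: "vec (snd (power_chart c) p $ i) = snd (c i) (p $ i)"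
  by (simp add: power_chart_def vec_nth_1)

lemma bounded_linear_vec_nth_1: "bounded_linear (\<lambda>v :: complex ^ 'n::finite. vec (v $ i) :: complex ^ 1)"
proof -
  have "(\<lambda>v :: complex ^ 'n. vec (v $ i) :: complex ^ 1) = (\<lambda>v. axis 1 (v $ i))"
    by (simp add: fun_eq_iff vec_eq_iff forall_1 axis_def)
  then show ?thesis
    using bounded_linear_compose[OF bounded_linear_axis bounded_linear_vec_nth] by metis
qed

lemma power_chart_image:
  assumes M: "charted M" and c: "\<forall>i. c i \<in> atlas M"
  shows "snd (power_chart c) ` fst (power_chart c) = {v. \<forall>i. vec (v $ i) \<in> snd (c i) ` fst (c i)}"
proof (intro equalityI subsetI)
  fix v assume "v \<in> snd (power_chart c) ` fst (power_chart c)"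
  then obtain p where p: "p \<in> fst (power_chart c)" "v = snd (power_chart c) p"
    by blast
  show "v \<in> {v. \<forall>i. vec (v $ i) \<in> snd (c i) ` fst (c i)}"
    using p(1) unfolding p(2) by (simp add: snd_power_chart_nth) (simp add: power_chart_def)
next
  fix v :: "complex ^ 'b" assume v: "v \<in> {v. \<forall>i. vec (v $ i) \<in> snd (c i) ` fst (c i)}"
  define p where "p = (\<chi> i. chart_inv (c i) (vec (v $ i)))"
  have ci: "chart_inv (c i) (vec (v $ i)) \<in> fst (c i) \<and> snd (c i) (chart_inv (c i) (vec (v $ i))) = vec (v $ i)" for i
  proof -
    obtain x where "x \<in> fst (c i)" "vec (v $ i) = snd (c i) x"
      using v by blast
    then show ?thesis
      using chart_inv_left[OF M, of "c i" x] c by simp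
  qed
  then have "p \<in> fst (power_chart c)" "v = snd (power_chart c) p"
    by (simp_all add: p_def power_chart_def vec_eq_iff)
  then show "v \<in> snd (power_chart c) ` fst (power_chart c)"
    by blast
qed

lemma power_chart_inv_left:
  assumes M: "charted M" and c: "\<forall>i. c i \<in> atlas M" and p: "p \<in> fst (power_chart c)"
  shows "(\<chi> i. chart_inv (c i) (vec (snd (power_chart c) p $ i))) = p"
    and "chart_inv (power_chart c) (snd (power_chart c) p) = p"
proof -
  have left: "(\<chi> i. chart_inv (c i) (vec (snd (power_chart c) p $ i))) = p" if "p \<in> fst (power_chart c)" for p
    using that chart_inv_left[OF M] c unfolding snd_power_chart_nth
    by (simp add: vec_eq_iff power_chart_def)
  show "(\<chi> i. chart_inv (c i) (vec (snd (power_chart c) p $ i))) = p"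
    by (rule left[OF p])
  have "inj_on (snd (power_chart c)) (fst (power_chart c))"
    by (rule inj_onI) (metis left)
  then show "chart_inv (power_chart c) (snd (power_chart c) p) = p"
    unfolding chart_inv_def using p by (rule inv_into_f_f)
qed

lemma charted_mfd_power:
  assumes M: "charted M"
  shows "charted (mfd_power M :: ('a::topological_space ^ 'n::finite, 'n) mfd)"
  unfolding charted_def
proof (intro conjI ballI)
  show "\<Union>(fst ` atlas (mfd_power M)) = points (mfd_power M :: ('a ^ 'n, 'n) mfd)"
  proof (intro equalityI subsetI)
    fix p :: "'a ^ 'n" assume "p \<in> \<Union>(fst ` atlas (mfd_power M))"
    then obtain c where "\<forall>i. c i \<in> atlas M" "\<forall>i. p $ i \<in> fst (c i)"
      by (auto simp: atlas_mfd_power power_chart_def)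
    then show "p \<in> points (mfd_power M)"
      using subsetD[OF chartedD(4)[OF M]] unfolding points_mfd_power by blast
  next
    fix p :: "'a ^ 'n" assume "p \<in> points (mfd_power M)"
    then have pM: "p $ i \<in> points M" for i
      by (simp add: points_mfd_power)
    have "\<forall>i. \<exists>\<phi>. \<phi> \<in> atlas M \<and> p $ i \<in> fst \<phi>"
      using charted_obtain_chart[OF M pM] by blast
    from choice[OF this] obtain c where "\<forall>i. c i \<in> atlas M \<and> p $ i \<in> fst (c i)" ..
    then have "power_chart c \<in> atlas (mfd_power M)" "p \<in> fst (power_chart c)"
      by (auto simp: atlas_mfd_power power_chart_def)
    then show "p \<in> \<Union>(fst ` atlas (mfd_power M))"
      by blast
  qed
next
  fix \<phi> :: "('a ^ 'n, 'n) chart" assume "\<phi> \<in> atlas (mfd_power M)"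
  then obtain c where c: "\<forall>i. c i \<in> atlas M" and \<phi>: "\<phi> = power_chart c"
    by (auto simp: atlas_mfd_power)
  have "\<forall>i. \<exists>T. open T \<and> fst (c i) = points M \<inter> T"
    using chartedD(1)[OF M] c by (auto simp: openin_open)
  from choice[OF this] obtain T where T: "\<forall>i. open (T i) \<and> fst (c i) = points M \<inter> T i" ..
  then have "fst \<phi> = points (mfd_power M) \<inter> {p. \<forall>i. p $ i \<in> T i}"
    by (auto simp: \<phi> power_chart_def points_mfd_power)
  moreover have "open {p :: 'a ^ 'n. \<forall>i. p $ i \<in> T i}"
    using T by (intro open_vector_box) simp
  ultimately show "openin (mtop (mfd_power M)) (fst \<phi>)"
    by (auto simp: openin_open)
  have "continuous_on UNIV (vec :: complex \<Rightarrow> complex ^ 1)"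
    unfolding vec_def by (intro continuous_on_vec_lambda continuous_on_id)
  then have "open (vec -` (snd (c i) ` fst (c i)) :: complex set)" for i
    using chartedD(2)[OF M, of "c i"] c open_vimage by blast
  then have "open {v :: complex ^ 'n. \<forall>i. v $ i \<in> vec -` (snd (c i) ` fst (c i))}"
    by (intro open_vector_box) simp
  then show "open (snd \<phi> ` fst \<phi>)"
    by (simp add: \<phi> power_chart_image[OF M c] vimage_def)
  show "homeomorphism (fst \<phi>) (snd \<phi> ` fst \<phi>) (snd \<phi>) (chart_inv \<phi>)"
  proof (rule homeomorphismI)
    show "continuous_on (fst \<phi>) (snd \<phi>)"
      unfolding \<phi> power_chart_def fst_conv snd_conv
    proof (intro continuous_on_vec_lambda continuous_on_component)
      fix i
      show "continuous_on {p. \<forall>i. p $ i \<in> fst (c i)} (\<lambda>p. snd (c i) (p $ i))"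
        by (rule continuous_on_compose2[OF homeomorphism_cont1[OF chartedD(3)[OF M c[rule_format, of i]]]])
           (auto intro: continuous_on_component continuous_on_id)
    qed
    have "continuous_on (snd \<phi> ` fst \<phi>) (\<lambda>v. \<chi> i. chart_inv (c i) (vec (v $ i)))"
    proof (intro continuous_on_vec_lambda)
      fix i
      have "continuous_on (snd \<phi> ` fst \<phi>) (\<lambda>v. vec (v $ i) :: complex ^ 1)"
        by (rule linear_continuous_on[OF bounded_linear_vec_nth_1])
      then show "continuous_on (snd \<phi> ` fst \<phi>) (\<lambda>v. chart_inv (c i) (vec (v $ i)))"
        by (rule continuous_on_compose2[OF homeomorphism_cont2[OF chartedD(3)[OF M c[rule_format, of i]]]])
           (auto simp: \<phi> power_chart_image[OF M c])
    qed
    then show "continuous_on (snd \<phi> ` fst \<phi>) (chart_inv \<phi>)"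
      by (rule continuous_on_eq) (auto simp: \<phi> power_chart_inv_left[OF M c])
  qed (auto simp: \<phi> power_chart_inv_left[OF M c])
qed

lemma mdiff_at_power:
  fixes f :: "'a::topological_space \<Rightarrow> 'b::topological_space ^ 'm::finite"
  assumes f: "\<And>i. mdiff_at X M (\<lambda>y. f y $ i) x"
  shows "mdiff_at X (mfd_power M) f x"
  unfolding mdiff_at_def
proof (intro conjI allI impI ballI)
  fix V assume V: "openin (mtop (mfd_power M)) V" "f x \<in> V"
  then obtain T where T: "open T" "V = points (mfd_power M) \<inter> T"
    by (auto simp: openin_open)
  have "f x \<in> T"
    using V(2) T(2) by blast
  from bspec[OF T(1)[unfolded open_vec_def] this]
  obtain S where S: "\<forall>i. open (S i) \<and> f x $ i \<in> S i" "\<forall>p. (\<forall>i. p $ i \<in> S i) \<longrightarrow> p \<in> T"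
    by (elim exE conjE)
  have "\<exists>U. openin (mtop X) U \<and> x \<in> U \<and> (\<lambda>y. f y $ i) ` U \<subseteq> points M \<inter> S i" for i
  proof -
    have "openin (mtop M) (points M \<inter> S i)" "f x $ i \<in> points M \<inter> S i"
      using S(1) V(2) T(2) by (auto simp: openin_open_Int points_mfd_power)
    from mdiff_atD1[OF f[of i] this] show ?thesis
      by blast
  qed
  then have "\<forall>i. \<exists>U. openin (mtop X) U \<and> x \<in> U \<and> (\<lambda>y. f y $ i) ` U \<subseteq> points M \<inter> S i"
    by blast
  from choice[OF this] obtain U
    where U: "\<And>i. openin (mtop X) (U i)" "\<And>i. x \<in> U i" "\<And>i. (\<lambda>y. f y $ i) ` U i \<subseteq> points M \<inter> S i"
    by blast
  have "openin (mtop X) (\<Inter>i\<in>UNIV. U i)"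
    by (rule openin_INT2) (use U(1) in auto)
  moreover have "f ` (\<Inter>i\<in>UNIV. U i) \<subseteq> V"
  proof
    fix q assume "q \<in> f ` (\<Inter>i\<in>UNIV. U i)"
    then have "\<forall>i. q $ i \<in> points M \<inter> S i"
      using U(3) by blast
    then show "q \<in> V"
      using S(2) T(2) by (simp add: points_mfd_power)
  qed
  ultimately show "\<exists>U. openin (mtop X) U \<and> x \<in> U \<and> f ` U \<subseteq> V"
    using U(2) by blast
next
  fix \<phi> \<psi> assume \<phi>: "\<phi> \<in> atlas X" "x \<in> fst \<phi>" and "\<psi> \<in> atlas (mfd_power M)" "f x \<in> fst \<psi>"
  then obtain c where c: "\<forall>i. c i \<in> atlas M" and \<psi>: "\<psi> = power_chart c" and fx: "\<forall>i. f x $ i \<in> fst (c i)"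
    by (auto simp: atlas_mfd_power power_chart_def)
  have "\<forall>i. \<exists>D. (snd (c i) \<circ> (\<lambda>y. f y $ i) \<circ> chart_inv \<phi> has_derivative (*v) D) (at (snd \<phi> x))"
    using f \<phi> c fx unfolding mdiff_at_def by blast
  from choice[OF this] obtain D
    where D: "\<forall>i. (snd (c i) \<circ> (\<lambda>y. f y $ i) \<circ> chart_inv \<phi> has_derivative (*v) (D i)) (at (snd \<phi> x))" ..
  have "(snd \<psi> \<circ> f \<circ> chart_inv \<phi> has_derivative (*v) (\<chi> i. D i $ 1)) (at (snd \<phi> x))"
  proof (rule has_derivative_vec_components)
    fix i
    from bounded_linear.has_derivative[OF bounded_linear_vec_nth[of 1] D[rule_format, of i]]
    show "((\<lambda>z. (snd \<psi> \<circ> f \<circ> chart_inv \<phi>) z $ i) has_derivative (\<lambda>v. ((\<chi> i. D i $ 1) *v v) $ i)) (at (snd \<phi> x))"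
      by (simp add: \<psi> power_chart_def matrix_vector_mult_def)
  qed
  then show "\<exists>D. (snd \<psi> \<circ> f \<circ> chart_inv \<phi> has_derivative (*v) D) (at (snd \<phi> x))" ..
qed

lemma has_derivative_power_proj:
  "((\<lambda>v :: complex ^ 'n::finite. vec (v $ i) :: complex ^ 1) has_derivative (*v) (\<chi> k l. if l = i then 1 else 0)) F"
proof -
  have "(\<lambda>v :: complex ^ 'n. vec (v $ i) :: complex ^ 1) = (*v) (\<chi> k l. if l = i then 1 else 0)"
    by (simp add: fun_eq_iff vec_eq_iff matrix_vector_mult_def if_distrib[of "\<lambda>x. x * _"] cong: if_cong)
  then show ?thesis
    using bounded_linear_imp_has_derivative[OF bounded_linear_vec_nth_1[of i]] by simp
qed

lemma has_derivative_power_proj_chart: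
  fixes M :: "('a::topological_space, 1) mfd" and p :: "'a ^ 'n::finite"
  assumes M: "charted M" and c: "\<forall>i. c i \<in> atlas M" and p: "p \<in> fst (power_chart c)"
  shows "(snd (c i) \<circ> (\<lambda>p. p $ i) \<circ> chart_inv (power_chart c) has_derivative
    (*v) (\<chi> k l. if l = i then 1 else 0)) (at (snd (power_chart c) p))"
proof (rule has_derivative_cong_nhds[OF has_derivative_power_proj[of i]])
  have "power_chart c \<in> atlas (mfd_power M)"
    using c by (auto simp: atlas_mfd_power)
  from eventually_chart_inv[OF charted_mfd_power[OF M] this chartedD(1)[OF charted_mfd_power[OF M] this] p p]
  show "\<forall>\<^sub>F v in nhds (snd (power_chart c) p).
     vec (v $ i) = (snd (c i) \<circ> (\<lambda>p. p $ i) \<circ> chart_inv (power_chart c)) v"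
  proof eventually_elim
    case (elim v)
    then show ?case
      using snd_power_chart_nth[of c "chart_inv (power_chart c) v" i] by simp
  qed
qed

text \<open>Differentiability of the identity of \<open>M\<close> accounts for the change from the component of a product chart to
  another chart of \<open>M\<close>.\<close>

lemma mdiff_at_power_proj:
  fixes M :: "('a::topological_space, 1) mfd" and p :: "'a ^ 'n::finite"
  assumes M: "charted M" and id: "\<And>q. q \<in> points M \<Longrightarrow> mdiff_at M M (\<lambda>q. q) q"
    and p: "p \<in> points (mfd_power M)"
  shows "mdiff_at (mfd_power M) M (\<lambda>p. p $ i) p"
  unfolding mdiff_at_def
proof (intro conjI allI impI ballI)
  fix V assume V: "openin (mtop M) V" "p $ i \<in> V"
  then obtain T where T: "open T" "V = points M \<inter> T"
    by (auto simp: openin_open)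
  let ?U = "points (mfd_power M) \<inter> ((\<lambda>p. p $ i) -` T)"
  have "openin (mtop (mfd_power M)) ?U"
    using open_vimage_vec_nth[OF T(1)] by (rule openin_open_Int)
  moreover have "(\<lambda>p. p $ i) ` ?U \<subseteq> V"
    using T(2) by (auto simp: points_mfd_power)
  ultimately show "\<exists>U. openin (mtop (mfd_power M)) U \<and> p \<in> U \<and> (\<lambda>p. p $ i) ` U \<subseteq> V"
    using V(2) T(2) p by (intro exI[of _ ?U]) auto
next
  fix \<phi> \<kappa> assume \<phi>: "\<phi> \<in> atlas (mfd_power M)" "p \<in> fst \<phi>" and \<kappa>: "\<kappa> \<in> atlas M" "p $ i \<in> fst \<kappa>"
  obtain c where c: "\<forall>i. c i \<in> atlas M" and \<phi>_eq: "\<phi> = power_chart c"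
    using \<phi>(1) by (auto simp: atlas_mfd_power)
  have pi: "p $ i \<in> fst (c i)" "p $ i \<in> points M"
    using \<phi>(2) p by (auto simp: \<phi>_eq power_chart_def points_mfd_power)
  obtain E where E: "(snd \<kappa> \<circ> (\<lambda>q. q) \<circ> chart_inv (c i) has_derivative (*v) E) (at (snd (c i) (p $ i)))"
    using mdiff_atD2[OF id[OF pi(2)] c[rule_format] \<kappa>(1) pi(1) \<kappa>(2)] .
  have "(snd \<kappa> \<circ> (\<lambda>p. p $ i) \<circ> chart_inv \<phi> has_derivative
      (*v) (E ** (\<chi> k l. if l = i then 1 else 0))) (at (snd \<phi> p))"
  proof (rule has_derivative_cong_nhds)
    show "((snd \<kappa> \<circ> (\<lambda>q. q) \<circ> chart_inv (c i)) \<circ> (\<lambda>v. vec (v $ i)) has_derivative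
      (*v) (E ** (\<chi> k l. if l = i then 1 else 0))) (at (snd \<phi> p))"
      by (rule has_derivative_matrix_compose[OF has_derivative_power_proj])
         (use E in \<open>simp add: \<phi>_eq snd_power_chart_nth\<close>)
    have ci: "c i \<in> atlas M"
      using c by blast
    from eventually_chart_inv[OF charted_mfd_power[OF M] \<phi>(1) chartedD(1)[OF charted_mfd_power[OF M] \<phi>(1)] \<phi>(2) \<phi>(2)]
    show "\<forall>\<^sub>F v in nhds (snd \<phi> p). ((snd \<kappa> \<circ> (\<lambda>q. q) \<circ> chart_inv (c i)) \<circ> (\<lambda>v. vec (v $ i))) v =
        (snd \<kappa> \<circ> (\<lambda>p. p $ i) \<circ> chart_inv \<phi>) v"
    proof eventually_elim
      case (elim v)
      have "vec (v $ i) = snd (c i) (chart_inv \<phi> v $ i)" "chart_inv \<phi> v $ i \<in> fst (c i)"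
        using elim snd_power_chart_nth[of c "chart_inv \<phi> v" i] by (simp_all add: \<phi>_eq) (simp add: power_chart_def)
      then show ?case
        using chart_inv_left[OF M ci] by simp
    qed
  qed
  then show "\<exists>D. (snd \<kappa> \<circ> (\<lambda>p. p $ i) \<circ> chart_inv \<phi> has_derivative (*v) D) (at (snd \<phi> p))" ..
qed

text \<open>The chain rule applied to \<open>g \<circ> f\<close>, which is the identity near \<open>x\<close>.\<close>

lemma has_derivative_chart_inverse:
  fixes X :: "('a::topological_space, 'n::finite) mfd" and Y :: "('b::topological_space, 'n) mfd"
  assumes X: "charted X" "\<phi> \<in> atlas X" "x \<in> fst \<phi>" and Y: "charted Y" "\<kappa> \<in> atlas Y" "f x \<in> fst \<kappa>"
    and f: "mdiff_at X Y f x"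
    and D: "(snd \<kappa> \<circ> f \<circ> chart_inv \<phi> has_derivative (*v) D) (at (snd \<phi> x))"
    and E: "(snd \<phi> \<circ> g \<circ> chart_inv \<kappa> has_derivative (*v) E) (at (snd \<kappa> (f x)))"
    and U: "openin (mtop X) U" "x \<in> U" "\<And>y. y \<in> U \<Longrightarrow> g (f y) = y"
  shows "E ** D = mat 1"
proof -
  have "(snd \<phi> \<circ> (\<lambda>y. y) \<circ> chart_inv \<phi> has_derivative (*v) (E ** D)) (at (snd \<phi> x))"
    by (rule has_derivative_chart_cong[OF X U(1,2) _ has_derivative_chart_compose[OF X Y f D E]])
       (simp add: U(3))
  moreover have "\<forall>\<^sub>F z in nhds (snd \<phi> x). (snd \<phi> \<circ> (\<lambda>y. y) \<circ> chart_inv \<phi>) z = z"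
    using eventually_chart_inv[OF X(1,2) U(1) X(3) U(2)] by eventually_elim simp
  ultimately have "((\<lambda>z. z) has_derivative (*v) (E ** D)) (at (snd \<phi> x))"
    by (rule has_derivative_cong_nhds)
  moreover have "(*v) (mat 1) = (\<lambda>z :: complex ^ 'n. z)"
    by (rule ext) simp
  then have "((\<lambda>z. z) has_derivative (*v) (mat 1)) (at (snd \<phi> x))"
    by simp
  ultimately show ?thesis
    by (rule has_derivative_matrix_unique)
qed

text \<open>The inverse is a parameter, so that the roles of the two maps can be exchanged.\<close>

definition mfd_automorphism ::
    "('a::topological_space, 'n::finite) mfd \<Rightarrow> ('a \<Rightarrow> 'a) \<Rightarrow> ('a \<Rightarrow> 'a) \<Rightarrow> bool" where
  "mfd_automorphism P F G \<longleftrightarrow>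
     (\<forall>x\<in>points P. F x \<in> points P \<and> G x \<in> points P \<and> mdiff_at P P F x \<and> mdiff_at P P G x \<and>
        G (F x) = x \<and> F (G x) = x)"

lemma mfd_automorphism_derivative_inverse:
  assumes P: "charted P" "\<phi> \<in> atlas P" "x \<in> fst \<phi>" "\<psi> \<in> atlas P" "F x \<in> fst \<psi>"
    and F: "mfd_automorphism P F G"
    and D: "(snd \<psi> \<circ> F \<circ> chart_inv \<phi> has_derivative (*v) D) (at (snd \<phi> x))"
  obtains B where "(snd \<phi> \<circ> G \<circ> chart_inv \<psi> has_derivative (*v) B) (at (snd \<psi> (F x)))"
    "B ** D = mat 1" "D ** B = mat 1"
proof -
  have x: "x \<in> points P" "F x \<in> points P"
    using P chartedD(4) by blast+
  have G: "mdiff_at P P G (F x)" "G (F x) \<in> fst \<phi>" and mF: "mdiff_at P P F x"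
    using F x P(3) by (simp_all add: mfd_automorphism_def)
  obtain B where B: "(snd \<phi> \<circ> G \<circ> chart_inv \<psi> has_derivative (*v) B) (at (snd \<psi> (F x)))"
    using mdiff_atD2[OF G(1) P(4,2,5) G(2)] .
  have "B ** D = mat 1"
  proof (rule has_derivative_chart_inverse[OF P(1-3) P(1,4,5) mF D B openin_subtopology_self x(1)])
    show "G (F y) = y" if "y \<in> points P" for y
      using F that by (simp add: mfd_automorphism_def)
  qed
  then show ?thesis
    using that[OF B] matrix_left_right_inverse by blast
qed

lemma mdiff_at_const:
  fixes X :: "('a::topological_space, 'c::finite) mfd" and Y :: "('b::topological_space, 'd::finite) mfd"
  assumes "x \<in> points X"
  shows "mdiff_at X Y (\<lambda>_. a) x"
  unfolding mdiff_at_def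
proof (intro conjI allI impI ballI)
  fix V assume "openin (mtop Y) V" "a \<in> V"
  then show "\<exists>U. openin (mtop X) U \<and> x \<in> U \<and> (\<lambda>_. a) ` U \<subseteq> V"
    using assms by (intro exI[of _ "points X"]) auto
next
  fix \<phi> :: "('a, 'c) chart" and \<psi> :: "('b, 'd) chart"
  show "\<exists>D. (snd \<psi> \<circ> (\<lambda>_. a) \<circ> chart_inv \<phi> has_derivative (*v) D) (at (snd \<phi> x))"
  proof (intro exI[of _ 0])
    have "(*v) 0 = (\<lambda>_ :: complex ^ 'c. 0 :: complex ^ 'd)"
      by (rule ext) (simp add: vec_eq_iff matrix_vector_mult_def)
    then show "(snd \<psi> \<circ> (\<lambda>_. a) \<circ> chart_inv \<phi> has_derivative (*v) 0) (at (snd \<phi> x))"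
      by (simp add: o_def)
  qed
qed

section \<open>Lifting in covering spaces of topological spaces\<close>

text \<open>A sheet \<open>V\<close> over \<open>U\<close> with inverse \<open>q\<close>: besides \<open>V\<close>, the rest of the preimage of \<open>U\<close> is open too,
  so the lift of a connected set to the preimage of \<open>U\<close> cannot leave \<open>V\<close>.\<close>

definition sheet_over ::
    "'a::topological_space set \<Rightarrow> ('a \<Rightarrow> 'b::topological_space) \<Rightarrow> 'b set \<Rightarrow> 'a set \<Rightarrow> ('b \<Rightarrow> 'a) \<Rightarrow> bool" where
  "sheet_over C p U V q \<longleftrightarrow> openin (top_of_set C) V \<and> openin (top_of_set C) (C \<inter> p -` U - V) \<and>
     V \<subseteq> C \<inter> p -` U \<and> homeomorphism V U p q"

lemma covering_space_sheets:
  assumes "covering_space C p S" "x \<in> S"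
  obtains U where "x \<in> U" "openin (top_of_set S) U"
    "\<forall>b\<in>C. p b \<in> U \<longrightarrow> (\<exists>V q. b \<in> V \<and> sheet_over C p U V q)"
proof -
  have "\<forall>x\<in>S. \<exists>T. x \<in> T \<and> openin (top_of_set S) T \<and> (\<exists>v. \<Union>v = C \<inter> p -` T \<and>
      (\<forall>u\<in>v. openin (top_of_set C) u) \<and> pairwise disjnt v \<and> (\<forall>u\<in>v. \<exists>q. homeomorphism u T p q))"
    using assms(1) unfolding covering_space_def by (elim conjE)
  from bspec[OF this assms(2)] obtain U \<V> where U: "x \<in> U" "openin (top_of_set S) U"
    and \<V>: "\<Union>\<V> = C \<inter> p -` U" "\<forall>V\<in>\<V>. openin (top_of_set C) V" "pairwise disjnt \<V>"
      "\<forall>V\<in>\<V>. \<exists>q. homeomorphism V U p q"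
    by (elim exE conjE)
  have "\<exists>V q. b \<in> V \<and> sheet_over C p U V q" if b: "b \<in> C" "p b \<in> U" for b
  proof -
    obtain V where V: "V \<in> \<V>" "b \<in> V"
      using \<V>(1) b by blast
    have "V \<subseteq> C \<inter> p -` U"
      using \<V>(1) V(1) by blast
    moreover have "C \<inter> p -` U - V = \<Union>(\<V> - {V})"
    proof -
      have "W \<inter> V = {}" if "W \<in> \<V>" "W \<noteq> V" for W
        using \<V>(3) V(1) that by (simp add: pairwise_def disjnt_def)
      then show ?thesis
        unfolding \<V>(1)[symmetric] by blast
    qed
    moreover have "openin (top_of_set C) (\<Union>(\<V> - {V}))"
      using \<V>(2) by (intro openin_Union) simp
    moreover obtain q where "homeomorphism V U p q"
      using \<V>(4) V(1) by blast
    ultimately have "sheet_over C p U V q"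
      using \<V>(2) V(1) by (simp add: sheet_over_def)
    then show ?thesis
      using V(2) by blast
  qed
  then show ?thesis
    using that[OF U] by simp
qed

lemma openin_subtopology_dist:
  fixes x :: "'a::metric_space"
  assumes "openin (top_of_set T) S" "x \<in> S"
  obtains d where "d > 0" "\<forall>u\<in>T. dist u x < d \<longrightarrow> u \<in> S"
  using assms unfolding openin_euclidean_subtopology_iff by blast

lemma connected_in_sheet:
  assumes "connected T" "continuous_on T g" "g ` T \<subseteq> W" "t0 \<in> T" "g t0 \<in> V"
    "openin (top_of_set C) V" "openin (top_of_set C) (W - V)" "W \<subseteq> C"
  shows "g ` T \<subseteq> V"
proof -
  have TC: "g \<in> T \<rightarrow> C"
    using assms(3,8) by blast
  have "openin (top_of_set T) (T \<inter> g -` V)" "openin (top_of_set T) (T \<inter> g -` (W - V))"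
    using continuous_openin_preimage[OF assms(2) TC] assms(6,7) by blast+
  moreover have "T \<inter> g -` (W - V) = T - (T \<inter> g -` V)"
    using assms(3) by blast
  ultimately have "T \<inter> g -` V = {} \<or> T \<inter> g -` V = T"
    using assms(1) unfolding connected_clopen closedin_def by simp
  then show ?thesis
    using assms(4,5) by blast
qed

text \<open>Agreement of two lifts is an open condition, as \<open>p\<close> is injective on a sheet, and so is disagreement: if
  \<open>g\<^sub>1\<close> lies in a sheet and \<open>g\<^sub>2\<close> outside of it, this remains so nearby.\<close>

lemma covering_lift_unique:
  assumes cov: "covering_space C p S" and T: "connected T"
    and g: "continuous_on T g1" "continuous_on T g2" "g1 ` T \<subseteq> C" "g2 ` T \<subseteq> C"
    and eq: "\<And>t. t \<in> T \<Longrightarrow> p (g1 t) = p (g2 t)"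
    and t0: "t0 \<in> T" "g1 t0 = g2 t0" and t: "t \<in> T"
  shows "g1 t = g2 t"
proof (rule connected_induction_simple[where P = "\<lambda>t. g1 t = g2 t", OF T t0(1) t t0(2)])
  fix s assume s: "s \<in> T"
  have gC: "g1 \<in> T \<rightarrow> C" "g2 \<in> T \<rightarrow> C"
    using g by auto
  have "p (g1 s) \<in> S"
    using covering_space_imp_surjective[OF cov] g(3) s by blast
  from covering_space_sheets[OF cov this]
  obtain U where U: "p (g1 s) \<in> U" "openin (top_of_set S) U"
    "\<forall>b\<in>C. p b \<in> U \<longrightarrow> (\<exists>V q. b \<in> V \<and> sheet_over C p U V q)" .
  have "g1 s \<in> C"
    using g s by blast
  then obtain V q where "g1 s \<in> V" "sheet_over C p U V q"
    using U by blast
  then have V: "g1 s \<in> V" "openin (top_of_set C) V" "openin (top_of_set C) (C \<inter> p -` U - V)"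
      "V \<subseteq> C \<inter> p -` U" "homeomorphism V U p q"
    by (simp_all add: sheet_over_def)
  have inj: "a = b" if "a \<in> V" "b \<in> V" "p a = p b" for a b
    using that homeomorphism_apply1[OF V(5)] by metis
  show "\<exists>N. openin (top_of_set T) N \<and> s \<in> N \<and> (\<forall>x\<in>N. \<forall>y\<in>N. g1 x = g2 x \<longrightarrow> g1 y = g2 y)"
  proof (cases "g2 s \<in> V")
    case True
    let ?N = "(T \<inter> g1 -` V) \<inter> (T \<inter> g2 -` V)"
    have "openin (top_of_set T) ?N"
      by (intro openin_Int continuous_openin_preimage[OF g(1) gC(1)] continuous_openin_preimage[OF g(2) gC(2)] V)
    moreover have "s \<in> ?N"
      using s V True by simp
    moreover have "\<forall>x\<in>?N. \<forall>y\<in>?N. g1 x = g2 x \<longrightarrow> g1 y = g2 y"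
      by (intro ballI impI, rule inj) (auto simp: eq)
    ultimately show ?thesis by blast
  next
    case False
    let ?N = "(T \<inter> g1 -` V) \<inter> (T \<inter> g2 -` (C \<inter> p -` U - V))"
    have "openin (top_of_set T) ?N"
      by (intro openin_Int continuous_openin_preimage[OF g(1) gC(1)] continuous_openin_preimage[OF g(2) gC(2)] V)
    moreover have "s \<in> ?N"
      using s V False U(1) eq[OF s] g by auto
    moreover have "\<forall>x\<in>?N. \<forall>y\<in>?N. g1 x = g2 x \<longrightarrow> g1 y = g2 y"
      by auto
    ultimately show ?thesis by blast
  qed
qed

text \<open>Bisection of the time interval: liftability for every starting point passes from two adjacent
  intervals to their union, and holds over short intervals, where the path stays in an evenly covered set.\<close>

lemma covering_lift_path:
  fixes g :: "real \<Rightarrow> 'a::topological_space"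
  assumes cov: "covering_space C p S" and g: "continuous_on {0..1} g" "g ` {0..1} \<subseteq> S"
    and b: "b \<in> C" "p b = g 0"
  obtains \<beta> where "continuous_on {0..1} \<beta>" "\<beta> ` {0..1} \<subseteq> C" "\<beta> 0 = b" "\<And>t. t \<in> {0..1} \<Longrightarrow> p (\<beta> t) = g t"
proof -
  define P where "P s t \<longleftrightarrow> (0 \<le> s \<longrightarrow> t \<le> 1 \<longrightarrow> (\<forall>b\<in>C. p b = g s \<longrightarrow>
      (\<exists>\<beta>. continuous_on {s..t} \<beta> \<and> \<beta> ` {s..t} \<subseteq> C \<and> \<beta> s = b \<and> (\<forall>u\<in>{s..t}. p (\<beta> u) = g u))))" for s t
  have "P 0 1"
  proof (induction rule: Bolzano[OF zero_le_one])
    case (1 r s t)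
    show ?case
      unfolding P_def
    proof (intro impI ballI)
      fix b assume A: "0 \<le> r" "t \<le> 1" "b \<in> C" "p b = g r"
      have rst: "r \<le> s" "s \<le> t" "0 \<le> s" "s \<le> 1"
        using 1(3,4) A by auto
      have "\<exists>\<beta>. continuous_on {r..s} \<beta> \<and> \<beta> ` {r..s} \<subseteq> C \<and> \<beta> r = b \<and> (\<forall>u\<in>{r..s}. p (\<beta> u) = g u)"
        using 1(1) A rst unfolding P_def by blast
      then obtain \<beta> where \<beta>: "continuous_on {r..s} \<beta>" "\<beta> ` {r..s} \<subseteq> C" "\<beta> r = b" "\<forall>u\<in>{r..s}. p (\<beta> u) = g u"
        by blast
      have "\<beta> s \<in> C" "p (\<beta> s) = g s"
        using \<beta> rst by auto
      then have "\<exists>\<gamma>. continuous_on {s..t} \<gamma> \<and> \<gamma> ` {s..t} \<subseteq> C \<and> \<gamma> s = \<beta> s \<and> (\<forall>u\<in>{s..t}. p (\<gamma> u) = g u)"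
        using 1(2) A rst unfolding P_def by blast
      then obtain \<gamma> where \<gamma>: "continuous_on {s..t} \<gamma>" "\<gamma> ` {s..t} \<subseteq> C" "\<gamma> s = \<beta> s" "\<forall>u\<in>{s..t}. p (\<gamma> u) = g u"
        by blast
      have split: "{r..t} = {r..s} \<union> {s..t}"
        using rst by auto
      show "\<exists>\<beta>. continuous_on {r..t} \<beta> \<and> \<beta> ` {r..t} \<subseteq> C \<and> \<beta> r = b \<and> (\<forall>u\<in>{r..t}. p (\<beta> u) = g u)"
      proof (intro exI conjI)
        show "continuous_on {r..t} (\<lambda>u. if u \<le> s then \<beta> u else \<gamma> u)"
          unfolding split using \<beta> \<gamma> by (intro continuous_on_cases) auto
      qed (use \<beta> \<gamma> rst in \<open>auto simp: image_subset_iff\<close>)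
    qed
  next
    case (2 x)
    then have "g x \<in> S"
      using g(2) by auto
    from covering_space_sheets[OF cov this]
  obtain U where U: "g x \<in> U" "openin (top_of_set S) U"
    "\<forall>b\<in>C. p b \<in> U \<longrightarrow> (\<exists>V q. b \<in> V \<and> sheet_over C p U V q)" .
    have "g \<in> {0..1} \<rightarrow> S"
      using g(2) by blast
    from continuous_openin_preimage[OF g(1) this U(2)]
    have "openin (top_of_set {0..1}) ({0..1} \<inter> g -` U)" .
    moreover have "x \<in> {0..1} \<inter> g -` U"
      using 2 U(1) by simp
    ultimately obtain d where d: "d > 0" "\<forall>u\<in>{0..1}. dist u x < d \<longrightarrow> u \<in> {0..1} \<inter> g -` U"
      by (rule openin_subtopology_dist)
    show ?case
    proof (intro exI[of _ d] conjI allI impI)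
      fix s t assume st: "s \<le> x \<and> x \<le> t \<and> t - s < d"
      show "P s t"
        unfolding P_def
      proof (intro impI ballI)
        fix b assume A: "0 \<le> s" "t \<le> 1" "b \<in> C" "p b = g s"
        have gU: "g ` {s..t} \<subseteq> U"
          using d(2) st A by (force simp: dist_real_def)
        then have "p b \<in> U"
          using A st by auto
        then obtain V q where "b \<in> V" "sheet_over C p U V q"
          using U(3) A(3) by blast
        then have V: "b \<in> V" "V \<subseteq> C \<inter> p -` U" "homeomorphism V U p q"
          by (simp_all add: sheet_over_def)
        have "continuous_on {s..t} (q \<circ> g)"
        proof (rule continuous_on_compose)
          show "continuous_on {s..t} g"
            using A by (intro continuous_on_subset[OF g(1)]) auto
          show "continuous_on (g ` {s..t}) q"
            using continuous_on_subset[OF homeomorphism_cont2[OF V(3)] gU] .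
        qed
        moreover have "q u \<in> V" "p (q u) = u" if "u \<in> U" for u
          using homeomorphism_image2[OF V(3)] homeomorphism_apply2[OF V(3) that] that by auto
        moreover have "q (p b) = b"
          by (rule homeomorphism_apply1[OF V(3,1)])
        ultimately show "\<exists>\<beta>. continuous_on {s..t} \<beta> \<and> \<beta> ` {s..t} \<subseteq> C \<and> \<beta> s = b \<and> (\<forall>u\<in>{s..t}. p (\<beta> u) = g u)"
          using gU V(2) A by (intro exI[of _ "q \<circ> g"]) (auto simp: image_subset_iff)
      qed
    qed (rule d)
  qed
  then have "\<exists>\<beta>. continuous_on {0..1} \<beta> \<and> \<beta> ` {0..1} \<subseteq> C \<and> \<beta> 0 = b \<and> (\<forall>u\<in>{0..1}. p (\<beta> u) = g u)"
    using b unfolding P_def by simp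
  then show ?thesis
    using that by blast
qed

text \<open>Fix \<open>s\<^sub>0\<close>. The set of times \<open>t\<close> at which \<open>s \<mapsto> \<beta> s t\<close> is continuous at \<open>s\<^sub>0\<close> is open and closed, because
  over a small time interval every lift with \<open>s\<close> near \<open>s\<^sub>0\<close> stays in one sheet.\<close>

lemma covering_lift_family_continuous:
  fixes H :: "real \<Rightarrow> real \<Rightarrow> 'a::topological_space"
  assumes cov: "covering_space C p S"
    and H: "continuous_on ({0..1} \<times> {0..1}) (\<lambda>(s, t). H s t)" "\<And>s t. s \<in> {0..1} \<Longrightarrow> t \<in> {0..1} \<Longrightarrow> H s t \<in> S"
    and \<beta>: "\<And>s. s \<in> {0..1} \<Longrightarrow> continuous_on {0..1} (\<beta> s)" "\<And>s. s \<in> {0..1} \<Longrightarrow> \<beta> s ` {0..1} \<subseteq> C"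
      "\<And>s t. s \<in> {0..1} \<Longrightarrow> t \<in> {0..1} \<Longrightarrow> p (\<beta> s t) = H s t"
    and start: "continuous_on {0..1} (\<lambda>s. \<beta> s 0)"
    and t: "t \<in> {0..1}"
  shows "continuous_on {0..1} (\<lambda>s. \<beta> s t)"
proof -
  define P where "P s0 t \<longleftrightarrow> (\<forall>W. openin (top_of_set C) W \<longrightarrow> \<beta> s0 t \<in> W \<longrightarrow>
    (\<exists>e>0. \<forall>s\<in>{0..1}. dist s s0 < e \<longrightarrow> \<beta> s t \<in> W))" for s0 t
  have P_iff: "continuous_on {0..1} (\<lambda>s. \<beta> s t) \<longleftrightarrow> (\<forall>s0\<in>{0..1}. P s0 t)" if t: "t \<in> {0..1}" for t
  proof -
    have im: "(\<lambda>s. \<beta> s t) \<in> {0..1} \<rightarrow> C"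
      using \<beta>(2) t by blast
    have "openin (top_of_set {0..1}) ({0..1} \<inter> (\<lambda>s. \<beta> s t) -` W) \<longleftrightarrow>
        (\<forall>s0\<in>{0..1}. \<beta> s0 t \<in> W \<longrightarrow> (\<exists>e>0. \<forall>s\<in>{0..1}. dist s s0 < e \<longrightarrow> \<beta> s t \<in> W))" for W
      unfolding openin_euclidean_subtopology_iff by auto
    then show ?thesis
      unfolding continuous_on_open_gen[OF im] P_def by (intro iffI allI ballI impI) simp_all
  qed
  have "P s0 t" if s0: "s0 \<in> {0..1}" for s0
  proof (rule connected_induction_simple[of "{0..1::real}" 0 t])
    show "P s0 0"
      using start P_iff[of 0] s0 by simp
    fix t0 :: real assume t0: "t0 \<in> {0..1}"
    from covering_space_sheets[OF cov H(2)[OF s0 t0]]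
    obtain U where U: "H s0 t0 \<in> U" "openin (top_of_set S) U"
      "\<forall>b\<in>C. p b \<in> U \<longrightarrow> (\<exists>V q. b \<in> V \<and> sheet_over C p U V q)" .
    have "(\<lambda>(s, t). H s t) \<in> {0..1} \<times> {0..1} \<rightarrow> S"
      using H(2) by auto
    from continuous_openin_preimage[OF H(1) this U(2)]
    have "openin (top_of_set ({0..1} \<times> {0..1})) (({0..1} \<times> {0..1}) \<inter> (\<lambda>(s, t). H s t) -` U)" .
    moreover have "(s0, t0) \<in> ({0..1} \<times> {0..1}) \<inter> (\<lambda>(s, t). H s t) -` U"
      using s0 t0 U(1) by simp
    ultimately obtain d where d: "d > 0"
      "\<forall>x\<in>{0..1} \<times> {0..1}. dist x (s0, t0) < d \<longrightarrow> x \<in> ({0..1} \<times> {0..1}) \<inter> (\<lambda>(s, t). H s t) -` U"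
      by (rule openin_subtopology_dist)
    have HU: "H s t \<in> U" if "s \<in> {0..1}" "t \<in> {0..1}" "dist s s0 < d/2" "dist t t0 < d/2" for s t
    proof -
      have "dist (s, t) (s0, t0) \<le> dist s s0 + dist t t0"
        unfolding dist_prod_def using sqrt_sum_squares_le_sum_abs[of "dist s s0" "dist t t0"] by simp
      then show ?thesis
        using d(2) that by force
    qed
    \<comment> \<open>A time interval during which \<open>H s\<close> stays in \<open>U\<close>, for all \<open>s\<close> near \<open>s\<^sub>0\<close>.\<close>
    let ?T = "{0..1} \<inter> ball t0 (d/2)"
    have conn: "connected ?T"
      by (intro convex_connected convex_Int convex_ball) simp
    have "P s0 y" if x: "x \<in> ?T" and y: "y \<in> ?T" and Px: "P s0 x" for x y
      unfolding P_def
    proof (intro allI impI)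
      fix W assume W: "openin (top_of_set C) W" "\<beta> s0 y \<in> W"
      have in_sheet: "\<beta> s ` ?T \<subseteq> V" if "s \<in> {0..1}" "dist s s0 < d/2" "u \<in> ?T" "\<beta> s u \<in> V"
        "openin (top_of_set C) V" "openin (top_of_set C) (C \<inter> p -` U - V)" for s u V
      proof (rule connected_in_sheet[where W = "C \<inter> p -` U" and C = C and ?t0.0 = u])
        show "continuous_on ?T (\<beta> s)"
          using \<beta>(1)[OF that(1)] by (rule continuous_on_subset) auto
        show "\<beta> s ` ?T \<subseteq> C \<inter> p -` U"
          using \<beta>(2)[OF that(1)] \<beta>(3)[OF that(1)] HU[OF that(1) _ that(2)] by (auto simp: dist_commute)
      qed (use conn that in auto)
      have "\<beta> s0 x \<in> C" "p (\<beta> s0 x) \<in> U"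
        using \<beta>(2)[OF s0] \<beta>(3)[OF s0, of x] HU[OF s0, of x] x d(1) by (auto simp: dist_commute)
      then obtain V q where "\<beta> s0 x \<in> V" "sheet_over C p U V q"
        using U(3) by blast
      then have V: "\<beta> s0 x \<in> V" "openin (top_of_set C) V"
          "openin (top_of_set C) (C \<inter> p -` U - V)" "V \<subseteq> C \<inter> p -` U" "homeomorphism V U p q"
        by (simp_all add: sheet_over_def)
      \<comment> \<open>The lifts that are in \<open>V\<close> at time \<open>x\<close> are still there at time \<open>y\<close>, where they are given by the section \<open>q\<close>.\<close>
      have q: "\<beta> s y = q (H s y)" if "s \<in> {0..1}" "dist s s0 < d/2" "\<beta> s x \<in> V" for s
      proof -
        have "\<beta> s y \<in> V"
          using in_sheet[OF that(1,2) x that(3) V(2,3)] y by blast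
        then show ?thesis
          using homeomorphism_apply1[OF V(5), of "\<beta> s y"] \<beta>(3)[OF that(1), of y] y by simp
      qed
      have "q ` U \<subseteq> C"
        using V(4,5) homeomorphism_image2 by blast
      then have "openin (top_of_set U) (U \<inter> q -` W)"
        by (intro continuous_openin_preimage[OF homeomorphism_cont2[OF V(5)] _ W(1)]) blast
      then have opS: "openin (top_of_set S) (U \<inter> q -` W)"
        using U(2) by (rule openin_trans)
      have "continuous_on {0..1} (\<lambda>s. case (s, y) of (s, t) \<Rightarrow> H s t)"
        by (rule continuous_on_compose2[OF H(1)]) (use y in \<open>auto intro!: continuous_intros\<close>)
      then have "continuous_on {0..1} (\<lambda>s. H s y)"
        by simp
      moreover have "(\<lambda>s. H s y) \<in> {0..1} \<rightarrow> S"
        using H(2) y by auto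
      ultimately have "openin (top_of_set {0..1}) ({0..1} \<inter> (\<lambda>s. H s y) -` (U \<inter> q -` W))"
        using opS by (rule continuous_openin_preimage)
      moreover have "s0 \<in> {0..1} \<inter> (\<lambda>s. H s y) -` (U \<inter> q -` W)"
        using q[OF s0 _ V(1)] W(2) HU[OF s0, of y] s0 y d(1) by (simp add: dist_commute)
      ultimately obtain e1 where e1: "e1 > 0"
        "\<forall>s\<in>{0..1}. dist s s0 < e1 \<longrightarrow> s \<in> {0..1} \<inter> (\<lambda>s. H s y) -` (U \<inter> q -` W)"
        by (rule openin_subtopology_dist)
      obtain e2 where e2: "e2 > 0" "\<forall>s\<in>{0..1}. dist s s0 < e2 \<longrightarrow> \<beta> s x \<in> V"
        using Px V(1,2) unfolding P_def by blast
      show "\<exists>e>0. \<forall>s\<in>{0..1}. dist s s0 < e \<longrightarrow> \<beta> s y \<in> W"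
      proof (intro exI conjI ballI impI)
        show "min (d/2) (min e1 e2) > 0"
          using e1 e2 d by simp
        show "\<beta> s y \<in> W" if "s \<in> {0..1}" "dist s s0 < min (d/2) (min e1 e2)" for s
          using q[of s] e1(2) e2(2) that by auto
      qed
    qed
    moreover have "openin (top_of_set {0..1}) ?T" "t0 \<in> ?T"
      using t0 d(1) by (auto intro: openin_open_Int)
    ultimately show "\<exists>T. openin (top_of_set {0..1}) T \<and> t0 \<in> T \<and> (\<forall>x\<in>T. \<forall>y\<in>T. P s0 x \<longrightarrow> P s0 y)"
      by blast
  qed (use t in auto)
  then show ?thesis
    using P_iff[OF t] by blast
qed

lemma simply_connected_homotopic_loops:
  assumes "simply_connected C" "path f" "path_image f \<subseteq> C" "pathfinish f = pathstart f"
    "path g" "path_image g \<subseteq> C" "pathfinish g = pathstart g"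
  shows "homotopic_loops C f g"
  using assms unfolding simply_connected_def by blast

lemma path_const: "path (\<lambda>_. a)" "path_image (\<lambda>_. a) = {a}"
  by (auto simp: path_def path_image_def)

text \<open>Contract the loop \<open>\<gamma>\<close> by a homotopy \<open>K\<close> of loops, and let \<open>H\<close> be its image in the base. The initial points of
  the lifts of the loops \<open>H s\<close> form a lift of the path \<open>s \<mapsto> H s 0\<close>, and so do the end points. At \<open>s = 1\<close> the loop is
  constant, so both lifts agree there, and hence they agree at \<open>s = 0\<close>.\<close>

lemma simply_connected_loop_lift:
  fixes \<gamma> :: "real \<Rightarrow> 'a::topological_space"
  assumes cov: "covering_space C p S" and sc: "simply_connected C"
    and p\<gamma>: "path \<gamma>" "path_image \<gamma> \<subseteq> C" "pathfinish \<gamma> = pathstart \<gamma>"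
    and p\<beta>: "path \<beta>" "path_image \<beta> \<subseteq> C" and p\<beta>\<gamma>: "\<And>t. t \<in> {0..1} \<Longrightarrow> p (\<beta> t) = p (\<gamma> t)"
  shows "pathfinish \<beta> = pathstart \<beta>"
proof -
  have \<gamma>: "continuous_on {0..1} \<gamma>" "\<gamma> ` {0..1} \<subseteq> C" "\<gamma> 0 = \<gamma> 1"
    using p\<gamma> by (simp_all add: path_def path_image_def pathstart_def pathfinish_def)
  have \<beta>: "continuous_on {0..1} \<beta>" "\<beta> ` {0..1} \<subseteq> C" "\<And>t. t \<in> {0..1} \<Longrightarrow> p (\<beta> t) = p (\<gamma> t)"
    using p\<beta> p\<beta>\<gamma> by (simp_all add: path_def path_image_def)
  have "\<gamma> 0 \<in> C"
    using \<gamma>(2) by auto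
  then have "homotopic_loops C \<gamma> (\<lambda>_. \<gamma> 0)"
    by (intro simply_connected_homotopic_loops sc p\<gamma> path_const)
       (simp_all add: path_const pathstart_def pathfinish_def)
  then obtain K where K: "continuous_on ({0..1} \<times> {0..1}) K" "K \<in> ({0..1} \<times> {0..1}) \<rightarrow> C"
      "\<forall>x\<in>{0..1}. K (0::real, x) = \<gamma> x" "\<forall>x\<in>{0..1}. K (1::real, x) = \<gamma> 0"
      "\<forall>t\<in>{0..1}. pathfinish (K \<circ> Pair t) = pathstart (K \<circ> Pair t)"
    unfolding homotopic_loops by blast
  define H where "H s t = p (K (s, t))" for s t :: real
  have contp: "continuous_on C p"
    by (rule covering_space_imp_continuous[OF cov])
  have pC: "p x \<in> S" if "x \<in> C" for x
    using covering_space_imp_surjective[OF cov] that by blast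
  have Hcont: "continuous_on ({0..1} \<times> {0..1}) (\<lambda>(s, t). H s t)"
    unfolding H_def case_prod_beta prod.collapse
    by (rule continuous_on_compose2[OF contp K(1)]) (use K(2) in blast)
  have HS: "H s t \<in> S" if "s \<in> {0..1}" "t \<in> {0..1}" for s t
    unfolding H_def using K(2) that by (intro pC) auto
  have Hs: "continuous_on {0..1} (\<lambda>s. H s t)" if "t \<in> {0..1}" for t
  proof -
    have "continuous_on {0..1} (\<lambda>s. case (s, t) of (s, t) \<Rightarrow> H s t)"
      by (rule continuous_on_compose2[OF Hcont]) (use that in \<open>auto intro!: continuous_intros\<close>)
    then show ?thesis by simp
  qed
  have Ht: "continuous_on {0..1} (H s)" if "s \<in> {0..1}" for s
  proof -
    have "continuous_on {0..1} (\<lambda>t. case (s, t) of (s, t) \<Rightarrow> H s t)"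
      by (rule continuous_on_compose2[OF Hcont]) (use that in \<open>auto intro!: continuous_intros\<close>)
    then show ?thesis by simp
  qed
  have ends: "H s 0 = H s 1" if "s \<in> {0..1}" for s
    using K(5) that by (simp add: H_def pathfinish_def pathstart_def)
  have H0: "H 0 t = p (\<gamma> t)" "H 1 t = p (\<gamma> 0)" if "t \<in> {0..1}" for t
    using K(3,4) that by (simp_all add: H_def)
  have I: "connected {0..1::real}" and I01: "0 \<in> {0..1::real}" "1 \<in> {0..1::real}"
    by simp_all
  have "\<beta> 0 \<in> C" "p (\<beta> 0) = H 0 0"
    using \<beta> H0(1)[of 0] by auto
  moreover have "(\<lambda>s. H s 0) ` {0..1} \<subseteq> S"
    using HS by auto
  ultimately obtain b where b: "continuous_on {0..1} b" "b ` {0..1} \<subseteq> C" "b 0 = \<beta> 0"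
      "\<And>s. s \<in> {0..1} \<Longrightarrow> p (b s) = H s 0"
    using covering_lift_path[OF cov Hs[OF I01(1)]] by metis
  have "\<exists>B. continuous_on {0..1} B \<and> B ` {0..1} \<subseteq> C \<and> B 0 = b s \<and> (\<forall>t\<in>{0..1}. p (B t) = H s t)"
    if s: "s \<in> {0..1}" for s
  proof -
    have "H s ` {0..1} \<subseteq> S" "b s \<in> C" "p (b s) = H s 0"
      using HS[OF s] b s by auto
    from covering_lift_path[OF cov Ht[OF s] this] show ?thesis
      by metis
  qed
  then obtain B where B: "\<And>s. s \<in> {0..1} \<Longrightarrow> continuous_on {0..1} (B s)" "\<And>s. s \<in> {0..1} \<Longrightarrow> B s ` {0..1} \<subseteq> C"
      "\<And>s. s \<in> {0..1} \<Longrightarrow> B s 0 = b s" "\<And>s t. s \<in> {0..1} \<Longrightarrow> t \<in> {0..1} \<Longrightarrow> p (B s t) = H s t"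
    by metis
  have "continuous_on {0..1} (\<lambda>s. B s 0)"
    by (rule continuous_on_eq[OF b(1)]) (simp add: B(3))
  from covering_lift_family_continuous[OF cov Hcont HS B(1,2,4) this, where t = 1]
  have B1: "continuous_on {0..1} (\<lambda>s. B s 1)"
    by simp
  have "B 1 1 = b 1"
  proof (rule covering_lift_unique[OF cov I B(1)[OF I01(2)] _ B(2)[OF I01(2)],
        where ?g2.0 = "\<lambda>_. b 1" and ?t0.0 = 0 and t = 1])
    show "p (B 1 t) = p (b 1)" if "t \<in> {0..1}" for t
      using B(4)[of 1 t] b(4)[of 1] H0(2) that by simp
  qed (use B b in auto)
  have "B 0 1 = b 0"
  proof (rule covering_lift_unique[OF cov I B1 b(1) _ b(2), where ?t0.0 = 1 and t = 0])
    show "p (B s 1) = p (b s)" if "s \<in> {0..1}" for s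
      using B(4)[of s 1] b(4)[of s] ends that by simp
  qed (use B(2) \<open>B 1 1 = b 1\<close> in \<open>auto simp: image_subset_iff\<close>)
  moreover have "B 0 1 = \<beta> 1"
  proof (rule covering_lift_unique[OF cov I B(1)[OF I01(1)] \<beta>(1) B(2)[OF I01(1)] \<beta>(2),
        where ?t0.0 = 0 and t = 1])
    show "p (B 0 t) = p (\<beta> t)" if "t \<in> {0..1}" for t
      using B(4)[of 0 t] \<beta>(3)[of t] H0(1) that by simp
  qed (use B b in auto)
  ultimately show ?thesis
    using b(3) by (simp add: pathstart_def pathfinish_def)
qed

text \<open>Two constant loops are freely homotopic, and the trace of a base point under the homotopy is a path.\<close>

lemma simply_connected_path_exists:
  assumes "simply_connected C" "a \<in> C" "b \<in> C"
  obtains \<gamma> where "path \<gamma>" "path_image \<gamma> \<subseteq> C" "pathstart \<gamma> = a" "pathfinish \<gamma> = b"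
proof -
  have "homotopic_loops C (\<lambda>_. a) (\<lambda>_. b)"
    using assms(2,3) by (intro simply_connected_homotopic_loops assms(1) path_const)
       (simp_all add: path_const pathstart_def pathfinish_def)
  then obtain K where K: "continuous_on ({0..1} \<times> {0..1}) K" "K \<in> ({0..1} \<times> {0..1}) \<rightarrow> C"
      "\<forall>x\<in>{0..1}. K (0::real, x) = a" "\<forall>x\<in>{0..1}. K (1::real, x::real) = b"
    unfolding homotopic_loops by blast
  have "continuous_on {0..1} (\<lambda>s. K (s, 0))"
    by (rule continuous_on_compose2[OF K(1)]) (auto intro!: continuous_intros)
  then show ?thesis
    using that[of "\<lambda>s. K (s, 0)"] K(2-4)
    by (simp add: path_def path_image_def pathstart_def pathfinish_def image_subset_iff Pi_iff)
qed

text \<open>Transport along paths: the point \<open>h y\<close> is the end of the lift, starting at \<open>y\<^sub>1\<close>, of the image of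
  a path from \<open>y\<^sub>0\<close> to \<open>y\<close>. It does not depend on the path by the previous results.\<close>

lemma covering_deck_lift:
  fixes C :: "'a::topological_space set"
  assumes cov: "covering_space C p S" and sc: "simply_connected C"
    and lpc: "\<And>y W. openin (top_of_set C) W \<Longrightarrow> y \<in> W \<Longrightarrow>
       \<exists>N. openin (top_of_set C) N \<and> y \<in> N \<and> N \<subseteq> W \<and> path_connected N"
    and y: "y0 \<in> C" "y1 \<in> C" "p y0 = p y1"
  obtains h where "continuous_on C h" "h ` C \<subseteq> C" "h y0 = y1" "\<And>y. y \<in> C \<Longrightarrow> p (h y) = p y"
proof -
  define R where "R y z \<longleftrightarrow> (\<exists>\<gamma> \<beta>. path \<gamma> \<and> path_image \<gamma> \<subseteq> C \<and> pathstart \<gamma> = y0 \<and> pathfinish \<gamma> = y \<and>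
     path \<beta> \<and> path_image \<beta> \<subseteq> C \<and> pathstart \<beta> = y1 \<and> pathfinish \<beta> = z \<and> (\<forall>t\<in>{0..1}. p (\<beta> t) = p (\<gamma> t)))" for y z
  have contp: "continuous_on C p"
    by (rule covering_space_imp_continuous[OF cov])
  have pC: "p x \<in> S" if "x \<in> C" for x
    using covering_space_imp_surjective[OF cov] that by blast
  have R_ex: "\<exists>z. R y z" if "y \<in> C" for y
  proof -
    obtain \<gamma> where \<gamma>: "path \<gamma>" "path_image \<gamma> \<subseteq> C" "pathstart \<gamma> = y0" "pathfinish \<gamma> = y"
      using simply_connected_path_exists[OF sc y(1) \<open>y \<in> C\<close>] .
    have "continuous_on {0..1} (p \<circ> \<gamma>)"
      using \<gamma>(1,2) contp unfolding path_def path_image_def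
      by (intro continuous_on_compose) (auto intro: continuous_on_subset)
    moreover have "(p \<circ> \<gamma>) ` {0..1} \<subseteq> S"
      using \<gamma>(2) pC by (auto simp: path_image_def)
    moreover have "p y1 = (p \<circ> \<gamma>) 0"
      using y(3) \<gamma>(3) by (simp add: pathstart_def)
    ultimately obtain \<beta> where "continuous_on {0..1} \<beta>" "\<beta> ` {0..1} \<subseteq> C" "\<beta> 0 = y1"
        "\<And>t. t \<in> {0..1} \<Longrightarrow> p (\<beta> t) = (p \<circ> \<gamma>) t"
      using covering_lift_path[OF cov _ _ y(2)] by metis
    then have "R y (\<beta> 1)"
      unfolding R_def using \<gamma>
      by (intro exI[of _ \<gamma>] exI[of _ \<beta>]) (auto simp: path_def path_image_def pathstart_def pathfinish_def)
    then show ?thesis ..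
  qed
  have R_unique: "z = z'" if "R y z" "R y z'" for y z z'
  proof -
    obtain \<gamma> \<beta> where 1: "path \<gamma>" "path_image \<gamma> \<subseteq> C" "pathstart \<gamma> = y0" "pathfinish \<gamma> = y"
      "path \<beta>" "path_image \<beta> \<subseteq> C" "pathstart \<beta> = y1" "pathfinish \<beta> = z" "\<forall>t\<in>{0..1}. p (\<beta> t) = p (\<gamma> t)"
      using \<open>R y z\<close> unfolding R_def by (elim exE conjE)
    obtain \<gamma>' \<beta>' where 2: "path \<gamma>'" "path_image \<gamma>' \<subseteq> C" "pathstart \<gamma>' = y0" "pathfinish \<gamma>' = y"
      "path \<beta>'" "path_image \<beta>' \<subseteq> C" "pathstart \<beta>' = y1" "pathfinish \<beta>' = z'" "\<forall>t\<in>{0..1}. p (\<beta>' t) = p (\<gamma>' t)"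
      using \<open>R y z'\<close> unfolding R_def by (elim exE conjE)
    have A: "path (reversepath \<gamma> +++ \<gamma>')" "path_image (reversepath \<gamma> +++ \<gamma>') \<subseteq> C"
        "pathfinish (reversepath \<gamma> +++ \<gamma>') = pathstart (reversepath \<gamma> +++ \<gamma>')"
      using 1(1-4) 2(1-4) by (simp_all add: subset_path_image_join)
    have B: "path (reversepath \<beta> +++ \<beta>')" "path_image (reversepath \<beta> +++ \<beta>') \<subseteq> C"
      using 1(5-8) 2(5-8) by (simp_all add: subset_path_image_join)
    have "p ((reversepath \<beta> +++ \<beta>') t) = p ((reversepath \<gamma> +++ \<gamma>') t)" if "t \<in> {0..1}" for t
      using 1(9) 2(9) that by (auto simp: joinpaths_def reversepath_def)
    from simply_connected_loop_lift[OF cov sc A B this]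
    have "pathfinish (reversepath \<beta> +++ \<beta>') = pathstart (reversepath \<beta> +++ \<beta>')" .
    then show ?thesis
      using 1(8) 2(8) by simp
  qed
  define h where "h y = (THE z. R y z)" for y
  have hR: "h y = z" if "R y z" for y z
    unfolding h_def using that R_unique by (intro the_equality)
  have Rh: "R y (h y)" if "y \<in> C" for y
    using R_ex[OF that] hR by blast
  have hC: "h y \<in> C" and ph: "p (h y) = p y" if y: "y \<in> C" for y
  proof -
    obtain \<gamma> \<beta> where "pathfinish \<gamma> = y" "path_image \<beta> \<subseteq> C" "pathfinish \<beta> = h y"
        "\<forall>t\<in>{0..1}. p (\<beta> t) = p (\<gamma> t)"
      using Rh[OF y] unfolding R_def by (elim exE conjE)
    moreover from this have "p (\<beta> 1) = p (\<gamma> 1)" "\<beta> 1 \<in> C"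
      by (simp_all add: path_image_def image_subset_iff)
    ultimately show "h y \<in> C" "p (h y) = p y"
      by (simp_all add: pathfinish_def)
  qed
  have "R y0 y1"
    unfolding R_def using y
    by (intro exI[of _ "\<lambda>_. y0"] exI[of _ "\<lambda>_. y1"]) (auto simp: path_const pathstart_def pathfinish_def)
  \<comment> \<open>Continuity: paths to points near \<open>y\<close> can be chosen to pass through \<open>y\<close> and to stay near \<open>y\<close> from then on, so
    that \<open>h\<close> is \<open>q \<circ> p\<close> near \<open>y\<close>, where \<open>q\<close> is the section over the sheet of \<open>h y\<close>.\<close>
  have "\<exists>N. openin (top_of_set C) N \<and> y \<in> N \<and> N \<subseteq> C \<inter> h -` W"
    if W: "openin (top_of_set C) W" and y: "y \<in> C \<inter> h -` W" for y W
  proof -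
    have "p y \<in> S" "y \<in> C" "h y \<in> W"
      using pC y by auto
    from covering_space_sheets[OF cov this(1)]
    obtain U where U: "p y \<in> U" "openin (top_of_set S) U"
      "\<forall>b\<in>C. p b \<in> U \<longrightarrow> (\<exists>V q. b \<in> V \<and> sheet_over C p U V q)" .
    have "p (h y) \<in> U"
      using ph[OF \<open>y \<in> C\<close>] U(1) by simp
    then obtain V q where "h y \<in> V" "sheet_over C p U V q"
      using U(3) hC[OF \<open>y \<in> C\<close>] by blast
    then have V: "h y \<in> V" "V \<subseteq> C" "homeomorphism V U p q"
      by (simp_all add: sheet_over_def)
    have qU: "q u \<in> V" "p (q u) = u" if "u \<in> U" for u
      using homeomorphism_image2[OF V(3)] homeomorphism_apply2[OF V(3) that] that by auto
    have q_py: "q (p y) = h y"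
      using homeomorphism_apply1[OF V(3,1)] ph[OF \<open>y \<in> C\<close>] by simp
    have "q \<in> U \<rightarrow> C"
      using qU(1) V(2) by blast
    from continuous_openin_preimage[OF homeomorphism_cont2[OF V(3)] this W]
    have "openin (top_of_set U) (U \<inter> q -` W)" .
    then have "openin (top_of_set S) (U \<inter> q -` W)"
      using U(2) by (rule openin_trans)
    moreover have "p \<in> C \<rightarrow> S"
      using pC by blast
    ultimately have "openin (top_of_set C) (C \<inter> p -` (U \<inter> q -` W))"
      using contp by (intro continuous_openin_preimage)
    moreover have "y \<in> C \<inter> p -` (U \<inter> q -` W)"
      using \<open>y \<in> C\<close> U(1) q_py \<open>h y \<in> W\<close> by simp
    ultimately obtain N where N: "openin (top_of_set C) N" "y \<in> N" "N \<subseteq> C \<inter> p -` (U \<inter> q -` W)" "path_connected N"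
      using lpc by blast
    have "h y' \<in> W" if y': "y' \<in> N" for y'
    proof -
      obtain \<delta> where \<delta>: "path \<delta>" "path_image \<delta> \<subseteq> N" "pathstart \<delta> = y" "pathfinish \<delta> = y'"
        using N(2,4) y' unfolding path_connected_def by blast
      obtain \<gamma> \<beta> where 1: "path \<gamma>" "path_image \<gamma> \<subseteq> C" "pathstart \<gamma> = y0" "pathfinish \<gamma> = y"
        "path \<beta>" "path_image \<beta> \<subseteq> C" "pathstart \<beta> = y1" "pathfinish \<beta> = h y" "\<forall>t\<in>{0..1}. p (\<beta> t) = p (\<gamma> t)"
        using Rh[OF \<open>y \<in> C\<close>] unfolding R_def by (elim exE conjE)
      have \<delta>U: "p (\<delta> t) \<in> U" "\<delta> t \<in> C" if "t \<in> {0..1}" for t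
        using subsetD[OF \<delta>(2), of "\<delta> t"] N(3) that by (auto simp: path_image_def)
      have "path (q \<circ> p \<circ> \<delta>)"
        unfolding path_def
      proof (intro continuous_on_compose)
        show "continuous_on {0..1} \<delta>"
          using \<delta>(1) by (simp add: path_def)
        show "continuous_on (\<delta> ` {0..1}) p"
          using \<delta>U by (intro continuous_on_subset[OF contp]) blast
        show "continuous_on (p ` \<delta> ` {0..1}) q"
          using \<delta>U by (intro continuous_on_subset[OF homeomorphism_cont2[OF V(3)]]) blast
      qed
      moreover have "path_image (q \<circ> p \<circ> \<delta>) \<subseteq> C"
        using \<delta>U qU V(2) by (auto simp: path_image_def)
      moreover have ends: "pathstart (q \<circ> p \<circ> \<delta>) = h y" "pathfinish (q \<circ> p \<circ> \<delta>) = q (p y')"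
        using \<delta>(3,4) q_py by (simp_all add: pathstart_def pathfinish_def)
      moreover have "p ((\<beta> +++ (q \<circ> p \<circ> \<delta>)) t) = p ((\<gamma> +++ \<delta>) t)" if "t \<in> {0..1}" for t
      proof (cases "t \<le> 1/2")
        case True
        then show ?thesis
          using 1(9) that by (simp add: joinpaths_def)
      next
        case False
        then show ?thesis
          using qU(2)[OF \<delta>U(1), of "2 * t - 1"] that by (simp add: joinpaths_def)
      qed
      moreover have "path_image \<delta> \<subseteq> C"
        using \<delta>(2) N(3) by blast
      ultimately have "R y' (q (p y'))"
        unfolding R_def using 1 \<delta>
        by (intro exI[of _ "\<gamma> +++ \<delta>"] exI[of _ "\<beta> +++ (q \<circ> p \<circ> \<delta>)"])
           (simp add: subset_path_image_join)
      then have "h y' = q (p y')"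
        by (rule hR)
      then show ?thesis
        using N(3) y' by auto
    qed
    then show ?thesis
      using N by blast
  qed
  then have "openin (top_of_set C) (C \<inter> h -` W)" if "openin (top_of_set C) W" for W
    using that by (subst openin_subopen) blast
  moreover have "h \<in> C \<rightarrow> C"
    using hC by blast
  ultimately have "continuous_on C h"
    using continuous_on_open_gen by blast
  then show ?thesis
    using that[of h] hC ph hR[OF \<open>R y0 y1\<close>] by blast
qed

text \<open>The lifts that take \<open>y\<^sub>0\<close> to \<open>y\<^sub>1\<close> and \<open>y\<^sub>1\<close> to \<open>y\<^sub>0\<close> are inverse to each other by uniqueness of lifts.\<close>

proposition covering_deck_transformation:
  fixes C :: "'a::topological_space set"
  assumes cov: "covering_space C p S" and sc: "simply_connected C" and conn: "connected C"
    and lpc: "\<And>y W. openin (top_of_set C) W \<Longrightarrow> y \<in> W \<Longrightarrow>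
       \<exists>N. openin (top_of_set C) N \<and> y \<in> N \<and> N \<subseteq> W \<and> path_connected N"
    and y: "y0 \<in> C" "y1 \<in> C" "p y0 = p y1"
  obtains h k where "homeomorphism C C h k" "h y0 = y1"
    "\<And>y. y \<in> C \<Longrightarrow> p (h y) = p y" "\<And>y. y \<in> C \<Longrightarrow> p (k y) = p y"
proof -
  obtain h where h: "continuous_on C h" "h ` C \<subseteq> C" "h y0 = y1" "\<And>y. y \<in> C \<Longrightarrow> p (h y) = p y"
    using covering_deck_lift[OF cov sc lpc y] by metis
  obtain k where k: "continuous_on C k" "k ` C \<subseteq> C" "k y1 = y0" "\<And>y. y \<in> C \<Longrightarrow> p (k y) = p y"
    using covering_deck_lift[OF cov sc lpc y(2,1) y(3)[symmetric]] by metis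
  have id: "g2 (g1 z) = z" if "continuous_on C g1" "g1 ` C \<subseteq> C" "continuous_on C g2" "g2 ` C \<subseteq> C"
    "\<And>y. y \<in> C \<Longrightarrow> p (g1 y) = p y" "\<And>y. y \<in> C \<Longrightarrow> p (g2 y) = p y" "a \<in> C" "g2 (g1 a) = a" "z \<in> C"
    for g1 g2 a z
  proof (rule covering_lift_unique[OF cov conn, of "\<lambda>z. g2 (g1 z)" "\<lambda>z. z" a])
    show "continuous_on C (\<lambda>z. g2 (g1 z))"
      by (rule continuous_on_compose2[OF that(3,1,2)])
    show "p (g2 (g1 t)) = p t" if "t \<in> C" for t
      using that \<open>g1 ` C \<subseteq> C\<close> \<open>\<And>y. y \<in> C \<Longrightarrow> p (g1 y) = p y\<close> \<open>\<And>y. y \<in> C \<Longrightarrow> p (g2 y) = p y\<close>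
      by (simp add: image_subset_iff)
  qed (use that in \<open>simp_all add: image_subset_iff\<close>)
  have "k (h z) = z" "h (k z) = z" if "z \<in> C" for z
    using id[OF h(1,2) k(1,2) h(4) k(4) y(1) _ that] id[OF k(1,2) h(1,2) k(4) h(4) y(2) _ that] h(3) k(3)
    by auto
  then have "homeomorphism C C h k"
    using h k by (intro homeomorphismI) auto
  then show ?thesis
    using that h k by blast
qed

section \<open>Automorphisms of powers of the half-plane\<close>

text \<open>The hypotheses say that, after rescaling by \<open>y\<close> and \<open>w\<close>, neither \<open>D\<close> nor its inverse increases the maximum
  norm. Then every column \<open>j\<close> has an entry that alone exhausts the bound for its row, and the other entries of
  this row vanish.\<close>

lemma contraction_inverse_monomial:
  fixes D B :: "complex ^ 'n::finite ^ 'n" and y w :: "'n \<Rightarrow> real"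
  assumes BD: "B ** D = mat 1" and pos: "\<And>i. y i > 0" "\<And>i. w i > 0"
    and D: "\<And>i. (\<Sum>j\<in>UNIV. norm (D $ i $ j) * y j) \<le> w i"
    and B: "\<And>j. (\<Sum>i\<in>UNIV. norm (B $ j $ i) * w i) \<le> y j"
  shows "monomial_matrix D"
proof -
  \<comment> \<open>Otherwise column \<open>j\<close> of \<open>D\<close> is so small that the diagonal entry of \<open>B D\<close> cannot be 1.\<close>
  have "\<exists>i. w i \<le> norm (D $ i $ j) * y j" for j
  proof (rule ccontr)
    assume "\<nexists>i. w i \<le> norm (D $ i $ j) * y j"
    then have less: "norm (D $ i $ j) * y j < w i" for i
      by (simp add: not_le)
    have one: "(\<Sum>i\<in>UNIV. B $ j $ i * D $ i $ j) = 1"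
      using BD by (simp add: vec_eq_iff matrix_matrix_mult_def mat_def)
    have "\<exists>i. B $ j $ i \<noteq> 0"
    proof (rule ccontr)
      assume "\<nexists>i. B $ j $ i \<noteq> 0"
      then show False
        using one by simp
    qed
    then obtain i0 where i0: "B $ j $ i0 \<noteq> 0" ..
    have "y j = norm (\<Sum>i\<in>UNIV. B $ j $ i * D $ i $ j) * y j"
      by (simp add: one)
    also have "\<dots> \<le> (\<Sum>i\<in>UNIV. norm (B $ j $ i * D $ i $ j)) * y j"
      using pos(1)[of j] by (intro mult_right_mono norm_sum) simp
    also have "\<dots> = (\<Sum>i\<in>UNIV. norm (B $ j $ i) * (norm (D $ i $ j) * y j))"
      by (simp add: sum_distrib_right norm_mult mult.assoc)
    also have "\<dots> < (\<Sum>i\<in>UNIV. norm (B $ j $ i) * w i)"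
    proof (rule sum_strict_mono_ex1)
      show "\<forall>i\<in>UNIV. norm (B $ j $ i) * (norm (D $ i $ j) * y j) \<le> norm (B $ j $ i) * w i"
        by (intro ballI mult_left_mono less_imp_le[OF less] norm_ge_zero)
      show "\<exists>i\<in>UNIV. norm (B $ j $ i) * (norm (D $ i $ j) * y j) < norm (B $ j $ i) * w i"
        using i0 by (intro bexI[of _ i0] mult_strict_left_mono less) simp_all
    qed simp
    also have "\<dots> \<le> y j"
      by (rule B)
    finally show False by simp
  qed
  then obtain \<rho> where \<rho>: "\<And>j. w (\<rho> j) \<le> norm (D $ \<rho> j $ j) * y j"
    by metis
  have nz: "D $ \<rho> j $ j \<noteq> 0" for j
    using \<rho>[of j] pos(2)[of "\<rho> j"] by auto
  have zero: "D $ \<rho> j $ k = 0" if "k \<noteq> j" for j k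
  proof -
    have "norm (D $ \<rho> j $ j) * y j + norm (D $ \<rho> j $ k) * y k \<le> (\<Sum>l\<in>UNIV. norm (D $ \<rho> j $ l) * y l)"
    proof -
      have "(\<Sum>l\<in>{j, k}. norm (D $ \<rho> j $ l) * y l) \<le> (\<Sum>l\<in>UNIV. norm (D $ \<rho> j $ l) * y l)"
        by (rule sum_mono2) (auto intro: mult_nonneg_nonneg less_imp_le[OF pos(1)])
      then show ?thesis
        using that by simp
    qed
    also have "\<dots> \<le> norm (D $ \<rho> j $ j) * y j"
      using D[of "\<rho> j"] \<rho>[of j] by simp
    finally have "norm (D $ \<rho> j $ k) * y k \<le> 0"
      by simp
    then show ?thesis
      using pos(1)[of k] by (simp add: mult_le_0_iff)
  qed
  have "inj \<rho>"
    by (rule injI) (use nz zero in metis)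
  then have surj: "surj \<rho>"
    by (simp add: finite_UNIV_inj_surj)
  have "det D \<noteq> 0"
    using BD det_mul[of B D] by (metis det_I mult_zero_right zero_neq_one)
  moreover have "j = inv \<rho> i" if "D $ i $ j \<noteq> 0" for i j
    using zero[of j "inv \<rho> i"] that surj_f_inv_f[OF surj, of i] by metis
  ultimately show ?thesis
    unfolding monomial_matrix_def by blast
qed

text \<open>The Schwarz-Pick inequality for a function on the power, obtained from the one-variable
  Schwarz lemma on discs \<open>\<gamma>\<close> that go through \<open>z\<close> with a prescribed phase in every coordinate.\<close>

lemma half_plane_schwarz_pick:
  fixes f :: "complex ^ 'n::finite \<Rightarrow> complex"
  assumes f: "holo_on f {z. \<forall>j. 0 < Im (z $ j)}" and im: "\<And>z. \<forall>j. 0 < Im (z $ j) \<Longrightarrow> 0 < Im (f z)"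
    and z: "\<forall>j. 0 < Im (z $ j)" and a: "(f has_derivative (\<lambda>v. \<Sum>j\<in>UNIV. a j * v $ j)) (at z)"
  shows "(\<Sum>j\<in>UNIV. norm (a j) * Im (z $ j)) \<le> Im (f z)"
proof -
  \<comment> \<open>Phases that make the terms \<open>a\<^sub>j u\<^sub>j\<close> of the derivative along the disc add up without cancellation.\<close>
  define u where "u j = (if a j = 0 then 1 else cnj (sgn (a j)))" for j
  have u: "norm (u j) = 1" "a j * u j = norm (a j)" for j
  proof -
    show "norm (u j) = 1"
      by (simp add: u_def norm_sgn)
    have "a j * cnj (a j) = of_real (norm (a j)) * of_real (norm (a j))"
      using complex_norm_square[of "a j"] by (simp add: power2_eq_square)
    then show "a j * u j = norm (a j)"
      by (simp add: u_def sgn_eq)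
  qed
  \<comment> \<open>In each coordinate a Cayley transform of the unit disc onto the half-plane, with centre \<open>z\<^sub>j\<close>.\<close>
  define \<gamma> where "\<gamma> \<zeta> = (\<chi> j. Re (z $ j) + \<i> * Im (z $ j) * ((1 + u j * \<zeta>) / (1 - u j * \<zeta>)))" for \<zeta>
  have ne: "1 - u j * \<zeta> \<noteq> 0" and re: "0 < Re ((1 + u j * \<zeta>) / (1 - u j * \<zeta>))" if "norm \<zeta> < 1" for \<zeta> j
  proof -
    have n: "norm (u j * \<zeta>) < 1"
      using that u(1) by (simp add: norm_mult)
    then show ne: "1 - u j * \<zeta> \<noteq> 0"
      by auto
    have "(Re (u j * \<zeta>))\<^sup>2 + (Im (u j * \<zeta>))\<^sup>2 < 1"
      using n by (simp add: cmod_def)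
    then have "0 < Re ((1 + u j * \<zeta>) * cnj (1 - u j * \<zeta>))"
      by (simp add: algebra_simps power2_eq_square)
    then show "0 < Re ((1 + u j * \<zeta>) / (1 - u j * \<zeta>))"
      using ne by (simp add: Re_complex_div_gt_0)
  qed
  have \<gamma>_im: "\<forall>j. 0 < Im (\<gamma> \<zeta> $ j)" if "norm \<zeta> < 1" for \<zeta>
  proof
    fix j
    have "Im (of_real a + \<i> * of_real y * r) = y * Re r" for a y r
      by simp
    then have "Im (\<gamma> \<zeta> $ j) = Im (z $ j) * Re ((1 + u j * \<zeta>) / (1 - u j * \<zeta>))"
      by (simp only: \<gamma>_def vec_lambda_beta)
    then show "0 < Im (\<gamma> \<zeta> $ j)"
      using z re[OF that] by simp
  qed
  have \<gamma>0: "\<gamma> 0 = z"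
    by (simp add: \<gamma>_def vec_eq_iff complex_eq_iff)
  define \<gamma>' where "\<gamma>' \<zeta> = (\<chi> j. \<i> * Im (z $ j) * (2 * u j / (1 - u j * \<zeta>)\<^sup>2))" for \<zeta>
  have \<gamma>_deriv: "(\<gamma> has_derivative (\<lambda>h. \<chi> j. \<gamma>' \<zeta> $ j * h)) (at \<zeta>)" if "norm \<zeta> < 1" for \<zeta>
  proof (rule has_derivative_vec_components)
    fix j
    have "((\<lambda>\<zeta>. Re (z $ j) + \<i> * Im (z $ j) * ((1 + u j * \<zeta>) / (1 - u j * \<zeta>))) has_field_derivative
        \<gamma>' \<zeta> $ j) (at \<zeta>)"
      using ne[OF that, of j]
      by (auto intro!: derivative_eq_intros simp: \<gamma>'_def power2_eq_square field_simps)
    then show "((\<lambda>\<zeta>. \<gamma> \<zeta> $ j) has_derivative (\<lambda>h. (\<chi> j. \<gamma>' \<zeta> $ j * h) $ j)) (at \<zeta>)"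
      by (simp add: \<gamma>_def has_field_derivative_def)
  qed
  define g where "g = f \<circ> \<gamma>"
  have g_deriv: "(g has_field_derivative (\<Sum>j\<in>UNIV. b j * \<gamma>' \<zeta> $ j)) (at \<zeta>)"
    if "norm \<zeta> < 1" "(f has_derivative (\<lambda>v. \<Sum>j\<in>UNIV. b j * v $ j)) (at (\<gamma> \<zeta>))" for \<zeta> b
  proof -
    have "(\<lambda>h. \<Sum>j\<in>UNIV. b j * (\<gamma>' \<zeta> $ j * h)) = (*) (\<Sum>j\<in>UNIV. b j * \<gamma>' \<zeta> $ j)"
      by (rule ext) (simp add: sum_distrib_right mult.assoc)
    then show ?thesis
      using diff_chain_at[OF \<gamma>_deriv[OF that(1)] that(2)]
      by (simp add: g_def has_field_derivative_def o_def)
  qed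
  have g_im: "0 < Im (g \<zeta>)" if "norm \<zeta> < 1" for \<zeta>
    using im[OF \<gamma>_im[OF that]] by (simp add: g_def)
  define w where "w = f z"
  have w: "0 < Im w" "g 0 = w"
    using im[OF z] by (simp_all add: w_def g_def \<gamma>0)
  define S where "S = (\<Sum>j\<in>UNIV. norm (a j) * Im (z $ j))"
  have "(g has_field_derivative (\<Sum>j\<in>UNIV. a j * \<gamma>' 0 $ j)) (at 0)"
    by (rule g_deriv) (use a in \<open>simp_all add: \<gamma>0\<close>)
  also have "(\<Sum>j\<in>UNIV. a j * \<gamma>' 0 $ j) = 2 * \<i> * S"
  proof -
    have "a j * \<gamma>' 0 $ j = 2 * \<i> * (norm (a j) * Im (z $ j))" for j
      using u(2)[of j] by (simp add: \<gamma>'_def algebra_simps)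
    then show ?thesis
      by (simp add: S_def sum_distrib_left)
  qed
  finally have g0: "(g has_field_derivative 2 * \<i> * S) (at 0)" .
  \<comment> \<open>The Cayley transform of the half-plane that takes \<open>w\<close> to 0 turns \<open>g\<close> into a map of the disc to itself.\<close>
  define k where "k \<zeta> = (g \<zeta> - w) / (g \<zeta> - cnj w)" for \<zeta>
  have k_ne: "g \<zeta> - cnj w \<noteq> 0" if "norm \<zeta> < 1" for \<zeta>
    using g_im[OF that] w(1) by (auto simp: complex_eq_iff)
  have hol: "k holomorphic_on ball 0 1"
  proof -
    have "g field_differentiable at \<zeta>" if \<zeta>: "norm \<zeta> < 1" for \<zeta>
    proof -
      obtain b where "(f has_derivative (\<lambda>v. \<Sum>j\<in>UNIV. b $ j * v $ j)) (at (\<gamma> \<zeta>))"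
        using f \<gamma>_im[OF \<zeta>] unfolding holo_on_def by blast
      from g_deriv[OF \<zeta> this] show ?thesis
        by (auto simp: field_differentiable_def)
    qed
    then have "g holomorphic_on ball 0 1"
      by (simp add: holomorphic_on_def field_differentiable_at_within)
    then show ?thesis
      unfolding k_def by (intro holomorphic_intros) (use k_ne in auto)
  qed
  have "norm (k \<zeta>) < 1" if "norm \<zeta> < 1" for \<zeta>
  proof -
    have "(Im (g \<zeta>) - Im w)\<^sup>2 < (Im (g \<zeta>) + Im w)\<^sup>2"
      using g_im[OF that] w(1) by (simp add: power2_eq_square algebra_simps)
    then have "norm (g \<zeta> - w) < norm (g \<zeta> - cnj w)"
      by (simp add: cmod_def)
    then show ?thesis
      using k_ne[OF that] by (simp add: k_def norm_divide divide_less_eq)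
  qed
  moreover have k_deriv: "(k has_field_derivative S / Im w) (at 0)"
  proof -
    have "w - cnj w = 2 * \<i> * Im w"
      by (simp add: complex_eq_iff)
    then have "(2 * \<i> * of_real S * (g 0 - cnj w) - (g 0 - w) * (2 * \<i> * of_real S)) / ((g 0 - cnj w) * (g 0 - cnj w)) =
        of_real S / of_real (Im w)"
      using w by simp
    moreover have "(k has_field_derivative (2 * \<i> * of_real S * (g 0 - cnj w) - (g 0 - w) * (2 * \<i> * of_real S)) /
        ((g 0 - cnj w) * (g 0 - cnj w))) (at 0)"
      unfolding k_def
      using DERIV_divide[OF DERIV_diff[OF g0 DERIV_const[of w]] DERIV_diff[OF g0 DERIV_const[of "cnj w"]] k_ne] by simp
    ultimately show ?thesis
      by simp
  qed
  ultimately have "norm (deriv k 0) \<le> 1"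
    using Schwarz_Lemma(2)[OF hol, of 0] w(2) by (simp add: k_def)
  moreover have "0 \<le> S"
    unfolding S_def using z by (intro sum_nonneg mult_nonneg_nonneg) (auto intro!: less_imp_le)
  ultimately show ?thesis
    using w(1) by (simp add: DERIV_imp_deriv[OF k_deriv] norm_divide S_def[symmetric] w_def[symmetric])
qed

abbreviation half_plane_chart :: "(complex, 1) chart" where
  "half_plane_chart \<equiv> ({\<tau>. 0 < Im \<tau>}, \<lambda>\<tau>. \<chi> i. \<tau>)"

lemma charted_upper_half_plane: "charted upper_half_plane"
proof -
  have open_H: "open {v :: complex ^ 1. 0 < Im (v $ 1)}"
    by (intro open_Collect_less continuous_intros continuous_on_component)
  have image: "(\<lambda>\<tau>. \<chi> i. \<tau>) ` {\<tau>. 0 < Im \<tau>} = {v :: complex ^ 1. 0 < Im (v $ 1)}"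
    by (auto simp: image_iff vec_eq_iff forall_1)
  have inj: "inj_on (\<lambda>\<tau>. (\<chi> i. \<tau>) :: complex ^ 1) {\<tau>. 0 < Im \<tau>}"
    by (auto simp: inj_on_def vec_eq_iff)
  have inv: "chart_inv half_plane_chart (\<chi> i. \<tau>) = \<tau>" if "0 < Im \<tau>" for \<tau>
    unfolding chart_inv_def using inv_into_f_f[OF inj] that by simp
  have inv': "chart_inv half_plane_chart v = v $ 1" if "0 < Im (v $ 1)" for v
  proof -
    have "v = (\<chi> i. v $ 1)"
      by (simp add: vec_eq_iff forall_1)
    then show ?thesis
      using inv[OF that] by simp
  qed
  have "homeomorphism {\<tau>. 0 < Im \<tau>} {v :: complex ^ 1. 0 < Im (v $ 1)} (\<lambda>\<tau>. \<chi> i. \<tau>) (chart_inv half_plane_chart)"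
  proof (rule homeomorphismI)
    show "continuous_on {v :: complex ^ 1. 0 < Im (v $ 1)} (chart_inv half_plane_chart)"
      by (rule continuous_on_eq[of _ "\<lambda>v. v $ 1"])
         (auto simp: inv' intro!: continuous_on_component continuous_on_id)
    show "continuous_on {\<tau>. 0 < Im \<tau>} (\<lambda>\<tau>. (\<chi> i. \<tau>) :: complex ^ 1)"
      by (intro continuous_on_vec_lambda continuous_on_id)
    show "(\<chi> i. chart_inv half_plane_chart v) = v" if "v \<in> {v :: complex ^ 1. 0 < Im (v $ 1)}" for v
      using that by (simp add: inv' vec_eq_iff forall_1)
  qed (auto simp: inv inv')
  then show ?thesis
    by (simp add: charted_def upper_half_plane_def image open_H)
qed

lemma half_plane_power_automorphism_monomial:
  fixes F G :: "complex ^ 'n::finite \<Rightarrow> complex ^ 'n"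
  defines "P \<equiv> (mfd_power upper_half_plane :: (complex ^ 'n, 'n) mfd)"
  assumes F: "mfd_automorphism P F G" and \<phi>: "\<phi> \<in> atlas P" "x \<in> fst \<phi>" and \<psi>: "\<psi> \<in> atlas P" "F x \<in> fst \<psi>"
    and D: "(snd \<psi> \<circ> F \<circ> chart_inv \<phi> has_derivative (*v) D) (at (snd \<phi> x))"
  shows "monomial_matrix D"
proof -
  have P: "charted P"
    unfolding P_def by (rule charted_mfd_power[OF charted_upper_half_plane])
  have pts: "points P = {z. \<forall>j. 0 < Im (z $ j)}"
    by (simp add: P_def points_mfd_power upper_half_plane_def)
  have chart: "fst \<kappa> = points P" "snd \<kappa> = (\<lambda>z. z)" if "\<kappa> \<in> atlas P" for \<kappa>
    using that by (auto simp: P_def points_mfd_power atlas_mfd_power upper_half_plane_def power_chart_def fun_eq_iff vec_eq_iff)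
  have in_coords: "(F has_derivative F') (at z)"
    if "(snd \<psi> \<circ> F \<circ> chart_inv \<phi> has_derivative F') (at (snd \<phi> z))" "\<phi> \<in> atlas P" "\<psi> \<in> atlas P" "z \<in> points P"
    for F F' \<phi> \<psi> z
  proof -
    have z: "z \<in> fst \<phi>"
      using that chart by simp
    have "\<forall>\<^sub>F v in nhds (snd \<phi> z). (snd \<psi> \<circ> F \<circ> chart_inv \<phi>) v = F v"
      using eventually_chart_inv[OF P that(2) openin_subtopology_self z that(4)]
      by eventually_elim (use chart(2)[OF that(2)] chart(2)[OF that(3)] in auto)
    from has_derivative_cong_nhds[OF that(1) this] show ?thesis
      by (simp add: chart(2)[OF that(2)])
  qed
  have pick: "(\<Sum>j\<in>UNIV. norm (A $ i $ j) * Im (z $ j)) \<le> Im (F z $ i)"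
    if F: "mfd_automorphism P F G" and z: "z \<in> points P"
      and A: "(F has_derivative (*v) A) (at z)" for F G A z i
  proof (rule half_plane_schwarz_pick)
    show "holo_on (\<lambda>z. F z $ i) {z. \<forall>j. 0 < Im (z $ j)}"
    proof -
      have "\<exists>A. (F has_derivative (*v) A) (at z)" if z: "z \<in> points P" for z
      proof -
        have "mdiff_at P P F z" "z \<in> fst \<phi>" "F z \<in> fst \<psi>"
          using F z chart(1)[OF \<phi>(1)] chart(1)[OF \<psi>(1)] by (simp_all add: mfd_automorphism_def)
        from mdiff_atD2[OF this(1) \<phi>(1) \<psi>(1) this(2,3)] obtain A
          where "(snd \<psi> \<circ> F \<circ> chart_inv \<phi> has_derivative (*v) A) (at (snd \<phi> z))" .
        from in_coords[OF this \<phi>(1) \<psi>(1) z] show ?thesis ..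
      qed
      then have "holo_vec_on F (points P)"
        by (simp add: holo_vec_on_iff)
      then show ?thesis
        by (simp add: holo_vec_on_def pts)
    qed
    show "0 < Im (F z $ i)" if "\<forall>j. 0 < Im (z $ j)" for z
      using F that pts by (auto simp: mfd_automorphism_def)
    show "\<forall>j. 0 < Im (z $ j)"
      using z pts by simp
    show "((\<lambda>z. F z $ i) has_derivative (\<lambda>v. \<Sum>j\<in>UNIV. A $ i $ j * v $ j)) (at z)"
      using bounded_linear.has_derivative[OF bounded_linear_vec_nth A, of i]
      by (simp add: matrix_vector_mult_def)
  qed
  have x: "x \<in> points P" "F x \<in> points P"
    using \<phi> \<psi> chart(1) by simp_all
  obtain B where B: "(snd \<phi> \<circ> G \<circ> chart_inv \<psi> has_derivative (*v) B) (at (snd \<psi> (F x)))" "B ** D = mat 1"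
    using mfd_automorphism_derivative_inverse[OF P \<phi> \<psi> F D] by metis
  have G: "mfd_automorphism P G F"
    using F by (simp add: mfd_automorphism_def)
  have GF: "G (F x) = x"
    using F x by (simp add: mfd_automorphism_def)
  show ?thesis
  proof (rule contraction_inverse_monomial[OF B(2), of "\<lambda>j. Im (x $ j)" "\<lambda>i. Im (F x $ i)"])
    show "(\<Sum>j\<in>UNIV. norm (D $ i $ j) * Im (x $ j)) \<le> Im (F x $ i)" for i
      by (rule pick[OF F x(1) in_coords[OF D \<phi>(1) \<psi>(1) x(1)]])
    show "(\<Sum>i\<in>UNIV. norm (B $ j $ i) * Im (F x $ i)) \<le> Im (x $ j)" for j
      using pick[OF G x(2) in_coords[OF B(1) \<psi>(1) \<phi>(1) x(2)], of j] by (simp add: GF)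
  qed (use x pts in auto)
qed

section \<open>Automorphisms of powers of the projective line\<close>

subsection \<open>The two affine charts\<close>

text \<open>The two charts are treated uniformly: \<open>True\<close> stands for the coordinate \<open>z/w\<close> of \<open>[z : w]\<close> and \<open>False\<close> for
  \<open>w/z\<close>.\<close>

definition proj_affine :: "bool \<Rightarrow> complex \<Rightarrow> complex \<times> complex" where
  "proj_affine e t = (if e then (t, 1) else (1, t))"

definition proj_den :: "bool \<Rightarrow> complex \<times> complex \<Rightarrow> complex" where
  "proj_den e v = (if e then snd v else fst v)"

definition proj_coord :: "bool \<Rightarrow> complex \<times> complex \<Rightarrow> complex" where
  "proj_coord e v = (if e then fst v / snd v else snd v / fst v)"

definition proj_chart :: "bool \<Rightarrow> (proj_line, 1) chart" where
  "proj_chart e = (range (\<lambda>t. proj_pt (proj_affine e t)), \<lambda>p. \<chi> i. if e then proj_ratio p else proj_ratio' p)"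

lemma proj_rel_refl: "v \<noteq> 0 \<Longrightarrow> proj_rel v v"
  unfolding proj_rel_def by (intro conjI exI[of _ 1]) (auto simp: prod_eq_iff)

lemma proj_pt_eqI:
  assumes "u \<noteq> 0" "c \<noteq> 0" "v = (c * fst u, c * snd u)"
  shows "proj_pt u = proj_pt v"
proof -
  have "proj_rel u v"
    using assms unfolding proj_rel_def by blast
  then show ?thesis
    using Quotient3_rel[OF Quotient3_proj_line] by blast
qed

lemma proj_pt_eqD:
  assumes "u \<noteq> 0" "v \<noteq> 0" "proj_pt u = proj_pt v"
  obtains c where "c \<noteq> 0" "v = (c * fst u, c * snd u)"
proof -
  have "proj_rel u v"
    using assms proj_rel_refl Quotient3_rel[OF Quotient3_proj_line] by blast
  then show ?thesis
    using that unfolding proj_rel_def by blast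
qed

lemma proj_pt_cases:
  obtains v where "v \<noteq> 0" "q = proj_pt v"
proof -
  have "proj_rel (rep_proj_line q) (rep_proj_line q)"
    using Quotient3_rep_reflp[OF Quotient3_proj_line] .
  then have "rep_proj_line q \<noteq> 0"
    by (simp add: proj_rel_def)
  then show ?thesis
    using that Quotient3_abs_rep[OF Quotient3_proj_line] by metis
qed

lemma proj_affine_nonzero [simp]: "proj_affine e t \<noteq> 0"
  by (simp add: proj_affine_def zero_prod_def)

lemma proj_affine_simps [simp]: "proj_den e (proj_affine e t) = 1" "proj_coord e (proj_affine e t) = t"
  by (simp_all add: proj_affine_def proj_den_def proj_coord_def)

lemma proj_pt_affine:
  assumes "v \<noteq> 0" "proj_den e v \<noteq> 0"
  shows "proj_pt v = proj_pt (proj_affine e (proj_coord e v))"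
  by (rule proj_pt_eqI[OF assms(1), of "1 / proj_den e v"])
     (use assms(2) in \<open>auto simp: proj_den_def proj_coord_def proj_affine_def split: if_splits\<close>)

lemma mem_proj_chart:
  assumes "v \<noteq> 0"
  shows "proj_pt v \<in> fst (proj_chart e) \<longleftrightarrow> proj_den e v \<noteq> 0"
proof
  assume "proj_pt v \<in> fst (proj_chart e)"
  then obtain t where "proj_pt (proj_affine e t) = proj_pt v"
    by (auto simp: proj_chart_def)
  from proj_pt_eqD[OF proj_affine_nonzero assms this] obtain c
    where "c \<noteq> 0" "v = (c * fst (proj_affine e t), c * snd (proj_affine e t))" .
  then show "proj_den e v \<noteq> 0"
    by (cases e) (simp_all add: proj_affine_def proj_den_def)
next
  assume "proj_den e v \<noteq> 0"
  then show "proj_pt v \<in> fst (proj_chart e)"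
    using proj_pt_affine[OF assms, of e] by (auto simp: proj_chart_def)
qed

lemma proj_den_nonzero: "proj_den e v \<noteq> 0 \<Longrightarrow> v \<noteq> 0"
  by (cases e) (auto simp: proj_den_def)

lemma proj_chart_preimage: "{v. v \<noteq> 0 \<and> proj_pt v \<in> fst (proj_chart e)} = {v. proj_den e v \<noteq> 0}"
  using mem_proj_chart proj_den_nonzero by blast

lemma snd_proj_chart: "v \<noteq> 0 \<Longrightarrow> snd (proj_chart e) (proj_pt v) = vec (proj_coord e v)"
  using proj_ratio.abs_eq[OF proj_rel_refl, of v] proj_ratio'.abs_eq[OF proj_rel_refl, of v]
  by (cases e) (simp_all add: proj_chart_def proj_coord_def vec_eq_iff)

lemma mem_proj_chart_affine:
  assumes "q \<in> fst (proj_chart e)"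
  shows "q = proj_pt (proj_affine e (snd (proj_chart e) q $ 1))"
proof -
  obtain t where "q = proj_pt (proj_affine e t)"
    using assms by (auto simp: proj_chart_def)
  then show ?thesis
    by (simp add: snd_proj_chart)
qed

lemma proj_chart_cover: "fst (proj_chart True) \<union> fst (proj_chart False) = UNIV"
proof -
  have "q \<in> fst (proj_chart True) \<union> fst (proj_chart False)" for q
  proof -
    obtain v where v: "v \<noteq> 0" "q = proj_pt v"
      by (rule proj_pt_cases)
    then have "proj_den True v \<noteq> 0 \<or> proj_den False v \<noteq> 0"
      by (auto simp: proj_den_def prod_eq_iff)
    then show ?thesis
      using mem_proj_chart[OF v(1)] v(2) by blast
  qed
  then show ?thesis by blast
qed

lemma atlas_projective_line: "atlas projective_line = range proj_chart"
  by (auto simp: projective_line_def proj_chart_def proj_affine_def UNIV_bool)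

lemma points_projective_line [simp]: "points projective_line = UNIV"
  by (simp add: projective_line_def)

lemma open_proj_chart: "open (fst (proj_chart e))"
proof -
  have "open {v. proj_den e v \<noteq> 0}"
    by (cases e) (auto simp: proj_den_def intro!: open_Collect_neq continuous_intros)
  then show ?thesis
    by (simp add: open_proj_line_def proj_chart_preimage)
qed

lemma continuous_on_proj_line:
  assumes U: "open U" and f: "continuous_on {v. v \<noteq> 0 \<and> proj_pt v \<in> U} (\<lambda>v. f (proj_pt v))"
  shows "continuous_on U f"
  unfolding continuous_on_open_vimage[OF U]
proof (intro allI impI)
  fix B :: "'a set" assume B: "open B"
  have oU: "open {v. v \<noteq> 0 \<and> proj_pt v \<in> U}"
    using U by (simp add: open_proj_line_def)
  have "open ((\<lambda>v. f (proj_pt v)) -` B \<inter> {v. v \<noteq> 0 \<and> proj_pt v \<in> U})"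
    using f B unfolding continuous_on_open_vimage[OF oU] by blast
  moreover have "(\<lambda>v. f (proj_pt v)) -` B \<inter> {v. v \<noteq> 0 \<and> proj_pt v \<in> U} = {v. v \<noteq> 0 \<and> proj_pt v \<in> f -` B \<inter> U}"
    by auto
  ultimately show "open (f -` B \<inter> U)"
    by (simp add: open_proj_line_def)
qed

lemma continuous_on_proj_pt: "continuous_on {v. v \<noteq> 0} proj_pt"
proof -
  have open_nz: "open {v :: complex \<times> complex. v \<noteq> 0}"
    by (intro open_Collect_neq continuous_intros)
  have "proj_pt -` B \<inter> {v. v \<noteq> 0} = {v. v \<noteq> 0 \<and> proj_pt v \<in> B}" for B
    by auto
  then show ?thesis
    unfolding continuous_on_open_vimage[OF open_nz] by (simp add: open_proj_line_def)
qed

lemma continuous_proj_affine: "continuous_on UNIV (proj_affine e)"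
  by (cases e) (auto simp: proj_affine_def intro!: continuous_intros)

lemma continuous_proj_pt_affine: "continuous_on UNIV (\<lambda>t. proj_pt (proj_affine e t))"
  by (rule continuous_on_compose2[OF continuous_on_proj_pt continuous_proj_affine]) auto

lemma continuous_proj_chart: "continuous_on (fst (proj_chart e)) (snd (proj_chart e))"
proof (rule continuous_on_proj_line[OF open_proj_chart])
  have "continuous_on {v. proj_den e v \<noteq> 0} (proj_coord e)"
    by (cases e) (auto simp: proj_den_def proj_coord_def intro!: continuous_intros)
  then have "continuous_on {v. proj_den e v \<noteq> 0} (\<lambda>v. vec (proj_coord e v) :: complex ^ 1)"
    unfolding vec_def by (intro continuous_on_vec_lambda)
  then show "continuous_on {v. v \<noteq> 0 \<and> proj_pt v \<in> fst (proj_chart e)} (\<lambda>v. snd (proj_chart e) (proj_pt v))"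
    unfolding proj_chart_preimage
    by (rule continuous_on_eq) (simp add: snd_proj_chart proj_den_nonzero)
qed

lemma proj_chart_image: "snd (proj_chart e) ` fst (proj_chart e) = UNIV"
proof -
  have "z \<in> snd (proj_chart e) ` fst (proj_chart e)" for z
    by (rule image_eqI[of _ _ "proj_pt (proj_affine e (z $ 1))"])
       (simp_all add: snd_proj_chart vec_nth_1 mem_proj_chart)
  then show ?thesis by blast
qed

lemma chart_inv_proj_chart: "chart_inv (proj_chart e) z = proj_pt (proj_affine e (z $ 1))"
proof -
  have inj: "inj_on (snd (proj_chart e)) (fst (proj_chart e))"
    by (rule inj_on_inverseI[where g = "\<lambda>z. proj_pt (proj_affine e (z $ 1))"])
       (rule mem_proj_chart_affine[symmetric])
  show ?thesis
    unfolding chart_inv_def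
    by (rule inv_into_f_eq[OF inj]) (simp_all add: snd_proj_chart vec_nth_1 mem_proj_chart)
qed

lemma charted_projective_line: "charted projective_line"
  unfolding charted_def
proof (intro conjI ballI)
  show "\<Union>(fst ` atlas projective_line) = points projective_line"
    using proj_chart_cover by (auto simp: atlas_projective_line UNIV_bool)
  fix \<phi> assume "\<phi> \<in> atlas projective_line"
  then obtain e where \<phi>: "\<phi> = proj_chart e"
    by (auto simp: atlas_projective_line)
  show "openin (mtop projective_line) (fst \<phi>)" "open (snd \<phi> ` fst \<phi>)"
    by (simp_all add: \<phi> open_proj_chart proj_chart_image)
  show "homeomorphism (fst \<phi>) (snd \<phi> ` fst \<phi>) (snd \<phi>) (chart_inv \<phi>)"
    unfolding \<phi> proj_chart_image
  proof (rule homeomorphismI)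
    show "continuous_on UNIV (chart_inv (proj_chart e))"
      unfolding chart_inv_proj_chart
      by (rule continuous_on_compose2[OF continuous_proj_pt_affine])
         (auto intro!: continuous_on_component continuous_on_id)
    show "chart_inv (proj_chart e) ` UNIV \<subseteq> fst (proj_chart e)"
      by (auto simp: chart_inv_proj_chart mem_proj_chart)
    show "chart_inv (proj_chart e) (snd (proj_chart e) q) = q" if "q \<in> fst (proj_chart e)" for q
      using mem_proj_chart_affine[OF that] by (simp add: chart_inv_proj_chart)
    show "snd (proj_chart e) (chart_inv (proj_chart e) z) = z" for z
      by (simp add: chart_inv_proj_chart snd_proj_chart vec_nth_1)
  qed (simp_all add: continuous_proj_chart)
qed

lemma compact_proj_line: "compact (UNIV :: proj_line set)"
proof -
  have "q \<in> proj_pt ` sphere 0 1" for q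
  proof -
    obtain v where v: "v \<noteq> 0" "q = proj_pt v"
      by (rule proj_pt_cases)
    have "proj_pt v = proj_pt (v /\<^sub>R norm v)"
      by (rule proj_pt_eqI[of _ "of_real (inverse (norm v))"]) (use v(1) in \<open>auto simp: prod_eq_iff scaleR_conv_of_real\<close>)
    then show ?thesis
      using v by (intro image_eqI[of _ _ "v /\<^sub>R norm v"]) auto
  qed
  then have "(UNIV :: proj_line set) = proj_pt ` sphere 0 1"
    by blast
  moreover have "compact (proj_pt ` sphere 0 1)"
    by (intro compact_continuous_image continuous_on_subset[OF continuous_on_proj_pt]) auto
  ultimately show ?thesis by simp
qed

subsection \<open>Differentiable maps of the projective line\<close>

lemma has_derivative_vec_1:
  assumes "(f has_field_derivative d) (at (z $ 1))"
  shows "((\<lambda>z :: complex ^ 1. vec (f (z $ 1)) :: complex ^ 1) has_derivative (*v) (\<chi> i j. d)) (at z)"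
proof (rule has_derivative_vec_components)
  fix j :: 1
  have "((\<lambda>z :: complex ^ 1. z $ 1) has_derivative (\<lambda>v. v $ 1)) (at z)"
    by (rule bounded_linear_imp_has_derivative[OF bounded_linear_vec_nth])
  from diff_chain_at[OF this assms[unfolded has_field_derivative_def]]
  show "((\<lambda>z. vec (f (z $ 1)) $ j) has_derivative (\<lambda>v. ((\<chi> i j. d) *v v) $ j)) (at z)"
    by (simp add: o_def matrix_vector_mult_def UNIV_1)
qed

lemma has_field_derivative_vec_1:
  fixes F :: "complex ^ 1 \<Rightarrow> complex ^ 1"
  assumes "(F has_derivative (*v) D) (at (vec s))"
  shows "((\<lambda>s. F (vec s) $ 1) has_field_derivative D $ 1 $ 1) (at s)"
proof -
  have vec_axis: "vec = (axis 1 :: complex \<Rightarrow> complex ^ 1)"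
    by (simp add: fun_eq_iff vec_eq_iff axis_def forall_1)
  have "((vec :: complex \<Rightarrow> complex ^ 1) has_derivative vec) (at s)"
    unfolding vec_axis by (rule bounded_linear_imp_has_derivative[OF bounded_linear_axis])
  from bounded_linear.has_derivative[OF bounded_linear_vec_nth diff_chain_at[OF this assms], of 1]
  show ?thesis
    by (simp add: has_field_derivative_def o_def matrix_vector_mult_def UNIV_1)
qed

text \<open>In affine coordinates the map is a fractional linear one, with a denominator that does not vanish where
  the image lies in the target chart.\<close>

lemma mdiff_at_proj_linear:
  assumes A: "A = (\<lambda>v. (\<alpha> * fst v + \<beta> * snd v, \<gamma> * fst v + \<delta> * snd v))" and nz: "\<And>v. v \<noteq> 0 \<Longrightarrow> A v \<noteq> 0"
    and m: "\<And>v. v \<noteq> 0 \<Longrightarrow> m (proj_pt v) = proj_pt (A v)"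
  shows "mdiff_at projective_line projective_line m q"
  unfolding mdiff_at_def
proof (intro conjI allI impI ballI)
  have "continuous_on {v. v \<noteq> 0} (\<lambda>v. proj_pt (A v))"
    by (rule continuous_on_compose2[OF continuous_on_proj_pt])
       (use nz in \<open>auto simp: A intro!: continuous_intros\<close>)
  then have "continuous_on {v. v \<noteq> 0} (\<lambda>v. m (proj_pt v))"
    by (rule continuous_on_eq) (simp add: m)
  then have cont: "continuous_on UNIV m"
    by (intro continuous_on_proj_line) simp_all
  fix V assume V: "openin (mtop projective_line) V" "m q \<in> V"
  then have "open (m -` V)"
    using cont open_vimage by auto
  then show "\<exists>U. openin (mtop projective_line) U \<and> q \<in> U \<and> m ` U \<subseteq> V"
    using V(2) by (intro exI[of _ "m -` V"]) auto
next
  fix \<phi> \<psi> assume "\<phi> \<in> atlas projective_line" "\<psi> \<in> atlas projective_line" and q: "q \<in> fst \<phi>" "m q \<in> fst \<psi>"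
  then obtain e e' where \<phi>: "\<phi> = proj_chart e" and \<psi>: "\<psi> = proj_chart e'"
    by (auto simp: atlas_projective_line)
  define s where "s = snd \<phi> q $ 1"
  have q_eq: "q = proj_pt (proj_affine e s)"
    using mem_proj_chart_affine q(1) by (simp add: \<phi> s_def)
  have "proj_den e' (A (proj_affine e s)) \<noteq> 0"
    using q(2) nz by (simp add: \<psi> q_eq m mem_proj_chart)
  then have "\<exists>d. ((\<lambda>s. proj_coord e' (A (proj_affine e s))) has_field_derivative d) (at s)"
    unfolding A proj_den_def proj_coord_def proj_affine_def
    by (cases e; cases e') (auto intro!: exI derivative_eq_intros)
  then obtain d where "((\<lambda>s. proj_coord e' (A (proj_affine e s))) has_field_derivative d) (at s)" ..
  from has_derivative_vec_1[OF this[unfolded s_def]]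
  have "((\<lambda>z :: complex ^ 1. vec (proj_coord e' (A (proj_affine e (z $ 1)))) :: complex ^ 1)
      has_derivative (*v) (\<chi> i j. d)) (at (snd \<phi> q))" .
  moreover have "(snd \<psi> \<circ> m \<circ> chart_inv \<phi>) = (\<lambda>z. vec (proj_coord e' (A (proj_affine e (z $ 1)))))"
    using nz by (simp add: fun_eq_iff \<phi> \<psi> chart_inv_proj_chart m snd_proj_chart)
  ultimately show "\<exists>D. (snd \<psi> \<circ> m \<circ> chart_inv \<phi> has_derivative (*v) D) (at (snd \<phi> q))"
    by auto
qed

lemma mdiff_at_proj_id: "mdiff_at projective_line projective_line (\<lambda>q. q) q"
  by (rule mdiff_at_proj_linear[of "\<lambda>v. v" 1 0 0 1]) auto

lemma mdiff_at_continuous_on: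
  fixes X :: "('a::topological_space, 'n::finite) mfd" and Y :: "('b::topological_space, 'm::finite) mfd"
  assumes "\<And>x. mdiff_at X Y f x" "points X = UNIV" "points Y = UNIV"
  shows "continuous_on UNIV f"
  unfolding continuous_on_open_vimage[OF open_UNIV]
proof (intro allI impI)
  fix V :: "'b set" assume V: "open V"
  show "open (f -` V \<inter> UNIV)"
  proof (subst open_subopen, intro ballI)
    fix x assume "x \<in> f -` V \<inter> UNIV"
    then have "openin (mtop Y) V" "f x \<in> V"
      using V assms(3) by simp_all
    from mdiff_atD1[OF assms(1) this] obtain U where "openin (mtop X) U" "x \<in> U" "f ` U \<subseteq> V" .
    then show "\<exists>T. open T \<and> x \<in> T \<and> T \<subseteq> f -` V \<inter> UNIV"
      using assms(2) by (intro exI[of _ U]) auto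
  qed
qed

text \<open>In an affine coordinate of the source such a map is an entire function with a limit at infinity, namely
  its value at the point at infinity, so Liouville's theorem applies.\<close>

lemma proj_line_map_into_chart_constant:
  assumes \<Phi>: "\<And>q. mdiff_at projective_line projective_line \<Phi> q" and im: "\<And>q. \<Phi> q \<in> fst (proj_chart e)"
  shows "snd (proj_chart e) (\<Phi> q) = snd (proj_chart e) (\<Phi> q')"
proof -
  define f where "f e' s = snd (proj_chart e) (\<Phi> (proj_pt (proj_affine e' s))) $ 1" for e' s
  have deriv: "\<exists>d. (f e' has_field_derivative d) (at s)" for e' s
  proof -
    let ?q = "proj_pt (proj_affine e' s)"
    have "proj_chart e' \<in> atlas projective_line" "proj_chart e \<in> atlas projective_line" "?q \<in> fst (proj_chart e')"
      by (simp_all add: atlas_projective_line mem_proj_chart)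
    from mdiff_atD2[OF \<Phi> this im] obtain D where
      "(snd (proj_chart e) \<circ> \<Phi> \<circ> chart_inv (proj_chart e') has_derivative (*v) D) (at (snd (proj_chart e') ?q))" .
    then have "(snd (proj_chart e) \<circ> \<Phi> \<circ> chart_inv (proj_chart e') has_derivative (*v) D) (at (vec s))"
      by (simp add: snd_proj_chart)
    from has_field_derivative_vec_1[OF this] show ?thesis
      by (auto simp: chart_inv_proj_chart f_def[abs_def])
  qed
  have hol: "f True holomorphic_on UNIV"
    using deriv by (simp add: holomorphic_on_open)
  have inv: "f True s = f False (inverse s)" if "s \<noteq> 0" for s
  proof -
    have "proj_pt (proj_affine True s) = proj_pt (proj_affine False (inverse s))"
      by (rule proj_pt_eqI[of _ "inverse s"]) (use that in \<open>simp_all add: proj_affine_def zero_prod_def\<close>)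
    then show ?thesis
      by (simp add: f_def)
  qed
  have "isCont (f False) 0"
    using deriv DERIV_isCont by blast
  then have "((\<lambda>s. f False (inverse s)) \<longlongrightarrow> f False 0) at_infinity"
    by (intro isCont_tendsto_compose[OF _ tendsto_inverse_0])
  moreover have "\<forall>\<^sub>F s in at_infinity. f False (inverse s) = f True s"
    unfolding eventually_at_infinity
  proof (intro exI[of _ 1] allI impI)
    fix s :: complex assume "1 \<le> norm s"
    then have "s \<noteq> 0"
      by auto
    then show "f False (inverse s) = f True s"
      by (rule inv[symmetric])
  qed
  ultimately have "(f True \<longlongrightarrow> f False 0) at_infinity"
    by (rule Lim_transform_eventually)
  then have const: "f True s = f False 0" for s
    by (rule Liouville_weak[OF hol])
  have "snd (proj_chart e) (\<Phi> q) $ 1 = f False 0" for q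
  proof (cases "q \<in> fst (proj_chart True)")
    case True
    then obtain t where "q = proj_pt (proj_affine True t)"
      by (auto simp: proj_chart_def)
    then show ?thesis
      using const[of t] by (simp add: f_def)
  next
    case False
    then have "q \<in> fst (proj_chart False)"
      using proj_chart_cover by blast
    then obtain t where t: "q = proj_pt (proj_affine False t)"
      by (auto simp: proj_chart_def)
    then have "t = 0"
      using False by (simp add: mem_proj_chart) (simp add: proj_den_def proj_affine_def)
    then show ?thesis
      using t by (simp add: f_def)
  qed
  then show ?thesis
    by (simp add: vec_eq_iff forall_1)
qed

subsection \<open>Dilations fixing a point\<close>

text \<open>In the affine chart \<open>e\<close> this is the map \<open>z \<mapsto> c + exp t (z - c)\<close>.\<close>

definition dilation_vec :: "bool \<Rightarrow> complex \<Rightarrow> complex \<Rightarrow> complex \<times> complex \<Rightarrow> complex \<times> complex" where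
  "dilation_vec e c t v =
     (if e then (exp t * (fst v - c * snd v) + c * snd v, snd v)
      else (fst v, exp t * (snd v - c * fst v) + c * fst v))"

lemma dilation_vec_nonzero:
  assumes "v \<noteq> 0"
  shows "dilation_vec e c t v \<noteq> 0"
proof (cases e)
  case True
  show ?thesis
  proof (cases "snd v = 0")
    case True
    then have "fst v \<noteq> 0"
      using assms by (simp add: prod_eq_iff)
    then show ?thesis
      using True \<open>e\<close> by (simp add: dilation_vec_def zero_prod_def)
  qed (use \<open>e\<close> in \<open>simp add: dilation_vec_def zero_prod_def\<close>)
next
  case False
  show ?thesis
  proof (cases "fst v = 0")
    case True
    then have "snd v \<noteq> 0"
      using assms by (simp add: prod_eq_iff)
    then show ?thesis
      using True \<open>\<not> e\<close> by (simp add: dilation_vec_def zero_prod_def)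
  qed (use \<open>\<not> e\<close> in \<open>simp add: dilation_vec_def zero_prod_def\<close>)
qed

lift_definition dilation :: "bool \<Rightarrow> complex \<Rightarrow> complex \<Rightarrow> proj_line \<Rightarrow> proj_line" is dilation_vec
proof -
  fix e :: bool and c t :: complex and u v :: "complex \<times> complex"
  assume "proj_rel u v"
  then obtain d where "u \<noteq> 0" "d \<noteq> 0" "v = (d * fst u, d * snd u)"
    by (auto simp: proj_rel_def)
  then show "proj_rel (dilation_vec e c t u) (dilation_vec e c t v)"
    unfolding proj_rel_def
    by (intro conjI exI[of _ d] dilation_vec_nonzero) (simp_all add: dilation_vec_def algebra_simps)
qed

lemma dilation_proj_pt: "v \<noteq> 0 \<Longrightarrow> dilation e c t (proj_pt v) = proj_pt (dilation_vec e c t v)"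
  by (rule dilation.abs_eq[OF proj_rel_refl])

lemma dilation_affine:
  "dilation e c t (proj_pt (proj_affine e s)) = proj_pt (proj_affine e (exp t * (s - c) + c))"
  by (simp add: dilation_proj_pt) (simp add: dilation_vec_def proj_affine_def)

lemma dilation_0: "dilation e c 0 q = q"
proof -
  obtain v where "v \<noteq> 0" "q = proj_pt v"
    by (rule proj_pt_cases)
  moreover have "dilation_vec e c 0 v = v" for v
    by (simp add: dilation_vec_def prod_eq_iff)
  ultimately show ?thesis
    by (simp add: dilation_proj_pt)
qed

lemma mdiff_at_dilation: "mdiff_at projective_line projective_line (dilation e c t) q"
proof (cases e)
  case True
  show ?thesis
    by (rule mdiff_at_proj_linear[of "dilation_vec e c t" "exp t" "c - exp t * c" 0 1])
       (use True in \<open>simp_all add: dilation_vec_nonzero dilation_proj_pt, simp add: dilation_vec_def fun_eq_iff algebra_simps\<close>)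
next
  case False
  show ?thesis
    by (rule mdiff_at_proj_linear[of "dilation_vec e c t" 1 0 "c - exp t * c" "exp t"])
       (use False in \<open>simp_all add: dilation_vec_nonzero dilation_proj_pt, simp add: dilation_vec_def fun_eq_iff algebra_simps\<close>)
qed

lemma continuous_dilation: "continuous_on UNIV (\<lambda>(t, q). dilation e c t q)"
proof -
  have "continuous_on (UNIV \<times> fst (proj_chart e')) (\<lambda>(t, q). dilation e c t q)" for e'
  proof -
    have "continuous_on (UNIV \<times> fst (proj_chart e')) (\<lambda>x. proj_affine e' (snd (proj_chart e') (snd x) $ 1))"
      by (intro continuous_on_compose2[OF continuous_proj_affine] continuous_on_component
            continuous_on_compose2[OF continuous_proj_chart] continuous_on_snd continuous_on_id) auto
    then have "continuous_on (UNIV \<times> fst (proj_chart e'))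
        (\<lambda>x. dilation_vec e c (fst x) (proj_affine e' (snd (proj_chart e') (snd x) $ 1)))"
      unfolding dilation_vec_def
      by (cases e) (auto intro!: continuous_intros)
    then have "continuous_on (UNIV \<times> fst (proj_chart e'))
        (\<lambda>x. proj_pt (dilation_vec e c (fst x) (proj_affine e' (snd (proj_chart e') (snd x) $ 1))))"
      by (rule continuous_on_compose2[OF continuous_on_proj_pt]) (auto simp: dilation_vec_nonzero)
    then show ?thesis
    proof (rule continuous_on_eq)
      fix x :: "complex \<times> proj_line" assume "x \<in> UNIV \<times> fst (proj_chart e')"
      then have "snd x \<in> fst (proj_chart e')"
        by auto
      then obtain s where "snd x = proj_pt (proj_affine e' s)"
        by (auto simp: proj_chart_def)
      then show "proj_pt (dilation_vec e c (fst x) (proj_affine e' (snd (proj_chart e') (snd x) $ 1))) =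
          (case x of (t, q) \<Rightarrow> dilation e c t q)"
        by (simp add: case_prod_beta snd_proj_chart dilation_proj_pt)
    qed
  qed
  then have "continuous_on (UNIV \<times> fst (proj_chart True) \<union> UNIV \<times> fst (proj_chart False)) (\<lambda>(t, q). dilation e c t q)"
    by (intro continuous_on_open_Un open_Times open_proj_chart open_UNIV) simp_all
  moreover have "UNIV \<times> fst (proj_chart True) \<union> UNIV \<times> fst (proj_chart False) = (UNIV :: (complex \<times> proj_line) set)"
    by (simp add: proj_chart_cover flip: Sigma_Un_distrib2)
  ultimately show ?thesis
    by simp
qed

subsection \<open>Rigidity\<close>

text \<open>By compactness of the projective line the image of \<open>\<Phi> t\<close> stays for small \<open>t\<close> inside the affine chart that
  contains the image of \<open>\<Phi> 0\<close>, so that \<open>\<Phi> t\<close> is constant. A parameter with \<open>exp t \<noteq> 1\<close> is singled out because it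
  gives a dilation other than the identity.\<close>

lemma proj_line_family_constant:
  assumes cont: "continuous_on UNIV (\<lambda>(t, q). \<Phi> t q)"
    and \<Phi>: "\<And>t q. mdiff_at projective_line projective_line (\<Phi> t) q"
    and \<Phi>0: "\<And>q. \<Phi> (0 :: complex) q \<in> fst (proj_chart e)"
  obtains t where "exp t \<noteq> 1" "\<forall>q q'. snd (proj_chart e) (\<Phi> t q) = snd (proj_chart e) (\<Phi> t q')"
proof -
  have "open ((\<lambda>(t, q). \<Phi> t q) -` fst (proj_chart e))"
    by (rule open_vimage[OF open_proj_chart cont])
  moreover have "{0} \<times> UNIV \<subseteq> (\<lambda>(t, q). \<Phi> t q) -` fst (proj_chart e)"
    using \<Phi>0 by auto
  ultimately have "\<exists>T. 0 \<in> T \<and> open T \<and> T \<times> UNIV \<subseteq> (\<lambda>(t, q). \<Phi> t q) -` fst (proj_chart e)"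
    by (rule Elementary_Topology.tube_lemma[OF compact_proj_line])
  then obtain T where T: "0 \<in> T" "open T" "T \<times> UNIV \<subseteq> (\<lambda>(t, q). \<Phi> t q) -` fst (proj_chart e)"
    by (elim exE conjE)
  obtain \<epsilon> where \<epsilon>: "\<epsilon> > 0" "ball 0 \<epsilon> \<subseteq> T"
    using T(1,2) open_contains_ball by blast
  let ?t = "of_real (\<epsilon> / 2) :: complex"
  have "?t \<in> T"
    using \<epsilon> by (intro subsetD[OF \<epsilon>(2)]) simp
  then have "\<Phi> ?t q \<in> fst (proj_chart e)" for q
    using subsetD[OF T(3), of "(?t, q)"] by simp
  from proj_line_map_into_chart_constant[OF \<Phi> this]
  have "\<forall>q q'. snd (proj_chart e) (\<Phi> ?t q) = snd (proj_chart e) (\<Phi> ?t q')"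
    by (intro allI)
  moreover have "exp ?t \<noteq> 1"
  proof -
    have "exp (\<epsilon> / 2) \<noteq> 1"
      using \<epsilon>(1) by simp
    then have "of_real (exp (\<epsilon> / 2)) \<noteq> (1 :: complex)"
      by (simp only: of_real_eq_1_iff not_False_eq_True)
    then show ?thesis
      by (simp only: exp_of_real not_False_eq_True)
  qed
  ultimately show ?thesis
    by (rule that[rotated])
qed

lemma has_derivative_zero_matrix:
  fixes E :: "complex ^ 'n::finite ^ 'm::finite"
  assumes "(F has_derivative (*v) E) (at z)" "\<And>w. F w = F z"
  shows "E *v v = 0"
proof -
  have "(F has_derivative (\<lambda>_. 0)) (at z)"
    by (rule has_derivative_transform_within_open[OF has_derivative_const[of "F z"] open_UNIV UNIV_I])
       (rule assms(2)[symmetric])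
  from has_derivative_unique[OF assms(1) this] show ?thesis
    by (rule fun_cong)
qed

text \<open>Conjugate a dilation of the \<open>j\<close>-th factor about \<open>x\<close> by \<open>F\<close>. The result fixes \<open>F x\<close>, and the \<open>i, k\<close> entry of its
  derivative there is \<open>(exp t - 1) D\<^sub>i\<^sub>j B\<^sub>j\<^sub>k\<close>. If this were not zero, the \<open>i\<close>-th component would vary along the line
  through \<open>F x\<close> in the direction of the \<open>k\<close>-th factor, but on this line it is a map to an affine chart if \<open>t\<close> is
  small.\<close>

lemma proj_line_power_automorphism_entries:
  fixes F G :: "proj_line ^ 'n::finite \<Rightarrow> proj_line ^ 'n"
  defines "P \<equiv> (mfd_power projective_line :: (proj_line ^ 'n, 'n) mfd)"
  assumes F: "mfd_automorphism P F G" and \<phi>: "\<phi> \<in> atlas P" "x \<in> fst \<phi>" and \<psi>: "\<psi> \<in> atlas P" "F x \<in> fst \<psi>"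
    and D: "(snd \<psi> \<circ> F \<circ> chart_inv \<phi> has_derivative (*v) D) (at (snd \<phi> x))"
    and B: "(snd \<phi> \<circ> G \<circ> chart_inv \<psi> has_derivative (*v) B) (at (snd \<psi> (F x)))" and DB: "D ** B = mat 1"
    and ik: "i \<noteq> k"
  shows "D $ i $ j * B $ j $ k = 0"
proof -
  let ?M = projective_line
  have M: "charted ?M"
    by (rule charted_projective_line)
  have P: "charted P"
    unfolding P_def by (rule charted_mfd_power[OF M])
  have pts: "points P = UNIV"
    by (simp add: P_def points_mfd_power)
  have mF: "mdiff_at P P F y" and mG: "mdiff_at P P G y" and GF: "G (F y) = y" for y
    using F by (simp_all add: mfd_automorphism_def pts)
  obtain c where c: "\<forall>l. c l \<in> atlas ?M" and \<phi>_eq: "\<phi> = power_chart c"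
    using \<phi>(1) by (auto simp: P_def atlas_mfd_power)
  obtain d where d: "\<forall>l. d l \<in> atlas ?M" and \<psi>_eq: "\<psi> = power_chart d"
    using \<psi>(1) by (auto simp: P_def atlas_mfd_power)
  obtain e where e: "c j = proj_chart e"
    using c by (auto simp: atlas_projective_line)
  obtain e' where e': "d i = proj_chart e'"
    using d by (auto simp: atlas_projective_line)
  define b where "b = F x"
  define s0 where "s0 = snd \<phi> x $ j"
  have xj: "x $ j \<in> fst (proj_chart e)" and bi: "b $ i \<in> fst (d i)" and bk: "b $ k \<in> fst (d k)"
    using \<phi>(2) \<psi>(2) by (auto simp: \<phi>_eq \<psi>_eq power_chart_def b_def simp flip: e)
  \<comment> \<open>The dilation of the \<open>j\<close>-th factor about \<open>x\<close>, the line through \<open>b = F x\<close> in the direction of the \<open>k\<close>-th factor,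
    and the \<open>i\<close>-th component of \<open>F \<circ> S t \<circ> G\<close> on this line. As \<open>i \<noteq> k\<close>, the map \<open>\<Phi> 0\<close> is constant.\<close>
  define S where "S t p = (\<chi> l. if l = j then dilation e s0 t (p $ l) else p $ l)" for t and p :: "proj_line ^ 'n"
  define \<iota> where "\<iota> q = (\<chi> l. if l = k then q else b $ l)" for q :: proj_line
  define \<Phi> where "\<Phi> t q = F (S t (G (\<iota> q))) $ i" for t q
  have proj: "mdiff_at P ?M (\<lambda>p. p $ l) y" for l y
    unfolding P_def by (rule mdiff_at_power_proj[OF M mdiff_at_proj_id]) (simp add: points_mfd_power)
  have mS: "mdiff_at P P (S t) y" for t y
    unfolding P_def
  proof (rule mdiff_at_power)
    fix l
    show "mdiff_at (mfd_power ?M) ?M (\<lambda>y. S t y $ l) y"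
    proof (cases "l = j")
      case True
      have "mdiff_at P ?M (dilation e s0 t \<circ> (\<lambda>p. p $ l)) y"
        by (rule mdiff_at_compose[OF P M _ proj mdiff_at_dilation]) simp
      then show ?thesis
        using True by (simp add: S_def o_def P_def)
    next
      case False
      then show ?thesis
        using proj[of l y] by (simp add: S_def P_def)
    qed
  qed
  have m\<iota>: "mdiff_at ?M P \<iota> q" for q
    unfolding P_def
  proof (rule mdiff_at_power)
    fix l
    show "mdiff_at ?M ?M (\<lambda>q. \<iota> q $ l) q"
      using mdiff_at_proj_id mdiff_at_const[of q ?M ?M "b $ l"] by (cases "l = k") (simp_all add: \<iota>_def)
  qed
  have inP: "y \<in> points P" for y
    by (simp add: pts)
  have mG\<iota>: "mdiff_at ?M P (G \<circ> \<iota>) q" for q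
    by (rule mdiff_at_compose[OF M P inP m\<iota> mG])
  have mSG\<iota>: "mdiff_at ?M P (S t \<circ> (G \<circ> \<iota>)) q" for t q
    by (rule mdiff_at_compose[OF M P inP mG\<iota> mS])
  have mFSG\<iota>: "mdiff_at ?M P (F \<circ> (S t \<circ> (G \<circ> \<iota>))) q" for t q
    by (rule mdiff_at_compose[OF M P inP mSG\<iota> mF])
  have \<Phi>_eq: "\<Phi> t = (\<lambda>p. p $ i) \<circ> (F \<circ> (S t \<circ> (G \<circ> \<iota>)))" for t
    by (simp add: fun_eq_iff \<Phi>_def)
  have m\<Phi>: "mdiff_at ?M ?M (\<Phi> t) q" for t q
    unfolding \<Phi>_eq by (rule mdiff_at_compose[OF M P inP mFSG\<iota> proj])
  have \<iota>b: "\<iota> (b $ k) = b"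
    by (simp add: \<iota>_def vec_eq_iff)
  have Gb: "G b = x"
    using GF by (simp add: b_def)
  have x_j: "x $ j = proj_pt (proj_affine e s0)"
    using mem_proj_chart_affine[OF xj] by (simp add: s0_def \<phi>_eq power_chart_def e)
  have Sx: "S t x = x" for t
    using dilation_affine[of e s0 t s0] by (simp add: S_def vec_eq_iff x_j)
  have cont: "continuous_on UNIV (\<lambda>(t, q). \<Phi> t q)"
  proof -
    have contF: "continuous_on UNIV F" and contG\<iota>: "continuous_on UNIV (G \<circ> \<iota>)"
      by (rule mdiff_at_continuous_on[OF mF pts pts], rule mdiff_at_continuous_on[OF mG\<iota> _ pts], simp)
    have "continuous_on UNIV (\<lambda>x. S (fst x) ((G \<circ> \<iota>) (snd x)))"
      unfolding S_def
    proof (rule continuous_on_vec_lambda)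
      fix l
      have comp: "continuous_on UNIV (\<lambda>x :: complex \<times> proj_line. (G \<circ> \<iota>) (snd x) $ l)"
        by (intro continuous_on_component continuous_on_compose2[OF contG\<iota>] continuous_on_snd continuous_on_id) simp
      have "continuous_on UNIV (\<lambda>x :: complex \<times> proj_line. case (fst x, (G \<circ> \<iota>) (snd x) $ l) of (t, q) \<Rightarrow> dilation e s0 t q)"
        by (rule continuous_on_compose2[OF continuous_dilation])
           (intro continuous_on_Pair continuous_on_fst continuous_on_id comp, simp)
      then show "continuous_on UNIV (\<lambda>x :: complex \<times> proj_line.
          if l = j then dilation e s0 (fst x) ((G \<circ> \<iota>) (snd x) $ l) else (G \<circ> \<iota>) (snd x) $ l)"
        using comp by (cases "l = j") simp_all
    qed
    from continuous_on_component[OF continuous_on_compose2[OF contF this subset_UNIV]]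
    have "continuous_on UNIV (\<lambda>x. F (S (fst x) ((G \<circ> \<iota>) (snd x))) $ i)" .
    then show ?thesis
      by (simp add: \<Phi>_def case_prod_beta)
  qed
  have "S 0 y = y" for y
    by (simp add: S_def vec_eq_iff dilation_0)
  moreover have "F (G y) = y" for y
    using F by (simp add: mfd_automorphism_def pts)
  ultimately have "\<Phi> 0 q \<in> fst (proj_chart e')" for q
    using ik bi by (simp add: \<Phi>_def \<iota>_def e')
  from proj_line_family_constant[OF cont m\<Phi> this]
  obtain t where t: "exp t \<noteq> 1" "\<forall>q q'. snd (proj_chart e') (\<Phi> t q) = snd (proj_chart e') (\<Phi> t q')" .
  \<comment> \<open>The derivatives of the inclusion of the line, of the dilation and of the projection to the \<open>i\<close>-th factor.\<close>
  let ?J = "(\<chi> l m. if l = k then 1 else 0) :: complex ^ 1 ^ 'n"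
  let ?T = "(\<chi> l m. if l = m then (if l = j then exp t else 1) else 0) :: complex ^ 'n ^ 'n"
  let ?Q = "(\<chi> m l. if l = i then 1 else 0) :: complex ^ 'n ^ 1"
  have dk: "d k \<in> atlas ?M"
    using d by simp
  have D\<iota>: "(snd \<psi> \<circ> \<iota> \<circ> chart_inv (d k) has_derivative (*v) ?J) (at (snd (d k) (b $ k)))"
  proof (rule has_derivative_cong_nhds)
    show "((\<lambda>z :: complex ^ 1. \<chi> l. if l = k then z $ 1 else snd (d l) (b $ l) $ 1) has_derivative (*v) ?J)
        (at (snd (d k) (b $ k)))"
    proof (rule has_derivative_vec_components)
      fix l
      show "((\<lambda>z :: complex ^ 1. (\<chi> l. if l = k then z $ 1 else snd (d l) (b $ l) $ 1) $ l) has_derivative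
          (\<lambda>v. (?J *v v) $ l)) (at (snd (d k) (b $ k)))"
        using bounded_linear_imp_has_derivative[OF bounded_linear_vec_nth[of "1 :: 1"]]
        by (cases "l = k") (simp_all add: matrix_vector_mult_def UNIV_1)
    qed
    show "\<forall>\<^sub>F z in nhds (snd (d k) (b $ k)).
        (\<chi> l. if l = k then z $ 1 else snd (d l) (b $ l) $ 1) = (snd \<psi> \<circ> \<iota> \<circ> chart_inv (d k)) z"
      using eventually_chart_inv[OF M dk chartedD(1)[OF M dk] bk bk]
      by eventually_elim (auto simp: \<psi>_eq power_chart_def \<iota>_def vec_eq_iff)
  qed
  have DS: "(snd \<phi> \<circ> S t \<circ> chart_inv \<phi> has_derivative (*v) ?T) (at (snd \<phi> x))"
  proof (rule has_derivative_cong_nhds)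
    show "((\<lambda>z :: complex ^ 'n. \<chi> l. if l = j then exp t * (z $ l - s0) + s0 else z $ l) has_derivative (*v) ?T)
        (at (snd \<phi> x))"
    proof (rule has_derivative_vec_components)
      fix l
      have "((\<lambda>z :: complex ^ 'n. z $ l) has_derivative (\<lambda>v. v $ l)) (at (snd \<phi> x))"
        by (rule bounded_linear_imp_has_derivative[OF bounded_linear_vec_nth])
      then have "((\<lambda>z :: complex ^ 'n. if l = j then exp t * (z $ l - s0) + s0 else z $ l) has_derivative
          (\<lambda>v. (if l = j then exp t else 1) * v $ l)) (at (snd \<phi> x))"
        by (cases "l = j") (auto intro!: derivative_eq_intros)
      moreover have "(\<lambda>v. (?T *v v) $ l) = (\<lambda>v. (if l = j then exp t else 1) * v $ l)"
        by (rule ext) (simp add: matrix_vector_mult_def if_distrib[of "\<lambda>x. x * _"] cong: if_cong)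
      ultimately show "((\<lambda>z :: complex ^ 'n. (\<chi> l. if l = j then exp t * (z $ l - s0) + s0 else z $ l) $ l)
          has_derivative (\<lambda>v. (?T *v v) $ l)) (at (snd \<phi> x))"
        by simp
    qed
    show "\<forall>\<^sub>F z in nhds (snd \<phi> x).
        (\<chi> l. if l = j then exp t * (z $ l - s0) + s0 else z $ l) = (snd \<phi> \<circ> S t \<circ> chart_inv \<phi>) z"
      using eventually_chart_inv[OF P \<phi>(1) chartedD(1)[OF P \<phi>(1)] \<phi>(2) \<phi>(2)]
    proof eventually_elim
      case (elim z)
      define p where "p = chart_inv \<phi> z"
      have p\<phi>: "p \<in> fst \<phi>" "snd \<phi> p = z"
        using elim by (simp_all add: p_def)
      then have p: "\<forall>l. p $ l \<in> fst (c l)" "\<forall>l. z $ l = snd (c l) (p $ l) $ 1"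
        unfolding \<phi>_eq power_chart_def by auto
      obtain s where s: "p $ j = proj_pt (proj_affine e s)"
        using p(1)[rule_format, of j] by (auto simp: e proj_chart_def)
      have zj: "z $ j = s"
        using p(2) s by (simp add: e snd_proj_chart)
      have "snd (c l) (S t p $ l) $ 1 = (if l = j then exp t * (z $ l - s0) + s0 else z $ l)" for l
        using p(2) zj s by (simp add: S_def e dilation_affine snd_proj_chart)
      then have "snd \<phi> (S t p) = (\<chi> l. if l = j then exp t * (z $ l - s0) + s0 else z $ l)"
        unfolding \<phi>_eq power_chart_def by (simp add: vec_eq_iff)
      then show ?case
        by (simp add: p_def)
    qed
  qed
  have \<psi>b: "b \<in> fst \<psi>"
    using \<psi>(2) by (simp add: b_def)
  have B': "(snd \<phi> \<circ> G \<circ> chart_inv \<psi> has_derivative (*v) B) (at (snd \<psi> (\<iota> (b $ k))))"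
    using B unfolding \<iota>b b_def[symmetric] .
  have 1: "(snd \<phi> \<circ> (G \<circ> \<iota>) \<circ> chart_inv (d k) has_derivative (*v) (B ** ?J)) (at (snd (d k) (b $ k)))"
    by (rule has_derivative_chart_compose[OF M dk bk P \<psi>(1) _ m\<iota> D\<iota> B']) (simp add: \<iota>b \<psi>b)
  have 2: "(snd \<phi> \<circ> (S t \<circ> (G \<circ> \<iota>)) \<circ> chart_inv (d k) has_derivative (*v) (?T ** (B ** ?J))) (at (snd (d k) (b $ k)))"
    by (rule has_derivative_chart_compose[OF M dk bk P \<phi>(1) _ mG\<iota> 1])
       (use DS \<phi>(2) in \<open>simp_all add: \<iota>b Gb\<close>)
  have 3: "(snd \<psi> \<circ> (F \<circ> (S t \<circ> (G \<circ> \<iota>))) \<circ> chart_inv (d k) has_derivative (*v) (D ** (?T ** (B ** ?J))))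
      (at (snd (d k) (b $ k)))"
    by (rule has_derivative_chart_compose[OF M dk bk P \<phi>(1) _ mSG\<iota> 2])
       (use D[folded b_def] \<phi>(2) in \<open>simp_all add: \<iota>b Gb Sx\<close>)
  have proj_i: "(snd (d i) \<circ> (\<lambda>p. p $ i) \<circ> chart_inv \<psi> has_derivative (*v) ?Q) (at (snd \<psi> b))"
    using has_derivative_power_proj_chart[OF M d, of b i] \<psi>b by (simp add: \<psi>_eq)
  have "(snd (d i) \<circ> ((\<lambda>p. p $ i) \<circ> (F \<circ> (S t \<circ> (G \<circ> \<iota>)))) \<circ> chart_inv (d k) has_derivative
      (*v) (?Q ** (D ** (?T ** (B ** ?J))))) (at (snd (d k) (b $ k)))"
    by (rule has_derivative_chart_compose[OF M dk bk P \<psi>(1) _ mFSG\<iota> 3])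
       (use proj_i \<psi>b in \<open>simp_all add: \<iota>b Gb Sx b_def[symmetric]\<close>)
  then have "(snd (d i) \<circ> \<Phi> t \<circ> chart_inv (d k) has_derivative
      (*v) (?Q ** (D ** (?T ** (B ** ?J))))) (at (snd (d k) (b $ k)))"
    by (simp add: \<Phi>_eq)
  then have zero: "(?Q ** (D ** (?T ** (B ** ?J)))) *v 1 = 0"
    by (rule has_derivative_zero_matrix) (simp add: e', rule t(2)[rule_format])
  define w where "w = B *v axis k 1"
  have w: "w $ l = B $ l $ k" for l
    by (simp add: w_def matrix_vector_mult_def axis_def if_distrib[of "\<lambda>x. _ * x"] cong: if_cong)
  have J1: "?J *v 1 = axis k 1"
    by (simp add: vec_eq_iff matrix_vector_mult_def axis_def UNIV_1)
  have T: "?T *v v = v + ((exp t - 1) * v $ j) *s axis j 1" for v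
  proof -
    have "(?T *v v) $ l = (if l = j then exp t else 1) * v $ l" for l
      by (simp add: matrix_vector_mult_def if_distrib[of "\<lambda>x. x * _"] cong: if_cong)
    moreover have "(v + ((exp t - 1) * v $ j) *s axis j 1) $ l = (if l = j then exp t else 1) * v $ l" for l
      by (cases "l = j") (simp_all add: axis_def algebra_simps)
    ultimately show ?thesis
      by (simp only: vec_eq_iff simp_thms)
  qed
  have Dj: "(D *v (r *s axis j 1)) $ i = r * D $ i $ j" for r
    by (simp add: matrix_vector_mult_def axis_def if_distrib[of "\<lambda>x. _ * x"] cong: if_cong)
  have Dw: "D *v w = axis k 1"
    using DB by (simp add: w_def matrix_vector_mul_assoc)
  have "(?Q *v v) $ 1 = v $ i" for v
    by (simp add: matrix_vector_mult_def if_distrib[of "\<lambda>x. x * _"] cong: if_cong)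
  then have "0 = (D *v (?T *v w)) $ i"
    using zero by (simp add: matrix_vector_mul_assoc[symmetric] J1 w_def[symmetric] vec_eq_iff forall_1)
  also have "\<dots> = (exp t - 1) * w $ j * D $ i $ j"
    using ik by (simp add: T matrix_vector_right_distrib Dj Dw) (simp add: axis_def)
  finally show ?thesis
    using t(1) by (auto simp: w)
qed

text \<open>For each \<open>i\<close> some \<open>j = \<rho> i\<close> has \<open>D\<^sub>i\<^sub>j B\<^sub>j\<^sub>i \<noteq> 0\<close>, because \<open>D B = 1\<close>. By the previous result row \<open>\<rho> i\<close> of \<open>B\<close> has no
  other nonzero entry, so \<open>\<rho>\<close> is injective and hence a permutation, and row \<open>i\<close> of \<open>D\<close> is zero outside \<open>\<rho> i\<close>.\<close>

lemma proj_line_power_automorphism_monomial: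
  fixes F G :: "proj_line ^ 'n::finite \<Rightarrow> proj_line ^ 'n"
  defines "P \<equiv> (mfd_power projective_line :: (proj_line ^ 'n, 'n) mfd)"
  assumes F: "mfd_automorphism P F G" and \<phi>: "\<phi> \<in> atlas P" "x \<in> fst \<phi>" and \<psi>: "\<psi> \<in> atlas P" "F x \<in> fst \<psi>"
    and D: "(snd \<psi> \<circ> F \<circ> chart_inv \<phi> has_derivative (*v) D) (at (snd \<phi> x))"
  shows "monomial_matrix D"
proof -
  have P: "charted P"
    unfolding P_def by (rule charted_mfd_power[OF charted_projective_line])
  obtain B where B: "(snd \<phi> \<circ> G \<circ> chart_inv \<psi> has_derivative (*v) B) (at (snd \<psi> (F x)))"
      "B ** D = mat 1" "D ** B = mat 1"
    using mfd_automorphism_derivative_inverse[OF P \<phi> \<psi> F D] by metis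
  have prod0: "D $ i $ j * B $ j $ k = 0" if "i \<noteq> k" for i j k
    using proj_line_power_automorphism_entries[OF F[unfolded P_def] \<phi>[unfolded P_def] \<psi>[unfolded P_def]
        D B(1,3) that] .
  have "(\<Sum>j\<in>UNIV. D $ i $ j * B $ j $ i) = 1" for i
    using B(3) by (simp add: vec_eq_iff matrix_matrix_mult_def mat_def)
  then have "\<exists>j. D $ i $ j * B $ j $ i \<noteq> 0" for i
    by (metis (no_types, lifting) sum.neutral zero_neq_one)
  then obtain \<rho> where \<rho>: "\<And>i. D $ i $ \<rho> i * B $ \<rho> i $ i \<noteq> 0"
    by metis
  have B0: "B $ \<rho> i $ k = 0" if "k \<noteq> i" for i k
    using prod0[of i k "\<rho> i"] \<rho>[of i] that by auto
  have "inj \<rho>"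
    by (rule injI) (metis B0 \<rho> mult_zero_right)
  then have surj: "surj \<rho>"
    by (simp add: finite_UNIV_inj_surj)
  have "j = \<rho> i" if "D $ i $ j \<noteq> 0" for i j
  proof (rule ccontr)
    assume "j \<noteq> \<rho> i"
    obtain i' where i': "j = \<rho> i'"
      using surj by (metis surjD)
    then have "i \<noteq> i'"
      using \<open>j \<noteq> \<rho> i\<close> by blast
    then have "D $ i $ j * B $ j $ i' = 0"
      by (rule prod0)
    then show False
      using that \<rho>[of i'] i' by simp
  qed
  moreover have "det D \<noteq> 0"
    using B(2) det_mul[of B D] by (metis det_I mult_zero_right zero_neq_one)
  ultimately show ?thesis
    unfolding monomial_matrix_def by blast
qed

section \<open>The tensor of an atlas with monomial transition derivatives\<close>

lemma holo_fun_subset: "holo_fun X W f \<Longrightarrow> V \<subseteq> W \<Longrightarrow> holo_fun X V f"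
  unfolding holo_fun_def holo_on_def by blast

lemma holo_fun_divide:
  assumes "holo_fun X W f" "holo_fun X W g" "\<And>x. x \<in> W \<Longrightarrow> g x \<noteq> 0" and X: "charted X"
  shows "holo_fun X W (\<lambda>x. f x / g x)"
  unfolding holo_fun_def
proof
  fix \<phi> assume \<phi>: "\<phi> \<in> atlas X"
  have "holo_on (\<lambda>z. (f \<circ> chart_inv \<phi>) z / (g \<circ> chart_inv \<phi>) z) (snd \<phi> ` (fst \<phi> \<inter> W))"
  proof (rule holo_on_divide)
    show "(g \<circ> chart_inv \<phi>) z \<noteq> 0" if "z \<in> snd \<phi> ` (fst \<phi> \<inter> W)" for z
      using that assms(3) chart_inv_left[OF X \<phi>] by auto
  qed (use assms(1,2) \<phi> in \<open>simp_all add: holo_fun_def o_def\<close>)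
  then show "holo_on ((\<lambda>x. f x / g x) \<circ> chart_inv \<phi>) (snd \<phi> ` (fst \<phi> \<inter> W))"
    by (simp add: o_def)
qed

lemma holo_fun_det:
  fixes A :: "'a::topological_space \<Rightarrow> complex ^ 'n::finite ^ 'n" and X :: "('a, 'k::finite) mfd"
  assumes "\<And>i j. holo_fun X W (\<lambda>x. A x $ i $ j)"
  shows "holo_fun X W (\<lambda>x. det (A x))"
  using assms unfolding holo_fun_def o_def by (intro ballI holo_on_det) blast

lemma holo_fun_prod_form_coeff:
  fixes A :: "'a::topological_space \<Rightarrow> complex ^ 'n::finite ^ 'n" and X :: "('a, 'k::finite) mfd"
  assumes "\<And>i j. holo_fun X W (\<lambda>x. A x $ i $ j)"
  shows "holo_fun X W (\<lambda>x. prod_form_coeff (A x) \<alpha>)"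
  using assms unfolding holo_fun_def o_def by (intro ballI holo_on_prod_form_coeff) blast

text \<open>Local coordinates \<open>\<zeta> a\<close> near every point \<open>a\<close>, which take the place of the product coordinates on the
  universal cover. They are determined up to changes with monomial derivative; the matrix of the change does not
  depend on the chart \<open>\<phi>\<close> in which derivatives are computed.\<close>

locale monomial_coordinates =
  fixes X :: "('a::topological_space, 'n::finite) mfd"
    and U :: "'a \<Rightarrow> 'a set" and \<zeta> :: "'a \<Rightarrow> 'a \<Rightarrow> complex ^ 'n"
  assumes X: "complex_manifold X"
    and open_U: "a \<in> points X \<Longrightarrow> openin (mtop X) (U a)"
    and mem_U: "a \<in> points X \<Longrightarrow> a \<in> U a"
    and coordinates: "\<lbrakk>a \<in> points X; \<phi> \<in> atlas X; x \<in> fst \<phi>; x \<in> U a\<rbrakk> \<Longrightarrow>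
      \<exists>A. (\<zeta> a \<circ> chart_inv \<phi> has_derivative (*v) A) (at (snd \<phi> x)) \<and> det A \<noteq> 0"
    and monomial: "\<lbrakk>a \<in> points X; b \<in> points X; x \<in> U a; x \<in> U b\<rbrakk> \<Longrightarrow>
      \<exists>N. monomial_matrix N \<and> (\<forall>\<phi>\<in>atlas X. x \<in> fst \<phi> \<longrightarrow>
        jacobian_at (\<zeta> a \<circ> chart_inv \<phi>) (snd \<phi> x) = N ** jacobian_at (\<zeta> b \<circ> chart_inv \<phi>) (snd \<phi> x))"
begin

text \<open>The matrix of the forms \<open>d\<zeta>\<^sub>i\<close> in the chart \<open>\<phi>\<close>.\<close>

definition coord_deriv where "coord_deriv a \<phi> x = jacobian_at (\<zeta> a \<circ> chart_inv \<phi>) (snd \<phi> x)"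

definition change_matrix where
  "change_matrix a b x = (SOME N. monomial_matrix N \<and> (\<forall>\<phi>\<in>atlas X. x \<in> fst \<phi> \<longrightarrow> coord_deriv a \<phi> x = N ** coord_deriv b \<phi> x))"

definition sgn_bundle :: "('a, 'a) line_bundle" where
  "sgn_bundle = \<lparr> lb_index = points X, lb_dom = U, lb_trans = (\<lambda>a b x. monomial_sign (change_matrix a b x)) \<rparr>"

text \<open>The section \<open>d\<zeta>\<^sub>1 \<cdots> d\<zeta>\<^sub>n / (d\<zeta>\<^sub>1 \<and> \<dots> \<and> d\<zeta>\<^sub>n)\<close>, where \<open>\<zeta> = \<zeta> a\<close>: the numerator is written in the chart \<open>\<phi>\<close>, and the
  denominator in the chart \<open>\<kappa>\<close> that trivialises \<open>\<O>(-K)\<close>, for the index \<open>i = (\<kappa>, a)\<close>.\<close>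

definition tensor :: "('a, 'n, ('a, 'n) chart \<times> 'a) sym_section" where
  "tensor \<phi> i x \<alpha> = prod_form_coeff (coord_deriv (snd i) \<phi> x) \<alpha> / det (coord_deriv (snd i) (fst i) x)"

lemma charted_X: "charted X"
  by (rule complex_manifold_charted[OF X])

lemma U_subset: "a \<in> points X \<Longrightarrow> U a \<subseteq> points X"
  using open_U openin_imp_subset by blast

lemma coord_deriv_properties:
  assumes "a \<in> points X" "\<phi> \<in> atlas X" "x \<in> fst \<phi>" "x \<in> U a"
  shows "(\<zeta> a \<circ> chart_inv \<phi> has_derivative (*v) (coord_deriv a \<phi> x)) (at (snd \<phi> x))" "det (coord_deriv a \<phi> x) \<noteq> 0"
proof -
  obtain A where "(\<zeta> a \<circ> chart_inv \<phi> has_derivative (*v) A) (at (snd \<phi> x))" "det A \<noteq> 0"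
    using coordinates[OF assms] by blast
  then show "(\<zeta> a \<circ> chart_inv \<phi> has_derivative (*v) (coord_deriv a \<phi> x)) (at (snd \<phi> x))" "det (coord_deriv a \<phi> x) \<noteq> 0"
    by (simp_all add: coord_deriv_def jacobian_at_eq)
qed

lemma coord_deriv_transition:
  assumes a: "a \<in> points X" "x \<in> U a" and \<phi>: "\<phi> \<in> atlas X" "x \<in> fst \<phi>" and \<psi>: "\<psi> \<in> atlas X" "x \<in> fst \<psi>"
  shows "coord_deriv a \<phi> x = coord_deriv a \<psi> x ** jacobian_at (transition \<phi> \<psi>) (snd \<phi> x)"
proof -
  have id: "mdiff_at X X (\<lambda>x. x) x"
    by (rule complex_manifold_mdiff_id[OF X])
  obtain D where D: "(snd \<psi> \<circ> (\<lambda>x. x) \<circ> chart_inv \<phi> has_derivative (*v) D) (at (snd \<phi> x))"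
    by (rule mdiff_atD2[OF id \<phi>(1) \<psi>(1) \<phi>(2) \<psi>(2)])
  then have "jacobian_at (transition \<phi> \<psi>) (snd \<phi> x) = D"
    by (intro jacobian_at_eq) (simp add: transition_def o_def)
  moreover have "(\<zeta> a \<circ> ((\<lambda>x. x) \<circ> (\<lambda>x. x)) \<circ> chart_inv \<phi> has_derivative (*v) (coord_deriv a \<psi> x ** D)) (at (snd \<phi> x))"
    using coord_deriv_properties(1)[OF a(1) \<psi> a(2)] by (intro has_derivative_chart_compose[OF charted_X \<phi> charted_X \<psi> id D]) (simp add: o_def)
  then have "(\<zeta> a \<circ> chart_inv \<phi> has_derivative (*v) (coord_deriv a \<psi> x ** D)) (at (snd \<phi> x))"
    by (simp add: o_def)
  ultimately show ?thesis
    unfolding coord_deriv_def[of a \<phi>] by (simp add: jacobian_at_eq)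
qed

lemma change_matrix_props:
  assumes "a \<in> points X" "b \<in> points X" "x \<in> U a" "x \<in> U b"
  shows "monomial_matrix (change_matrix a b x)"
    and "\<phi> \<in> atlas X \<Longrightarrow> x \<in> fst \<phi> \<Longrightarrow> coord_deriv a \<phi> x = change_matrix a b x ** coord_deriv b \<phi> x"
proof -
  have "\<exists>N. monomial_matrix N \<and> (\<forall>\<phi>\<in>atlas X. x \<in> fst \<phi> \<longrightarrow> coord_deriv a \<phi> x = N ** coord_deriv b \<phi> x)"
    unfolding coord_deriv_def by (rule monomial[OF assms])
  from someI_ex[OF this]
  have *: "monomial_matrix (change_matrix a b x) \<and> (\<forall>\<phi>\<in>atlas X. x \<in> fst \<phi> \<longrightarrow> coord_deriv a \<phi> x = change_matrix a b x ** coord_deriv b \<phi> x)"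
    unfolding change_matrix_def .
  then show "monomial_matrix (change_matrix a b x)"
    by blast
  show "\<phi> \<in> atlas X \<Longrightarrow> x \<in> fst \<phi> \<Longrightarrow> coord_deriv a \<phi> x = change_matrix a b x ** coord_deriv b \<phi> x"
    using * by blast
qed

lemma change_matrix_cocycle:
  assumes "a \<in> points X" "b \<in> points X" "c \<in> points X" "x \<in> U a" "x \<in> U b" "x \<in> U c"
  shows "change_matrix a b x ** change_matrix b c x = change_matrix a c x"
proof -
  obtain \<phi> where \<phi>: "\<phi> \<in> atlas X" "x \<in> fst \<phi>"
    using charted_obtain_chart[OF charted_X] assms U_subset by blast
  have "invertible (coord_deriv c \<phi> x)"
    using coord_deriv_properties(2) \<phi> assms by (simp add: invertible_det_nz)
  then obtain K where K: "coord_deriv c \<phi> x ** K = mat 1"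
    by (auto simp: invertible_def)
  have "(change_matrix a b x ** change_matrix b c x) ** coord_deriv c \<phi> x = change_matrix a c x ** coord_deriv c \<phi> x"
    using change_matrix_props(2)[of a b x \<phi>] change_matrix_props(2)[of b c x \<phi>] change_matrix_props(2)[of a c x \<phi>] assms \<phi>
    by (simp add: matrix_mul_assoc[symmetric])
  then have "(change_matrix a b x ** change_matrix b c x) ** (coord_deriv c \<phi> x ** K) = change_matrix a c x ** (coord_deriv c \<phi> x ** K)"
    by (simp add: matrix_mul_assoc)
  then show ?thesis
    by (simp add: K)
qed

lemma sign_cocycle:
  assumes "a \<in> points X" "b \<in> points X" "c \<in> points X" "x \<in> U a" "x \<in> U b" "x \<in> U c"
  shows "monomial_sign (change_matrix a b x) * monomial_sign (change_matrix b c x) = monomial_sign (change_matrix a c x)"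
  using monomial_sign_mult[OF change_matrix_props(1) change_matrix_props(1), of a b x b c x] change_matrix_cocycle[OF assms] assms by simp

lemma sign_square:
  assumes "a \<in> points X" "b \<in> points X" "x \<in> U a" "x \<in> U b"
  shows "monomial_sign (change_matrix a b x) * monomial_sign (change_matrix a b x) = 1"
  by (rule monomial_sign_square[OF change_matrix_props(1)[OF assms]])

lemma sign_symmetric:
  assumes "a \<in> points X" "b \<in> points X" "x \<in> U a" "x \<in> U b"
  shows "monomial_sign (change_matrix b a x) = monomial_sign (change_matrix a b x)"
proof -
  have sq: "monomial_sign (change_matrix a b x) * monomial_sign (change_matrix a b x) = 1" "monomial_sign (change_matrix a a x) * monomial_sign (change_matrix a a x) = 1"
    using sign_square assms by blast+
  moreover have "monomial_sign (change_matrix a a x) * monomial_sign (change_matrix a a x) = monomial_sign (change_matrix a a x)"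
    using sign_cocycle[of a a a x] assms by simp
  moreover have "monomial_sign (change_matrix a b x) * monomial_sign (change_matrix b a x) = monomial_sign (change_matrix a a x)"
    using sign_cocycle[of a b a x] assms by simp
  ultimately have "monomial_sign (change_matrix a b x) * monomial_sign (change_matrix b a x) = monomial_sign (change_matrix a b x) * monomial_sign (change_matrix a b x)"
    by simp
  then show ?thesis
    using sq(1) by (metis mult_cancel_left mult_zero_left zero_neq_one)
qed

lemma holo_fun_coord_deriv:
  assumes a: "a \<in> points X" and \<phi>: "\<phi> \<in> atlas X"
  shows "holo_fun X (fst \<phi> \<inter> U a) (\<lambda>x. coord_deriv a \<phi> x $ i $ j)"
  unfolding holo_fun_def
proof
  fix \<kappa> assume \<kappa>: "\<kappa> \<in> atlas X"
  have "holo_vec_on (\<zeta> a \<circ> chart_inv \<phi>) (snd \<phi> ` (fst \<phi> \<inter> U a))"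
    unfolding holo_vec_on_iff using coord_deriv_properties(1)[OF a \<phi>] by auto
  then have "holo_on (\<lambda>z. jacobian_at (\<zeta> a \<circ> chart_inv \<phi>) z $ i $ j) (snd \<phi> ` (fst \<phi> \<inter> U a))"
    by (rule holo_on_jacobian_entry) (rule chart_image_open[OF charted_X \<phi> open_U[OF a]])
  moreover have "holo_vec_on (transition \<kappa> \<phi>) (snd \<kappa> ` (fst \<kappa> \<inter> fst \<phi>))"
    using X \<kappa> \<phi> by (simp add: complex_manifold_def)
  then have "holo_vec_on (transition \<kappa> \<phi>) (snd \<kappa> ` (fst \<kappa> \<inter> (fst \<phi> \<inter> U a)))"
    unfolding holo_vec_on_iff by blast
  moreover have "transition \<kappa> \<phi> ` snd \<kappa> ` (fst \<kappa> \<inter> (fst \<phi> \<inter> U a)) \<subseteq> snd \<phi> ` (fst \<phi> \<inter> U a)"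
    using chart_inv_left[OF charted_X \<kappa>] by (auto simp: transition_def)
  ultimately have "holo_on ((\<lambda>z. jacobian_at (\<zeta> a \<circ> chart_inv \<phi>) z $ i $ j) \<circ> transition \<kappa> \<phi>)
      (snd \<kappa> ` (fst \<kappa> \<inter> (fst \<phi> \<inter> U a)))"
    by (rule holo_on_compose)
  then show "holo_on ((\<lambda>x. coord_deriv a \<phi> x $ i $ j) \<circ> chart_inv \<kappa>) (snd \<kappa> ` (fst \<kappa> \<inter> (fst \<phi> \<inter> U a)))"
    by (simp add: coord_deriv_def o_def transition_def)
qed

text \<open>The matrix of the change of coordinates is known only pointwise, so holomorphy of its sign has to come from
  a formula in the \<open>d\<zeta>\<^sub>i\<close>: evaluate the forms \<open>\<Prod>\<^sub>i d\<zeta>\<^sub>i\<close> of both coordinate systems on a fixed tangent vector and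
  divide by the two determinants.\<close>

lemma holo_fun_sign:
  assumes a: "a \<in> points X" and b: "b \<in> points X"
  shows "holo_fun X (U a \<inter> U b) (\<lambda>x. monomial_sign (change_matrix a b x))"
  unfolding holo_fun_def
proof
  fix \<kappa> assume \<kappa>: "\<kappa> \<in> atlas X"
  let ?S = "snd \<kappa> ` (fst \<kappa> \<inter> (U a \<inter> U b))"
  let ?Ja = "\<lambda>z. coord_deriv a \<kappa> (chart_inv \<kappa> z)" and ?Jb = "\<lambda>z. coord_deriv b \<kappa> (chart_inv \<kappa> z)"
  have in_S: "chart_inv \<kappa> z \<in> fst \<kappa> \<and> chart_inv \<kappa> z \<in> U a \<and> chart_inv \<kappa> z \<in> U b" if "z \<in> ?S" for z
    using that chart_inv_left[OF charted_X \<kappa>] by auto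
  have open_S: "open ?S"
    using open_U a b by (intro chart_image_open[OF charted_X \<kappa>] openin_Int) auto
  have Ja: "holo_on (\<lambda>z. ?Ja z $ i $ j) ?S" and Jb: "holo_on (\<lambda>z. ?Jb z $ i $ j) ?S" for i j
  proof -
    have "holo_fun X (fst \<kappa> \<inter> (U a \<inter> U b)) (\<lambda>x. coord_deriv a \<kappa> x $ i $ j)"
      by (rule holo_fun_subset[OF holo_fun_coord_deriv[OF a \<kappa>]]) blast
    from bspec[OF this[unfolded holo_fun_def] \<kappa>] show "holo_on (\<lambda>z. ?Ja z $ i $ j) ?S"
      by (simp add: o_def Int_left_absorb)
    have "holo_fun X (fst \<kappa> \<inter> (U a \<inter> U b)) (\<lambda>x. coord_deriv b \<kappa> x $ i $ j)"
      by (rule holo_fun_subset[OF holo_fun_coord_deriv[OF b \<kappa>]]) blast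
    from bspec[OF this[unfolded holo_fun_def] \<kappa>] show "holo_on (\<lambda>z. ?Jb z $ i $ j) ?S"
      by (simp add: o_def Int_left_absorb)
  qed
  show "holo_on ((\<lambda>x. monomial_sign (change_matrix a b x)) \<circ> chart_inv \<kappa>) ?S"
  proof (rule holo_on_locally)
    fix z0 assume z0: "z0 \<in> ?S"
    obtain v where v: "(\<Prod>i\<in>UNIV. (?Jb z0 *v v) $ i) = 1"
      using invertible_prod_form_nonzero[OF coord_deriv_properties(2)[OF b \<kappa>], of "chart_inv \<kappa> z0"] in_S[OF z0] by blast
    define P where "P z = (\<Prod>i\<in>UNIV. (?Jb z *v v) $ i)" for z
    have P1: "P z0 = 1"
      using v by (simp only: P_def)
    define g where "g z = (\<Prod>i\<in>UNIV. (?Ja z *v v) $ i) * det (?Jb z) / (det (?Ja z) * P z)" for z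
    let ?T = "{z \<in> ?S. P z \<noteq> 0}"
    have holo_P: "holo_on P ?S"
      unfolding P_def by (intro holo_on_prod holo_on_matrix_vector_mult Jb)
    have sub: "holo_on f ?T" if "holo_on f ?S" for f
      using that unfolding holo_on_def by blast
    have "holo_on g ?T"
      unfolding g_def
    proof (rule holo_on_divide)
      show "holo_on (\<lambda>z. (\<Prod>i\<in>UNIV. (?Ja z *v v) $ i) * det (?Jb z)) ?T"
        by (intro sub holo_on_mult holo_on_prod holo_on_matrix_vector_mult holo_on_det Ja Jb)
      show "holo_on (\<lambda>z. det (?Ja z) * P z) ?T"
        by (intro sub holo_on_mult holo_on_det Ja holo_P)
      show "det (?Ja z) * P z \<noteq> 0" if "z \<in> ?T" for z
        using coord_deriv_properties(2)[OF a \<kappa>, of "chart_inv \<kappa> z"] in_S[of z] that by auto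
    qed
    moreover have "z0 \<in> ?T"
      using z0 P1 by simp
    moreover have "\<forall>\<^sub>F z in nhds z0. ((\<lambda>x. monomial_sign (change_matrix a b x)) \<circ> chart_inv \<kappa>) z = g z"
    proof -
      have "isCont P z0"
        using holo_on_has_derivative_partial[OF holo_P z0] has_derivative_continuous by blast
      then have "\<forall>\<^sub>F z in at z0. P z \<noteq> 0"
        unfolding isCont_def by (rule tendsto_imp_eventually_ne) (simp add: P1)
      then have "\<forall>\<^sub>F z in nhds z0. P z \<noteq> 0"
        by (simp add: eventually_nhds_conv_at P1)
      moreover have "\<forall>\<^sub>F z in nhds z0. z \<in> ?S"
        using open_S z0 by (rule eventually_nhds_in_open)
      ultimately show ?thesis
      proof eventually_elim
        case (elim z)
        let ?N = "change_matrix a b (chart_inv \<kappa> z)"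
        have mono: "monomial_matrix ?N" and Nz: "?Ja z = ?N ** ?Jb z"
          using change_matrix_props[OF a b, of "chart_inv \<kappa> z"] in_S[OF elim(2)] \<kappa> by blast+
        have "(\<Prod>i\<in>UNIV. (?Ja z *v v) $ i) = monomial_sign ?N * det ?N * P z"
          using prod_monomial_matrix[OF mono, of "?Jb z *v v"]
          by (simp add: P_def Nz matrix_vector_mul_assoc)
        moreover have "det (?Jb z) \<noteq> 0" "det (?Ja z) \<noteq> 0"
          using coord_deriv_properties(2)[OF b \<kappa>] coord_deriv_properties(2)[OF a \<kappa>] in_S[OF elim(2)] by blast+
        ultimately show ?case
          using elim(1) Nz by (simp add: g_def det_mul)
      qed
    qed
    ultimately show "\<exists>g T. holo_on g T \<and> z0 \<in> T \<and>
        (\<forall>\<^sub>F z in nhds z0. ((\<lambda>x. monomial_sign (change_matrix a b x)) \<circ> chart_inv \<kappa>) z = g z)"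
      by blast
  qed
qed

lemma holo_line_bundle_sgn: "holo_line_bundle X sgn_bundle"
  unfolding holo_line_bundle_def sgn_bundle_def line_bundle.select_convs
proof (intro conjI ballI)
  show "(\<Union>a\<in>points X. U a) = points X"
    using U_subset mem_U by blast
  fix a b x assume "a \<in> points X" "b \<in> points X" "x \<in> U a \<inter> U b"
  then show "monomial_sign (change_matrix a b x) \<noteq> 0"
    using sign_square[of a b x] by auto
next
  fix a b c x assume "a \<in> points X" "b \<in> points X" "c \<in> points X" "x \<in> U a \<inter> U b \<inter> U c"
  then show "monomial_sign (change_matrix a b x) * monomial_sign (change_matrix b c x) = monomial_sign (change_matrix a c x)"
    by (intro sign_cocycle) auto
qed (use open_U holo_fun_sign in auto)

text \<open>The expression of a section of the square for the index \<open>(a, b)\<close>, multiplied by the sign of the change from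
  \<open>b\<close> to \<open>a\<close>, does not depend on \<open>a\<close> and \<open>b\<close>, because signs are their own inverses.\<close>

lemma sgn_bundle_square_trivial: "lb_iso X (lb_tensor sgn_bundle sgn_bundle) (lb_trivial X)"
  unfolding lb_iso_def
proof (intro exI[of _ "\<lambda>(a, b) _ x. monomial_sign (change_matrix a b x)"] conjI ballI)
  fix i j assume "i \<in> lb_index (lb_tensor sgn_bundle sgn_bundle)"
  then obtain a b where i: "i = (a, b)" "a \<in> points X" "b \<in> points X"
    by (auto simp: lb_tensor_def sgn_bundle_def)
  have dom: "lb_dom (lb_tensor sgn_bundle sgn_bundle) i \<inter> lb_dom (lb_trivial X) j = U a \<inter> U b"
    using U_subset i by (auto simp: lb_tensor_def sgn_bundle_def lb_trivial_def)
  show "holo_fun X (lb_dom (lb_tensor sgn_bundle sgn_bundle) i \<inter> lb_dom (lb_trivial X) j)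
      ((case i of (a, b) \<Rightarrow> \<lambda>_ x. monomial_sign (change_matrix a b x)) j)"
    unfolding dom using holo_fun_sign i by simp
  show "(case i of (a, b) \<Rightarrow> \<lambda>_ x. monomial_sign (change_matrix a b x)) j x \<noteq> 0"
    if "x \<in> lb_dom (lb_tensor sgn_bundle sgn_bundle) i \<inter> lb_dom (lb_trivial X) j" for x
    using that sign_square[of a b x] i unfolding dom by auto
next
  fix i i' j j' x
  assume "i \<in> lb_index (lb_tensor sgn_bundle sgn_bundle)" "i' \<in> lb_index (lb_tensor sgn_bundle sgn_bundle)"
    and x: "x \<in> lb_dom (lb_tensor sgn_bundle sgn_bundle) i \<inter> lb_dom (lb_tensor sgn_bundle sgn_bundle) i' \<inter>
      lb_dom (lb_trivial X) j \<inter> lb_dom (lb_trivial X) j'"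
  then obtain a b a' b' where i: "i = (a, b)" "i' = (a', b')"
    and pts: "a \<in> points X" "b \<in> points X" "a' \<in> points X" "b' \<in> points X"
    by (auto simp: lb_tensor_def sgn_bundle_def)
  have U: "x \<in> U a" "x \<in> U b" "x \<in> U a'" "x \<in> U b'"
    using x by (auto simp: i lb_tensor_def sgn_bundle_def)
  have "monomial_sign (change_matrix a' b' x) = monomial_sign (change_matrix a' a x) * (monomial_sign (change_matrix a b x) * monomial_sign (change_matrix b b' x))"
    using sign_cocycle[of a b b' x] sign_cocycle[of a' a b' x] pts U by simp
  also have "monomial_sign (change_matrix a' a x) = monomial_sign (change_matrix a a' x)"
    by (rule sign_symmetric) (use pts U in auto)
  finally show "(case i of (a, b) \<Rightarrow> \<lambda>_ x. monomial_sign (change_matrix a b x)) j x * lb_trans (lb_tensor sgn_bundle sgn_bundle) i i' x =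
      lb_trans (lb_trivial X) j j' x * (case i' of (a, b) \<Rightarrow> \<lambda>_ x. monomial_sign (change_matrix a b x)) j' x"
    by (simp add: i lb_tensor_def sgn_bundle_def lb_trivial_def mult_ac)
qed

lemma sym_eval_tensor:
  "sym_eval CARD('n) (tensor \<phi> (\<kappa>, a) x) v = (\<Prod>i\<in>UNIV. (coord_deriv a \<phi> x *v v) $ i) / det (coord_deriv a \<kappa> x)"
proof -
  have "tensor \<phi> (\<kappa>, a) x = (\<lambda>\<alpha>. (1 / det (coord_deriv a \<kappa> x)) * prod_form_coeff (coord_deriv a \<phi> x) \<alpha>)"
    by (simp add: fun_eq_iff tensor_def)
  then show ?thesis
    using sym_eval_cmult[of "CARD('n)" "1 / det (coord_deriv a \<kappa> x)" "prod_form_coeff (coord_deriv a \<phi> x)" v]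
    by (simp add: sym_eval_prod_form_coeff)
qed

text \<open>Changing the chart replaces \<open>v\<close> by its image and multiplies the denominator by the Jacobian determinant.
  Changing the coordinates \<open>\<zeta>\<close> multiplies numerator and denominator by the determinant of the change of
  coordinates, and the numerator by the sign in addition.\<close>

lemma tensor_transition:
  assumes a: "a \<in> points X" "x \<in> U a" and b: "b \<in> points X" "x \<in> U b"
    and \<phi>: "\<phi> \<in> atlas X" "x \<in> fst \<phi>" and \<psi>: "\<psi> \<in> atlas X" "x \<in> fst \<psi>"
    and \<kappa>: "\<kappa> \<in> atlas X" "x \<in> fst \<kappa>" and \<kappa>': "\<kappa>' \<in> atlas X" "x \<in> fst \<kappa>'"
  shows "sym_eval CARD('n) (tensor \<phi> (\<kappa>, a) x) v =
    inverse (det (jacobian_at (transition \<kappa> \<kappa>') (snd \<kappa> x))) * monomial_sign (change_matrix a b x) *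
    sym_eval CARD('n) (tensor \<psi> (\<kappa>', b) x) (jacobian_at (transition \<phi> \<psi>) (snd \<phi> x) *v v)"
proof -
  let ?N = "change_matrix a b x"
  have mono: "monomial_matrix ?N"
    by (rule change_matrix_props(1)[OF a(1) b(1) a(2) b(2)])
  then have N0: "det ?N \<noteq> 0"
    by (simp add: monomial_matrix_def)
  have N\<phi>: "coord_deriv a \<phi> x = ?N ** coord_deriv b \<phi> x" and N\<kappa>: "coord_deriv a \<kappa> x = ?N ** coord_deriv b \<kappa> x"
    using change_matrix_props(2)[OF a(1) b(1) a(2) b(2)] \<phi> \<kappa> by blast+
  have "(\<Prod>i\<in>UNIV. (coord_deriv a \<phi> x *v v) $ i) = monomial_sign ?N * det ?N * (\<Prod>i\<in>UNIV. (coord_deriv b \<phi> x *v v) $ i)"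
    using prod_monomial_matrix[OF mono, of "coord_deriv b \<phi> x *v v"] by (simp add: N\<phi> matrix_vector_mul_assoc)
  then have "sym_eval CARD('n) (tensor \<phi> (\<kappa>, a) x) v =
      monomial_sign ?N * (\<Prod>i\<in>UNIV. (coord_deriv b \<phi> x *v v) $ i) / det (coord_deriv b \<kappa> x)"
    using N0 by (simp add: sym_eval_tensor N\<kappa> det_mul)
  also have "coord_deriv b \<phi> x *v v = coord_deriv b \<psi> x *v (jacobian_at (transition \<phi> \<psi>) (snd \<phi> x) *v v)"
    by (simp add: coord_deriv_transition[OF b \<phi> \<psi>] matrix_vector_mul_assoc)
  also have "det (coord_deriv b \<kappa> x) = det (coord_deriv b \<kappa>' x) * det (jacobian_at (transition \<kappa> \<kappa>') (snd \<kappa> x))"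
    by (simp add: coord_deriv_transition[OF b \<kappa> \<kappa>'] det_mul)
  finally show ?thesis
    by (simp add: sym_eval_tensor divide_inverse inverse_mult_distrib mult_ac)
qed

proposition semi_special_tensor: "semi_special_tensor X sgn_bundle tensor"
proof -
  let ?L = "lb_tensor (lb_dual (canonical_bundle X)) sgn_bundle"
  have index: "lb_index ?L = atlas X \<times> points X"
    by (simp add: lb_tensor_def lb_dual_def canonical_bundle_def sgn_bundle_def)
  have dom: "lb_dom ?L (\<kappa>, a) = fst \<kappa> \<inter> U a" for \<kappa> a
    by (simp add: lb_tensor_def lb_dual_def canonical_bundle_def sgn_bundle_def)
  have trans: "lb_trans ?L (\<kappa>, a) (\<kappa>', b) x =
      inverse (det (jacobian_at (transition \<kappa> \<kappa>') (snd \<kappa> x))) * monomial_sign (change_matrix a b x)" for \<kappa> \<kappa>' a b x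
    by (simp add: lb_tensor_def lb_dual_def canonical_bundle_def sgn_bundle_def)
  have "sym_diff_section CARD('n) X ?L tensor"
    unfolding sym_diff_section_def index
  proof (intro conjI ballI allI)
    fix \<phi> i and \<alpha> :: "'n \<Rightarrow> nat" assume \<phi>: "\<phi> \<in> atlas X" and "i \<in> atlas X \<times> points X"
    then obtain \<kappa> a where i: "i = (\<kappa>, a)" and \<kappa>: "\<kappa> \<in> atlas X" and a: "a \<in> points X"
      by blast
    have J\<phi>: "holo_fun X (fst \<phi> \<inter> (fst \<kappa> \<inter> U a)) (\<lambda>x. coord_deriv a \<phi> x $ k $ l)"
      and J\<kappa>: "holo_fun X (fst \<phi> \<inter> (fst \<kappa> \<inter> U a)) (\<lambda>x. coord_deriv a \<kappa> x $ k $ l)" for k l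
      by (rule holo_fun_subset[OF holo_fun_coord_deriv[OF a \<phi>]], blast, rule holo_fun_subset[OF holo_fun_coord_deriv[OF a \<kappa>]], blast)
    have "holo_fun X (fst \<phi> \<inter> (fst \<kappa> \<inter> U a)) (\<lambda>x. prod_form_coeff (coord_deriv a \<phi> x) \<alpha> / det (coord_deriv a \<kappa> x))"
      by (rule holo_fun_divide[OF holo_fun_prod_form_coeff[OF J\<phi>] holo_fun_det[OF J\<kappa>] _ charted_X])
         (use coord_deriv_properties(2)[OF a \<kappa>] in blast)
    then show "holo_fun X (fst \<phi> \<inter> lb_dom ?L i) (\<lambda>x. tensor \<phi> i x \<alpha>)"
      by (simp add: i dom tensor_def)
  next
    fix \<phi> \<psi> i j x v
    assume \<phi>: "\<phi> \<in> atlas X" and \<psi>: "\<psi> \<in> atlas X" and "i \<in> atlas X \<times> points X" "j \<in> atlas X \<times> points X"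
      and x: "x \<in> fst \<phi> \<inter> fst \<psi> \<inter> lb_dom ?L i \<inter> lb_dom ?L j"
    then obtain \<kappa> a \<kappa>' b where i: "i = (\<kappa>, a)" "j = (\<kappa>', b)"
      and \<kappa>: "\<kappa> \<in> atlas X" "a \<in> points X" "\<kappa>' \<in> atlas X" "b \<in> points X"
      by blast
    show "sym_eval CARD('n) (tensor \<phi> i x) v =
        lb_trans ?L i j x * sym_eval CARD('n) (tensor \<psi> j x) (jacobian_at (transition \<phi> \<psi>) (snd \<phi> x) *v v)"
      unfolding i trans
      by (rule tensor_transition) (use x \<phi> \<psi> \<kappa> in \<open>auto simp: i dom\<close>)
  qed
  moreover have "sym_nonzero CARD('n) X ?L tensor"
  proof -
    obtain x where x: "x \<in> points X"
      using X by (auto simp: complex_manifold_def)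
    obtain \<phi> where \<phi>: "\<phi> \<in> atlas X" "x \<in> fst \<phi>"
      using charted_obtain_chart[OF charted_X x] .
    have det: "det (coord_deriv x \<phi> x) \<noteq> 0"
      by (rule coord_deriv_properties(2)[OF x \<phi> mem_U[OF x]])
    obtain v where "(\<Prod>i\<in>UNIV. (coord_deriv x \<phi> x *v v) $ i) = 1"
      using invertible_prod_form_nonzero[OF det] .
    then have "sym_eval CARD('n) (tensor \<phi> (\<phi>, x) x) v \<noteq> 0"
      using det by (simp add: sym_eval_tensor)
    then have "\<exists>\<alpha>\<in>multi_indices CARD('n). tensor \<phi> (\<phi>, x) x \<alpha> \<noteq> 0"
      unfolding sym_eval_def by (metis (no_types, lifting) mult_zero_left sum.neutral)
    then show ?thesis
      unfolding sym_nonzero_def index using \<phi> x mem_U[OF x]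
      by (intro bexI[of _ \<phi>] bexI[of _ "(\<phi>, x)"] bexI[of _ x]) (simp_all add: dom)
  qed
  ultimately show ?thesis
    using holo_line_bundle_sgn sgn_bundle_square_trivial by (simp add: semi_special_tensor_def)
qed

end

section \<open>Descent from the universal cover\<close>

lemma charted_path_connected_neighbourhood:
  assumes Y: "charted Y" and W: "openin (mtop Y) W" "y \<in> W"
  shows "\<exists>N. openin (mtop Y) N \<and> y \<in> N \<and> N \<subseteq> W \<and> path_connected N"
proof -
  have "y \<in> points Y"
    using W openin_imp_subset by blast
  then obtain \<phi> where \<phi>: "\<phi> \<in> atlas Y" "y \<in> fst \<phi>"
    using charted_obtain_chart[OF Y] by blast
  note hom = chartedD(3)[OF Y \<phi>(1)]
  have "snd \<phi> y \<in> snd \<phi> ` (fst \<phi> \<inter> W)"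
    using \<phi>(2) W(2) by blast
  then obtain \<epsilon> where \<epsilon>: "\<epsilon> > 0" "ball (snd \<phi> y) \<epsilon> \<subseteq> snd \<phi> ` (fst \<phi> \<inter> W)"
    using chart_image_open[OF Y \<phi>(1) W(1)] open_contains_ball by blast
  let ?B = "ball (snd \<phi> y) \<epsilon>" and ?N = "fst \<phi> \<inter> snd \<phi> -` ball (snd \<phi> y) \<epsilon>"
  have N_eq: "?N = chart_inv \<phi> ` ?B"
  proof (intro equalityI subsetI)
    fix x assume "x \<in> ?N"
    then show "x \<in> chart_inv \<phi> ` ?B"
      using chart_inv_left[OF Y \<phi>(1), of x] by (intro image_eqI[of _ _ "snd \<phi> x"]) auto
  next
    fix x assume "x \<in> chart_inv \<phi> ` ?B"
    then obtain z where z: "x = chart_inv \<phi> z" "z \<in> ?B"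
      by blast
    then obtain x' where "x' \<in> fst \<phi>" "z = snd \<phi> x'"
      using \<epsilon>(2) by blast
    then show "x \<in> ?N"
      using z chart_inv_left[OF Y \<phi>(1)] by simp
  qed
  have "openin (top_of_set (fst \<phi>)) ?N"
    by (rule continuous_openin_preimage_gen[OF homeomorphism_cont1[OF hom] open_ball])
  then have "openin (mtop Y) ?N"
    using chartedD(1)[OF Y \<phi>(1)] by (rule openin_trans)
  moreover have "y \<in> ?N"
    using \<phi>(2) \<epsilon>(1) by simp
  moreover have "?N \<subseteq> W"
    using \<epsilon>(2) chart_inv_left[OF Y \<phi>(1)] unfolding N_eq by force
  moreover have "path_connected ?N"
    unfolding N_eq
  proof (rule path_connected_continuous_image)
    show "continuous_on ?B (chart_inv \<phi>)"
      using \<epsilon>(2) by (intro continuous_on_subset[OF homeomorphism_cont2[OF hom]]) blast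
    show "path_connected ?B"
      by (intro convex_imp_path_connected convex_ball)
  qed
  ultimately show ?thesis
    by blast
qed

text \<open>Near \<open>y\<close> the map \<open>h\<close> is \<open>p\<close> followed by the holomorphic local inverse of \<open>p\<close> near \<open>h y\<close>.\<close>

lemma covering_lift_mdiff:
  assumes p: "locally_biholo_map Y X p" and Y: "charted Y" and X: "charted X"
    and h: "continuous_on (points Y) h" "h ` points Y \<subseteq> points Y" "\<And>y. y \<in> points Y \<Longrightarrow> p (h y) = p y"
    and pX: "\<And>y. y \<in> points Y \<Longrightarrow> p y \<in> points X" and y: "y \<in> points Y"
  shows "mdiff_at Y Y h y"
proof -
  have "h y \<in> points Y"
    using h(2) y by blast
  from locally_biholo_local_inverse[OF p Y X this]
  obtain W g where W: "h y \<in> W" "openin (mtop Y) W" and g: "\<And>w. w \<in> W \<Longrightarrow> g (p w) = w"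
    "\<And>x. x \<in> p ` W \<Longrightarrow> mdiff_at X Y g x"
    by metis
  from locally_biholo_local_inverse[OF p Y X y] have py: "mdiff_at Y X p y"
    by metis
  have "mdiff_at X Y g (p y)"
    using g(2) W(1) h(3)[OF y] by (metis imageI)
  then have gp: "mdiff_at Y Y (g \<circ> p) y"
    by (rule mdiff_at_compose[OF Y X pX[OF y] py])
  show ?thesis
  proof (rule mdiff_at_cong[OF Y gp])
    have "h \<in> points Y \<rightarrow> points Y"
      using h(2) by blast
    then show "openin (mtop Y) (points Y \<inter> h -` W)"
      by (rule continuous_openin_preimage[OF h(1) _ W(2)])
    show "y \<in> points Y \<inter> h -` W"
      using y W(1) by simp
    show "(g \<circ> p) y' = h y'" if "y' \<in> points Y \<inter> h -` W" for y'
      using g(1)[of "h y'"] h(3)[of y'] that by simp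
  qed
qed

text \<open>The infinitesimal form of the statement that automorphisms only permute the factors of the product and act on
  each factor separately.\<close>

definition rigid_coordinates :: "('a::topological_space, 'n::finite) mfd \<Rightarrow> bool" where
  "rigid_coordinates Z \<longleftrightarrow> charted Z \<and>
     (\<forall>F G \<phi> \<psi> x D. mfd_automorphism Z F G \<longrightarrow> \<phi> \<in> atlas Z \<longrightarrow> x \<in> fst \<phi> \<longrightarrow> \<psi> \<in> atlas Z \<longrightarrow> F x \<in> fst \<psi> \<longrightarrow>
        (snd \<psi> \<circ> F \<circ> chart_inv \<phi> has_derivative (*v) D) (at (snd \<phi> x)) \<longrightarrow> monomial_matrix D)"

lemma rigid_projective_line_power: "rigid_coordinates (mfd_power projective_line :: (proj_line ^ 'n::finite, 'n) mfd)"
  unfolding rigid_coordinates_def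
  using charted_mfd_power[OF charted_projective_line] proj_line_power_automorphism_monomial by blast

lemma rigid_half_plane_power: "rigid_coordinates (mfd_power upper_half_plane :: (complex ^ 'n::finite, 'n) mfd)"
  unfolding rigid_coordinates_def
  using charted_mfd_power[OF charted_upper_half_plane] half_plane_power_automorphism_monomial by blast

text \<open>A local section of the covering, given by an open set \<open>U\<close> of the base and the section \<open>g\<close> on \<open>U\<close>,
  with values in the sheet \<open>W\<close> and, in the model \<open>Z\<close>, in the domain of the chart \<open>c\<close>.\<close>

definition local_section ::
    "('a::topological_space, 'n::finite) mfd \<Rightarrow> ('b::topological_space, 'n) mfd \<Rightarrow> ('c::topological_space, 'n) mfd \<Rightarrow>
     ('b \<Rightarrow> 'a) \<Rightarrow> ('b \<Rightarrow> 'c) \<Rightarrow> 'a set \<Rightarrow> ('a \<Rightarrow> 'b) \<Rightarrow> ('c, 'n) chart \<Rightarrow> 'b set \<Rightarrow> bool" where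
  "local_section X Y Z p f U g c W \<longleftrightarrow>
     openin (mtop X) U \<and> openin (mtop Y) W \<and> c \<in> atlas Z \<and> (\<forall>w\<in>W. g (p w) = w) \<and>
     (\<forall>x\<in>U. g x \<in> W \<and> p (g x) = x \<and> mdiff_at X Y g x \<and> f (g x) \<in> fst c)"

lemma local_section_exists:
  assumes p: "locally_biholo_map Y X p" and Y: "charted Y" and X: "charted X" and Z: "charted Z"
    and f: "\<And>y. y \<in> points Y \<Longrightarrow> f y \<in> points Z \<and> mdiff_at Y Z f y" and y: "y \<in> points Y"
  obtains U g c W where "p y \<in> U" "local_section X Y Z p f U g c W"
proof -
  obtain W g where W: "y \<in> W" "openin (mtop Y) W" "openin (mtop X) (p ` W)"
    and g: "\<And>w. w \<in> W \<Longrightarrow> g (p w) = w" "\<And>x. x \<in> p ` W \<Longrightarrow> mdiff_at X Y g x"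
    using locally_biholo_local_inverse[OF p Y X y] by metis
  obtain c where c: "c \<in> atlas Z" "f y \<in> fst c"
    using charted_obtain_chart[OF Z] f[OF y] by blast
  have WY: "W \<subseteq> points Y"
    using W(2) openin_imp_subset by blast
  define U where "U = {x \<in> p ` W. f (g x) \<in> fst c}"
  have "\<exists>T. openin (mtop X) T \<and> x \<in> T \<and> T \<subseteq> U" if x: "x \<in> U" for x
  proof -
    have xW: "x \<in> p ` W" and fgx: "f (g x) \<in> fst c"
      using x by (simp_all add: U_def)
    have gx: "g x \<in> points Y"
      using xW g(1) WY by auto
    have "mdiff_at X Z (f \<circ> g) x"
      using f[OF gx] by (intro mdiff_at_compose[OF X Y gx g(2)[OF xW]]) simp
    moreover have "(f \<circ> g) x \<in> fst c"
      using fgx by simp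
    ultimately obtain T where T: "openin (mtop X) T" "x \<in> T" "(f \<circ> g) ` T \<subseteq> fst c"
      using mdiff_atD1 chartedD(1)[OF Z c(1)] by metis
    have "T \<inter> p ` W \<subseteq> U"
      using T(3) by (auto simp: U_def)
    then show ?thesis
      using T(1,2) W(3) xW by (intro exI[of _ "T \<inter> p ` W"]) auto
  qed
  then have "openin (mtop X) U"
    by (subst openin_subopen) blast
  moreover have "g x \<in> W \<and> p (g x) = x \<and> mdiff_at X Y g x \<and> f (g x) \<in> fst c" if "x \<in> U" for x
    using that g by (auto simp: U_def)
  ultimately have "local_section X Y Z p f U g c W"
    using W(2) c(1) g(1) by (simp add: local_section_def)
  moreover have "p y \<in> U"
    using W(1) g(1) c(2) by (simp add: U_def)
  ultimately show ?thesis
    using that by blast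
qed

text \<open>The coordinates have a holomorphic left inverse, namely the inverse chart of the model followed by the
  covering map.\<close>

lemma local_section_coordinates:
  fixes X :: "('a::topological_space, 'n::finite) mfd"
  assumes s: "local_section X Y Z p f U g c W" and X: "charted X" and Y: "charted Y" and Z: "charted Z"
    and p: "\<And>y. y \<in> points Y \<Longrightarrow> p y \<in> points X \<and> mdiff_at Y X p y"
    and f: "\<And>y. y \<in> points Y \<Longrightarrow> f y \<in> points Z \<and> mdiff_at Y Z f y"
    and f': "\<And>z. z \<in> points Z \<Longrightarrow> f' z \<in> points Y \<and> mdiff_at Z Y f' z" "\<And>y. y \<in> points Y \<Longrightarrow> f' (f y) = y"
    and \<phi>: "\<phi> \<in> atlas X" "x \<in> fst \<phi>" and x: "x \<in> U"
  shows "\<exists>A. (snd c \<circ> f \<circ> g \<circ> chart_inv \<phi> has_derivative (*v) A) (at (snd \<phi> x)) \<and> det A \<noteq> 0"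
proof -
  have U: "openin (mtop X) U" "openin (mtop Y) W" and c: "c \<in> atlas Z"
    and gx: "\<And>x. x \<in> U \<Longrightarrow> g x \<in> W \<and> p (g x) = x \<and> mdiff_at X Y g x \<and> f (g x) \<in> fst c"
    using s by (auto simp: local_section_def)
  have gY: "g x \<in> points Y" if "x \<in> U" for x
    using gx[OF that] U(2) openin_imp_subset by blast
  have fg: "mdiff_at X Z (f \<circ> g) x"
    by (rule mdiff_at_compose[where f = g, OF X Y gY[OF x]]) (use gx[OF x] f[OF gY[OF x]] in auto)
  have fgx: "(f \<circ> g) x \<in> fst c" "(f \<circ> g) x \<in> points Z"
    using gx[OF x] f[OF gY[OF x]] by simp_all
  obtain A where A: "(snd c \<circ> (f \<circ> g) \<circ> chart_inv \<phi> has_derivative (*v) A) (at (snd \<phi> x))"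
    by (rule mdiff_atD2[OF fg \<phi>(1) c \<phi>(2) fgx(1)])
  have left_inv: "(p \<circ> f') ((f \<circ> g) y) = y" if "y \<in> U" for y
    using f'(2)[OF gY[OF that]] gx[OF that] by simp
  have "mdiff_at Z X (p \<circ> f') ((f \<circ> g) x)"
  proof (rule mdiff_at_compose[OF Z Y])
    show f'Y: "f' ((f \<circ> g) x) \<in> points Y"
      using f'(1)[OF fgx(2)] by blast
    show "mdiff_at Z Y f' ((f \<circ> g) x)"
      using f'(1)[OF fgx(2)] by blast
    show "mdiff_at Y X p (f' ((f \<circ> g) x))"
      using p[OF f'Y] by blast
  qed
  then obtain E where E: "(snd \<phi> \<circ> (p \<circ> f') \<circ> chart_inv c has_derivative (*v) E) (at (snd c ((f \<circ> g) x)))"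
    by (rule mdiff_atD2[OF _ c \<phi>(1) fgx(1)]) (use left_inv[OF x] \<phi>(2) in simp)
  have "E ** A = mat 1"
    by (rule has_derivative_chart_inverse[OF X \<phi> Z c fgx(1) fg A E U(1) x left_inv])
  then have "det A \<noteq> 0"
    using det_mul[of E A] by (metis det_I mult_zero_right zero_neq_one)
  then show ?thesis
    using A by (auto simp: comp_assoc)
qed

text \<open>Near a common point of their domains two local sections differ by a deck transformation \<open>h\<close>, so the
  change between their coordinates is the automorphism of the model induced by \<open>h\<close>.\<close>

lemma local_section_transition:
  fixes X :: "('a::topological_space, 'n::finite) mfd" and Z :: "('c::topological_space, 'n) mfd"
  assumes s1: "local_section X Y Z p f U1 g1 c1 W1" and s2: "local_section X Y Z p f U2 g2 c2 W2"
    and X: "charted X" and Z: "rigid_coordinates Z" and Y: "universal_cover Y p X"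
    and f: "\<And>y. y \<in> points Y \<Longrightarrow> f y \<in> points Z \<and> mdiff_at Y Z f y"
    and f': "\<And>z. z \<in> points Z \<Longrightarrow> f' z \<in> points Y \<and> mdiff_at Z Y f' z"
      "\<And>y. y \<in> points Y \<Longrightarrow> f' (f y) = y" "\<And>z. z \<in> points Z \<Longrightarrow> f (f' z) = z"
    and x: "x \<in> U1" "x \<in> U2"
  obtains N where "monomial_matrix N"
    "\<forall>\<phi> A. \<phi> \<in> atlas X \<longrightarrow> x \<in> fst \<phi> \<longrightarrow> (snd c1 \<circ> f \<circ> g1 \<circ> chart_inv \<phi> has_derivative (*v) A) (at (snd \<phi> x)) \<longrightarrow>
       (snd c2 \<circ> f \<circ> g2 \<circ> chart_inv \<phi> has_derivative (*v) (N ** A)) (at (snd \<phi> x))"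
proof -
  have cov: "covering_space (points Y) p (points X)" and sc: "simply_connected (points Y)"
    and mY: "complex_manifold Y" and lb: "locally_biholo_map Y X p"
    using Y by (simp_all add: universal_cover_def)
  have cY: "charted Y"
    by (rule complex_manifold_charted[OF mY])
  have cZ: "charted Z"
    using Z by (simp add: rigid_coordinates_def)
  have pX: "p y \<in> points X" if "y \<in> points Y" for y
    using covering_space_imp_surjective[OF cov] that by blast
  have U1: "openin (mtop X) U1" "openin (mtop Y) W1" "c1 \<in> atlas Z"
    and g1: "\<And>x. x \<in> U1 \<Longrightarrow> g1 x \<in> W1 \<and> p (g1 x) = x \<and> mdiff_at X Y g1 x \<and> f (g1 x) \<in> fst c1"
    using s1 by (auto simp: local_section_def)
  have U2: "openin (mtop X) U2" "openin (mtop Y) W2" "c2 \<in> atlas Z" "\<And>w. w \<in> W2 \<Longrightarrow> g2 (p w) = w"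
    and g2: "\<And>x. x \<in> U2 \<Longrightarrow> g2 x \<in> W2 \<and> p (g2 x) = x \<and> mdiff_at X Y g2 x \<and> f (g2 x) \<in> fst c2"
    using s2 by (auto simp: local_section_def)
  have g1Y: "g1 x \<in> points Y" if "x \<in> U1" for x
    using g1[OF that] U1(2) openin_imp_subset by blast
  have g2Y: "g2 x \<in> points Y" if "x \<in> U2" for x
    using g2[OF that] U2(2) openin_imp_subset by blast
  have "p (g1 x) = p (g2 x)"
    using g1[OF x(1)] g2[OF x(2)] by simp
  from covering_deck_transformation[OF cov sc _ charted_path_connected_neighbourhood[OF cY] g1Y[OF x(1)] g2Y[OF x(2)] this]
  obtain h k where hk: "homeomorphism (points Y) (points Y) h k" and hx: "h (g1 x) = g2 x"
    and ph: "\<And>y. y \<in> points Y \<Longrightarrow> p (h y) = p y" and pk: "\<And>y. y \<in> points Y \<Longrightarrow> p (k y) = p y"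
    using mY unfolding complex_manifold_def by metis
  have hY: "h y \<in> points Y" "k y \<in> points Y" "k (h y) = y" "h (k y) = y" if "y \<in> points Y" for y
    using hk that unfolding homeomorphism_def by blast+
  have mh: "mdiff_at Y Y h y" if "y \<in> points Y" for y
    using hY by (intro covering_lift_mdiff[OF lb cY X homeomorphism_cont1[OF hk] _ ph pX that]) auto
  have mk: "mdiff_at Y Y k y" if "y \<in> points Y" for y
    using hY by (intro covering_lift_mdiff[OF lb cY X homeomorphism_cont2[OF hk] _ pk pX that]) auto
  \<comment> \<open>The deck transformation, transported to the model.\<close>
  define F where "F = f \<circ> (h \<circ> f')"
  define G where "G = f \<circ> (k \<circ> f')"
  have mFG: "mdiff_at Z Z (f \<circ> (m \<circ> f')) z" if z: "z \<in> points Z"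
    and m: "\<And>y. y \<in> points Y \<Longrightarrow> m y \<in> points Y \<and> mdiff_at Y Y m y" for m z
  proof (rule mdiff_at_compose[OF cZ cY])
    have f'z: "f' z \<in> points Y" "mdiff_at Z Y f' z"
      using f'(1)[OF z] by simp_all
    show mf'z: "(m \<circ> f') z \<in> points Y"
      using m[OF f'z(1)] by simp
    show "mdiff_at Z Y (m \<circ> f') z"
      using m[OF f'z(1)] by (intro mdiff_at_compose[OF cZ cY f'z]) simp
    show "mdiff_at Y Z f ((m \<circ> f') z)"
      using f[OF mf'z] by simp
  qed
  have aut: "mfd_automorphism Z F G"
    unfolding mfd_automorphism_def
  proof (intro ballI conjI)
    fix z assume z: "z \<in> points Z"
    then have f'z: "f' z \<in> points Y"
      using f'(1) by blast
    show "F z \<in> points Z" "G z \<in> points Z"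
      using f hY f'z by (simp_all add: F_def G_def)
    show "mdiff_at Z Z F z"
      unfolding F_def by (rule mFG[OF z]) (simp add: hY mh)
    show "mdiff_at Z Z G z"
      unfolding G_def by (rule mFG[OF z]) (simp add: hY mk)
    show "G (F z) = z" "F (G z) = z"
      using f'z hY f'(2,3) z by (simp_all add: F_def G_def)
  qed
  define y where "y = g1 x"
  have y: "y \<in> points Y"
    using g1Y[OF x(1)] by (simp add: y_def)
  have fy: "f y \<in> fst c1" "f y \<in> points Z" "F (f y) = f (g2 x)"
    using g1[OF x(1)] f[OF y] f'(2)[OF y] hx by (simp_all add: y_def F_def)
  have Ffy: "F (f y) \<in> fst c2"
    using fy(3) g2[OF x(2)] by simp
  have mF: "mdiff_at Z Z F (f y)"
    using aut fy(2) by (simp add: mfd_automorphism_def)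
  obtain N where N: "(snd c2 \<circ> F \<circ> chart_inv c1 has_derivative (*v) N) (at (snd c1 (f y)))"
    by (rule mdiff_atD2[OF mF U1(3) U2(3) fy(1) Ffy])
  have "monomial_matrix N"
    using Z aut U1(3) fy(1) U2(3) Ffy N unfolding rigid_coordinates_def by blast
  moreover have "(snd c2 \<circ> f \<circ> g2 \<circ> chart_inv \<phi> has_derivative (*v) (N ** A)) (at (snd \<phi> x))"
    if \<phi>: "\<phi> \<in> atlas X" "x \<in> fst \<phi>" and A: "(snd c1 \<circ> f \<circ> g1 \<circ> chart_inv \<phi> has_derivative (*v) A) (at (snd \<phi> x))"
    for \<phi> A
  proof -
    have g1x: "mdiff_at X Y g1 x"
      using g1[OF x(1)] by simp
    have fg1: "mdiff_at X Z (f \<circ> g1) x"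
      by (rule mdiff_at_compose[OF X cY g1Y[OF x(1)] g1x]) (use f[OF g1Y[OF x(1)]] in simp)
    have 1: "(snd c2 \<circ> (F \<circ> (f \<circ> g1)) \<circ> chart_inv \<phi> has_derivative (*v) (N ** A)) (at (snd \<phi> x))"
      by (rule has_derivative_chart_compose[OF X \<phi> cZ U1(3) _ fg1])
         (use fy A N in \<open>simp_all add: y_def comp_assoc\<close>)
    have "mdiff_at X Y (h \<circ> g1) x"
      by (rule mdiff_at_compose[OF X cY g1Y[OF x(1)] g1x mh[OF g1Y[OF x(1)]]])
    moreover have "(h \<circ> g1) x \<in> W2"
      using hx g2[OF x(2)] by simp
    ultimately obtain T where T: "openin (mtop X) T" "x \<in> T" "(h \<circ> g1) ` T \<subseteq> W2"
      using mdiff_atD1 U2(2) by metis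
    have "(snd c2 \<circ> (f \<circ> g2) \<circ> chart_inv \<phi> has_derivative (*v) (N ** A)) (at (snd \<phi> x))"
    proof (rule has_derivative_chart_cong[OF X \<phi> _ _ _ 1])
      show "openin (mtop X) (T \<inter> U1)" "x \<in> T \<inter> U1"
        using T U1(1) x by auto
      show "(F \<circ> (f \<circ> g1)) x' = (f \<circ> g2) x'" if x': "x' \<in> T \<inter> U1" for x'
      proof -
        have "h (g1 x') \<in> W2"
          using T(3) x' by auto
        then have "g2 (p (h (g1 x'))) = h (g1 x')"
          by (rule U2(4))
        moreover have "p (h (g1 x')) = x'"
          using ph[OF g1Y] g1 x' by simp
        ultimately show ?thesis
          using f'(2)[OF g1Y] x' by (simp add: F_def)
      qed
    qed
    then show ?thesis
      by (simp add: comp_assoc)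
  qed
  ultimately show ?thesis
    by (intro that[of N] allI impI)
qed

text \<open>The coordinates at \<open>a\<close> are those of the model composed with a local section of the covering through \<open>a\<close>.\<close>

theorem semi_special_tensor_of_rigid_cover:
  fixes X :: "('a::topological_space, 'n::finite) mfd" and Y :: "('b::topological_space, 'n) mfd"
    and Z :: "('c::topological_space, 'n) mfd"
  assumes X: "complex_manifold X" and Y: "universal_cover Y p X" and YZ: "biholomorphic Y Z"
    and Z: "rigid_coordinates Z"
  shows "\<exists>(\<eta> :: ('a, 'a) line_bundle) \<omega>. semi_special_tensor X \<eta> \<omega>"
proof -
  have cov: "covering_space (points Y) p (points X)" and mY: "complex_manifold Y"
    and lb: "locally_biholo_map Y X p"
    using Y by (simp_all add: universal_cover_def)
  have cX: "charted X" and cY: "charted Y" and cZ: "charted Z"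
    using complex_manifold_charted X mY Z by (auto simp: rigid_coordinates_def)
  obtain f f' where hf: "holo_map Y Z f" and hf': "holo_map Z Y f'" and ff': "\<forall>y\<in>points Y. f' (f y) = y" "\<forall>z\<in>points Z. f (f' z) = z"
    using YZ unfolding biholomorphic_def biholo_map_def by blast
  have "f ` points Y \<subseteq> points Z" "f' ` points Z \<subseteq> points Y"
    using hf hf' by (simp_all add: holo_map_def)
  then have f: "\<And>y. y \<in> points Y \<Longrightarrow> f y \<in> points Z \<and> mdiff_at Y Z f y"
    and f': "\<And>z. z \<in> points Z \<Longrightarrow> f' z \<in> points Y \<and> mdiff_at Z Y f' z"
    using holo_map_mdiff_at[OF hf] holo_map_mdiff_at[OF hf'] by blast+
  have p: "p y \<in> points X \<and> mdiff_at Y X p y" if "y \<in> points Y" for y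
  proof
    show "p y \<in> points X"
      using covering_space_imp_surjective[OF cov] that by blast
    show "mdiff_at Y X p y"
      using locally_biholo_local_inverse[OF lb cY cX that] by metis
  qed
  have "\<exists>U g c W. a \<in> U \<and> local_section X Y Z p f U g c W" if a: "a \<in> points X" for a
  proof -
    have "a \<in> p ` points Y"
      using a by (simp add: covering_space_imp_surjective[OF cov])
    then obtain y where y: "y \<in> points Y" "p y = a"
      by blast
    obtain U g c W where "p y \<in> U" "local_section X Y Z p f U g c W"
      by (rule local_section_exists[OF lb cY cX cZ f y(1)])
    then show ?thesis
      using y(2) by blast
  qed
  then have "\<forall>a. \<exists>q. a \<in> points X \<longrightarrow> a \<in> fst q \<and>
      local_section X Y Z p f (fst q) (fst (snd q)) (fst (snd (snd q))) (snd (snd (snd q)))"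
    by (simp add: split_paired_Ex)
  from choice[OF this] obtain q where q: "\<And>a. a \<in> points X \<Longrightarrow> a \<in> fst (q a) \<and>
      local_section X Y Z p f (fst (q a)) (fst (snd (q a))) (fst (snd (snd (q a)))) (snd (snd (snd (q a))))"
    by blast
  define U where "U a = fst (q a)" for a
  define g where "g a = fst (snd (q a))" for a
  define c where "c a = fst (snd (snd (q a)))" for a
  define W where "W a = snd (snd (snd (q a)))" for a
  have s: "a \<in> U a \<and> local_section X Y Z p f (U a) (g a) (c a) (W a)" if "a \<in> points X" for a
    using q[OF that] by (simp add: U_def g_def c_def W_def)
  have f'f: "f' (f y) = y" if "y \<in> points Y" for y
    using ff'(1) that by blast
  have ff'z: "f (f' z) = z" if "z \<in> points Z" for z
    using ff'(2) that by blast
  interpret monomial_coordinates X U "\<lambda>a. snd (c a) \<circ> f \<circ> g a"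
  proof
    show "complex_manifold X"
      by (rule X)
    show "openin (mtop X) (U a)" if "a \<in> points X" for a
      using s[OF that] by (simp add: local_section_def)
    show "a \<in> U a" if "a \<in> points X" for a
      using s[OF that] by simp
    show coord: "\<exists>A. (snd (c a) \<circ> f \<circ> g a \<circ> chart_inv \<phi> has_derivative (*v) A) (at (snd \<phi> x)) \<and> det A \<noteq> 0"
      if "a \<in> points X" "\<phi> \<in> atlas X" "x \<in> fst \<phi>" "x \<in> U a" for a \<phi> x
      by (rule local_section_coordinates[OF conjunct2[OF s[OF that(1)]] cX cY cZ p f f' f'f that(2-4)])
    show "\<exists>N. monomial_matrix N \<and> (\<forall>\<phi>\<in>atlas X. x \<in> fst \<phi> \<longrightarrow>
        jacobian_at (snd (c a) \<circ> f \<circ> g a \<circ> chart_inv \<phi>) (snd \<phi> x) =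
        N ** jacobian_at (snd (c b) \<circ> f \<circ> g b \<circ> chart_inv \<phi>) (snd \<phi> x))"
      if ab: "a \<in> points X" "b \<in> points X" and x: "x \<in> U a" "x \<in> U b" for a b x
    proof -
      from local_section_transition[OF conjunct2[OF s[OF ab(2)]] conjunct2[OF s[OF ab(1)]] cX Z Y f f' f'f ff'z x(2,1)]
      obtain N where N: "monomial_matrix N"
        "\<forall>\<phi> A. \<phi> \<in> atlas X \<longrightarrow> x \<in> fst \<phi> \<longrightarrow>
         (snd (c b) \<circ> f \<circ> g b \<circ> chart_inv \<phi> has_derivative (*v) A) (at (snd \<phi> x)) \<longrightarrow>
         (snd (c a) \<circ> f \<circ> g a \<circ> chart_inv \<phi> has_derivative (*v) (N ** A)) (at (snd \<phi> x))" .
      have "jacobian_at (snd (c a) \<circ> f \<circ> g a \<circ> chart_inv \<phi>) (snd \<phi> x) =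
          N ** jacobian_at (snd (c b) \<circ> f \<circ> g b \<circ> chart_inv \<phi>) (snd \<phi> x)"
        if \<phi>: "\<phi> \<in> atlas X" "x \<in> fst \<phi>" for \<phi>
      proof -
        obtain A where A: "(snd (c b) \<circ> f \<circ> g b \<circ> chart_inv \<phi> has_derivative (*v) A) (at (snd \<phi> x))"
          using coord[OF ab(2) \<phi> x(2)] by blast
        show ?thesis
          using jacobian_at_eq[OF A] jacobian_at_eq[OF N(2)[rule_format, OF \<phi> A]] by simp
      qed
      then show ?thesis
        using N(1) by blast
    qed
  qed
  show ?thesis
    using semi_special_tensor by blast
qed

theorem proposition1p4:
  fixes X :: "('a::topological_space, 'n::finite) mfd"
    and Y :: "('b::topological_space, 'n) mfd"
    and p :: "'b \<Rightarrow> 'a"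
  assumes "complex_manifold X" and "compact (points X)"
    and "universal_cover Y p X"
    and "biholomorphic Y (mfd_power projective_line :: (proj_line ^ 'n, 'n) mfd) \<or>
         biholomorphic Y (mfd_power upper_half_plane :: (complex ^ 'n, 'n) mfd)"
  shows "\<exists>(\<eta> :: ('a, 'a) line_bundle) \<omega>. semi_special_tensor X \<eta> \<omega>"
  using assms(4)
proof
  assume "biholomorphic Y (mfd_power projective_line :: (proj_line ^ 'n, 'n) mfd)"
  then show ?thesis
    by (rule semi_special_tensor_of_rigid_cover[OF assms(1,3) _ rigid_projective_line_power])
next
  assume "biholomorphic Y (mfd_power upper_half_plane :: (complex ^ 'n, 'n) mfd)"
  then show ?thesis
    by (rule semi_special_tensor_of_rigid_cover[OF assms(1,3) _ rigid_half_plane_power])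
qed

end
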